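(* Let $G$ be a complex torus and $V$ a faithful $1$-modular $G$-module, with shell $N\subset U=V\oplus V^*$. Let $H\subset G$ be the isotropy group of a nonzero closed $G$-orbit in $N$. Then there is a Lagrangian $G$-submodule $V_1$ of $U$ (so $U\simeq V_1\oplus V_1^*$, with the same moment mapping and shell up to isomorphism) such that $V_1$ is a stable $G$-module, the fixed space $V_1^H$ is a stable $G$-module, and $H$ is the principal isotropy group of the $G$-module $V_1^H$.
   Context: Everything is over $\mathbb{C}$; a $G$-module is a finite-dimensional rational representation. For a reductive complex group $G$ with Lie algebra $\mathfrak{g}$ and a $G$-module $V$, let $U=V\oplus V^*$ with its canonical $G$-invariant symplectic form, let $\mu\colon U\to\mathfrak{g}^*$, $\mu(v,\xi)(A)=\xi(Av)$, be the canonical moment mapping, and let the shell be $N=\mu^{-1}(0)$. Let $V_{(r)}=\{v\in V\mid \dim G_v=r\}$. $V$ is $k$-modular if $\operatorname{codim}_V V_{(r)}\geq r+k$ for $1\leq r\leq \dim G$. A $G$-module (or affine $G$-variety) is stable if it contains a nonempty open subset consisting of closed $G$-orbits. For an affine $G$-variety $X$ with categorical quotient $X/\!\!/G$ (whose points correspond to the closed $G$-orbits in $X$), there is a unique open dense stratum of $X/\!\!/G$ consisting of the points whose closed orbits have isotropy group in one fixed conjugacy class; the groups in this class are the principal isotropy groups of $X$. *)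

theory Defs
  imports "HOL-Analysis.Analysis"
begin

inductive polyfun :: "(complex^'k \<Rightarrow> complex) \<Rightarrow> bool" where
  const: "polyfun (\<lambda>x. c)"
| coord: "polyfun (\<lambda>x. x $ i)"
| add: "polyfun f \<Longrightarrow> polyfun g \<Longrightarrow> polyfun (\<lambda>x. f x + g x)"
| mult: "polyfun f \<Longrightarrow> polyfun g \<Longrightarrow> polyfun (\<lambda>x. f x * g x)"

definition zariski :: "(complex^'k) topology" where
  "zariski = topology_generated_by {{x. f x \<noteq> 0} | f. polyfun f}"

definition irreducible_in :: "'a topology \<Rightarrow> 'a set \<Rightarrow> bool" where
  "irreducible_in T S \<longleftrightarrow> S \<noteq> {} \<and> S \<subseteq> topspace T \<and>
     (\<forall>A B. closedin T A \<and> closedin T B \<and> S \<subseteq> A \<union> B \<longrightarrow> S \<subseteq> A \<or> S \<subseteq> B)"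

text \<open>The empty space has no chains, so its dimension is \<open>Sup {} = - \<infinity>\<close>.\<close>

definition krull_dim :: "'a topology \<Rightarrow> ereal" where
  "krull_dim T = Sup {ereal (real k) | k.
     \<exists>Z. (\<forall>i\<le>k. closedin T (Z i) \<and> irreducible_in T (Z i)) \<and> (\<forall>i<k. Z i \<subset> Z (Suc i))}"

definition zdim :: "(complex^'k) set \<Rightarrow> ereal" where
  "zdim X = krull_dim (subtopology zariski X)"

definition zcodim :: "(complex^'k) set \<Rightarrow> ereal" where
  "zcodim X = ereal (real CARD('k)) - zdim X"

text \<open>
  The torus of rank \<open>card J\<close> inside the invertible diagonal matrices. The group operation is
  the componentwise product. The index set \<open>J\<close> may be empty, which gives the trivial torus.
\<close>

definition torus :: "'n set \<Rightarrow> (complex^'n::finite) set" where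
  "torus J = {t. (\<forall>i\<in>J. t $ i \<noteq> 0) \<and> (\<forall>i. i \<notin> J \<longrightarrow> t $ i = 1)}"

definition vinv :: "complex^'n \<Rightarrow> complex^'n" where
  "vinv t = (\<chi> i. inverse (t $ i))"

definition vexp :: "complex^'n \<Rightarrow> complex^'n" where
  "vexp a = (\<chi> i. exp (a $ i))"

definition lie_algebra :: "(complex^'n) set \<Rightarrow> (complex^'n) set" where
  "lie_algebra G = {a. \<forall>s. vexp (s *s a) \<in> G}"

text \<open>
  The coordinate ring of a closed subgroup of the invertible diagonal matrices is generated by
  the coordinates and the inverse of their product.
\<close>

definition regular_on :: "(complex^'n) set \<Rightarrow> (complex^'n \<Rightarrow> complex) \<Rightarrow> bool" where
  "regular_on G f \<longleftrightarrow>
     (\<exists>p k. polyfun p \<and> (\<forall>t\<in>G. f t = p t / (\<Prod>i\<in>UNIV. t $ i) ^ k))"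

definition rational_rep :: "(complex^'n) set \<Rightarrow> (complex^'n \<Rightarrow> complex^'m^'m) \<Rightarrow> bool" where
  "rational_rep G \<rho> \<longleftrightarrow>
     \<rho> 1 = mat 1 \<and>
     (\<forall>s\<in>G. \<forall>t\<in>G. \<rho> (s * t) = \<rho> s ** \<rho> t) \<and>
     (\<forall>i j. regular_on G (\<lambda>t. \<rho> t $ i $ j))"

definition submodule ::
    "(complex^'n) set \<Rightarrow> (complex^'n \<Rightarrow> complex^'m^'m) \<Rightarrow> (complex^'m) set \<Rightarrow> bool" where
  "submodule G \<rho> W \<longleftrightarrow> vec.subspace W \<and> (\<forall>t\<in>G. \<forall>w\<in>W. \<rho> t *v w \<in> W)"

definition fixed_space ::
    "(complex^'n) set \<Rightarrow> (complex^'n \<Rightarrow> complex^'m^'m) \<Rightarrow> (complex^'m) set \<Rightarrow> (complex^'m) set" where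
  "fixed_space H \<rho> W = {w \<in> W. \<forall>h\<in>H. \<rho> h *v w = w}"

definition orbit ::
    "(complex^'n) set \<Rightarrow> (complex^'n \<Rightarrow> complex^'m^'m) \<Rightarrow> complex^'m \<Rightarrow> (complex^'m) set" where
  "orbit G \<rho> x = (\<lambda>t. \<rho> t *v x) ` G"

definition isotropy ::
    "(complex^'n) set \<Rightarrow> (complex^'n \<Rightarrow> complex^'m^'m) \<Rightarrow> complex^'m \<Rightarrow> (complex^'n) set" where
  "isotropy G \<rho> x = {t \<in> G. \<rho> t *v x = x}"

definition modular :: "nat \<Rightarrow> (complex^'n) set \<Rightarrow> (complex^'n \<Rightarrow> complex^'m^'m) \<Rightarrow> bool" where
  "modular k G \<rho> \<longleftrightarrow>
     (\<forall>r::nat. 1 \<le> r \<and> ereal (real r) \<le> zdim G \<longrightarrow>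
        ereal (real (r + k)) \<le> zcodim {v. zdim (isotropy G \<rho> v) = ereal (real r)})"

text \<open>Here \<open>X\<close> is a Zariski closed \<open>G\<close>-invariant subset of the representation space.\<close>

definition closed_orbits ::
    "(complex^'n) set \<Rightarrow> (complex^'n \<Rightarrow> complex^'m^'m) \<Rightarrow> (complex^'m) set \<Rightarrow> (complex^'m) set set" where
  "closed_orbits G \<rho> X =
     {C. \<exists>x\<in>X. C = orbit G \<rho> x \<and> closedin (subtopology zariski X) C}"

definition stable_variety ::
    "(complex^'n) set \<Rightarrow> (complex^'n \<Rightarrow> complex^'m^'m) \<Rightarrow> (complex^'m) set \<Rightarrow> bool" where
  "stable_variety G \<rho> X \<longleftrightarrow>
     (\<exists>\<O>. openin (subtopology zariski X) \<O> \<and> \<O> \<noteq> {} \<and>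
        (\<forall>x\<in>\<O>. orbit G \<rho> x \<subseteq> \<O> \<and> orbit G \<rho> x \<in> closed_orbits G \<rho> X))"

text \<open>
  The categorical quotient is the variety with coordinate ring the invariant regular functions
  on \<open>X\<close>. Its points are the closed orbits, and the non-vanishing loci of the invariants form a
  basis of its Zariski topology.
\<close>

definition invariant_on ::
    "(complex^'n) set \<Rightarrow> (complex^'n \<Rightarrow> complex^'m^'m) \<Rightarrow> (complex^'m) set \<Rightarrow> (complex^'m \<Rightarrow> complex) \<Rightarrow> bool" where
  "invariant_on G \<rho> X f \<longleftrightarrow> (\<forall>t\<in>G. \<forall>x\<in>X. f (\<rho> t *v x) = f x)"

definition categorical_quotient ::
    "(complex^'n) set \<Rightarrow> (complex^'n \<Rightarrow> complex^'m^'m) \<Rightarrow> (complex^'m) set \<Rightarrow> (complex^'m) set topology" where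
  "categorical_quotient G \<rho> X = topology_generated_by
     {{C \<in> closed_orbits G \<rho> X. \<forall>x\<in>C. f x \<noteq> 0} | f. polyfun f \<and> invariant_on G \<rho> X f}"

text \<open>
  The isotropy groups of the points of one orbit form a conjugacy class, so the stratum of the
  conjugacy class of \<open>K\<close> consists of the closed orbits on which \<open>K\<close> occurs as an isotropy group.
\<close>

definition isotropy_stratum ::
    "(complex^'n) set \<Rightarrow> (complex^'n \<Rightarrow> complex^'m^'m) \<Rightarrow> (complex^'m) set \<Rightarrow> (complex^'n) set \<Rightarrow> (complex^'m) set set" where
  "isotropy_stratum G \<rho> X K = {C \<in> closed_orbits G \<rho> X. \<exists>x\<in>C. isotropy G \<rho> x = K}"

definition principal_isotropy ::
    "(complex^'n) set \<Rightarrow> (complex^'n \<Rightarrow> complex^'m^'m) \<Rightarrow> (complex^'m) set \<Rightarrow> (complex^'n) set \<Rightarrow> bool" where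
  "principal_isotropy G \<rho> X K \<longleftrightarrow>
     openin (categorical_quotient G \<rho> X) (isotropy_stratum G \<rho> X K) \<and>
     categorical_quotient G \<rho> X closure_of isotropy_stratum G \<rho> X K = topspace (categorical_quotient G \<rho> X)"

text \<open>
  An element \<open>u\<close> of \<open>complex^('m + 'm)\<close> stands for a pair \<open>(v, \<xi>)\<close> of a vector and a covector.
  The coordinates \<open>Inl i\<close> are those of \<open>v\<close>, and the coordinates \<open>Inr i\<close> are those of \<open>\<xi>\<close> in the
  dual basis.
\<close>

definition vpart :: "complex^('m::finite + 'm) \<Rightarrow> complex^'m" where
  "vpart u = (\<chi> i. u $ Inl i)"

definition dpart :: "complex^('m::finite + 'm) \<Rightarrow> complex^'m" where
  "dpart u = (\<chi> i. u $ Inr i)"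

definition pairing :: "complex^'m \<Rightarrow> complex^'m \<Rightarrow> complex" where
  "pairing \<xi> v = (\<Sum>i\<in>UNIV. \<xi> $ i * v $ i)"

definition symp :: "complex^('m::finite + 'm) \<Rightarrow> complex^('m + 'm) \<Rightarrow> complex" where
  "symp u w = pairing (dpart w) (vpart u) - pairing (dpart u) (vpart w)"

definition lagrangian :: "(complex^('m::finite + 'm)) set \<Rightarrow> bool" where
  "lagrangian W \<longleftrightarrow> vec.subspace W \<and> W = {u. \<forall>w\<in>W. symp u w = 0}"

definition dual_rep :: "(complex^'n \<Rightarrow> complex^'m^'m) \<Rightarrow> complex^'n \<Rightarrow> complex^'m^'m" where
  "dual_rep \<rho> t = transpose (\<rho> (vinv t))"

definition double_rep ::
    "(complex^'n \<Rightarrow> complex^'m^'m) \<Rightarrow> complex^'n \<Rightarrow> complex^('m::finite + 'm)^('m + 'm)" where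
  "double_rep \<rho> t = (\<chi> i j. case (i, j) of
       (Inl a, Inl b) \<Rightarrow> \<rho> t $ a $ b
     | (Inr a, Inr b) \<Rightarrow> dual_rep \<rho> t $ a $ b
     | _ \<Rightarrow> 0)"

definition infinitesimal :: "(complex^'n \<Rightarrow> complex^'m^'m) \<Rightarrow> complex^'n \<Rightarrow> complex^'m^'m" where
  "infinitesimal \<rho> a = (\<chi> i j. deriv (\<lambda>s. \<rho> (vexp (s *s a)) $ i $ j) 0)"

definition moment :: "(complex^'n \<Rightarrow> complex^'m^'m) \<Rightarrow> complex^('m::finite + 'm) \<Rightarrow> complex^'n \<Rightarrow> complex" where
  "moment \<rho> u a = pairing (dpart u) (infinitesimal \<rho> a *v vpart u)"

definition shell :: "(complex^'n) set \<Rightarrow> (complex^'n \<Rightarrow> complex^'m^'m) \<Rightarrow> (complex^('m::finite + 'm)) set" where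
  "shell G \<rho> = {u. \<forall>a\<in>lie_algebra G. moment \<rho> u a = 0}"

text \<open>
  The module \<open>\<sigma>\<close> is a copy of \<open>W\<close> in coordinates: \<open>\<Phi>\<close> is an equivariant symplectic isomorphism
  from the double of \<open>\<sigma>\<close> to the double of \<open>\<rho>\<close> that maps the module \<open>\<sigma>\<close> itself onto \<open>W\<close> and
  matches the two moment mappings and the two shells.
\<close>

definition double_iso ::
    "(complex^'n) set \<Rightarrow> (complex^'n \<Rightarrow> complex^'m^'m) \<Rightarrow> (complex^'n \<Rightarrow> complex^'m^'m) \<Rightarrow>
     (complex^('m::finite + 'm)) set \<Rightarrow> complex^('m + 'm)^('m + 'm) \<Rightarrow> bool" where
  "double_iso G \<sigma> \<rho> W \<Phi> \<longleftrightarrow>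
     invertible \<Phi> \<and>
     (\<forall>t\<in>G. \<Phi> ** double_rep \<sigma> t = double_rep \<rho> t ** \<Phi>) \<and>
     (\<forall>u w. symp (\<Phi> *v u) (\<Phi> *v w) = symp u w) \<and>
     (\<lambda>u. \<Phi> *v u) ` {u. dpart u = 0} = W \<and>
     (\<forall>u. \<forall>a\<in>lie_algebra G. moment \<rho> (\<Phi> *v u) a = moment \<sigma> u a) \<and>
     (\<lambda>u. \<Phi> *v u) ` shell G \<sigma> = shell G \<rho>"

end

theory Submission
  imports Defs
begin

text \<open>
  Diagonalize the torus action: in suitable coordinates \<open>V\<close> has weights \<open>w k\<close>, and the double has
  the weights \<open>w k\<close> and \<open>- w k\<close>. The orbit of a point is closed if and only if the weights on its
  support satisfy a linear relation with strictly positive coefficients: if there is none, then by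
  Stiemke's lemma a one-parameter group moves the point out of its orbit in the limit, and the
  converse uses invariant monomials and the divisibility of the multiplicative group. Hence a
  Lagrangian coordinate subspace, given by a choice of signs, is stable if and only if some relation
  between the \<open>w k\<close> has exactly these signs.

  Faithfulness and 1-modularity imply that every weight occurs in some relation, so that there is a
  relation \<open>d\<close> without zero coefficients. If \<open>u\<close> is a point of the shell with closed orbit and
  isotropy group \<open>H\<close>, then every weight that is trivial on \<open>H\<close> occurs in a relation between such
  weights: for a weight on the support of \<open>u\<close> take the positive relation or, if both coordinates
  of \<open>u\<close> are nonzero, the equation of the shell. This gives a relation \<open>c\<close> whose support is
  exactly the set of weights trivial on \<open>H\<close>. The signs of \<open>c + \<delta> d\<close> for small \<open>\<delta> > 0\<close>
  define \<open>V1\<close>.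
\<close>

subsection \<open>The Zariski topology\<close>

text \<open>One choice of signs has to serve two stability claims at once, for \<open>V1\<close> and
  for the subspace fixed by \<open>H\<close>. The sum of c and \<delta> d reconciles them: it keeps
  the signs of c on the weights trivial on \<open>H\<close> and takes those of d on all others.
  \<open>H\<close> is the common kernel of the weights on the support of \<open>u\<close>. Since
  these are among the weights trivial on \<open>H\<close>, the common kernel of all weights trivial
  on \<open>H\<close> is again \<open>H\<close>, and this kernel is the principal isotropy group of
  the fixed space. Most relations are real: the shell yields complex ones, of which real and
  imaginary parts are taken, and separation arguments yield real ones. Only supports and signs
  matter, so they can be replaced by integral relations with the same signs, whose coefficients
  serve as exponents of invariant monomials. The group \<open>H\<close> may be disconnected, so it
  is handled through values of characters and not through spans of weights. Krull dimension enters
  only through explicit chains: a lower bound for the generic part of a hyperplane, and the value 1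
  for a one-parameter group.\<close>

lemma polyfun_uminus: "polyfun f \<Longrightarrow> polyfun (\<lambda>x. - f x)"
  using polyfun.mult[OF polyfun.const[of "-1"], of f] by simp

lemma polyfun_diff: "polyfun f \<Longrightarrow> polyfun g \<Longrightarrow> polyfun (\<lambda>x. f x - g x)"
  using polyfun.add[OF _ polyfun_uminus, of f g] by simp

lemma polyfun_sum: "(\<And>i. i \<in> I \<Longrightarrow> polyfun (f i)) \<Longrightarrow> polyfun (\<lambda>x. \<Sum>i\<in>I. f i x)"
  by (induction I rule: infinite_finite_induct) (auto intro: polyfun.intros)

lemma polyfun_power: "polyfun f \<Longrightarrow> polyfun (\<lambda>x. f x ^ n)"
  by (induction n) (auto intro: polyfun.intros)

lemma polyfun_prod: "(\<And>i. i \<in> I \<Longrightarrow> polyfun (f i)) \<Longrightarrow> polyfun (\<lambda>x. \<Prod>i\<in>I. f i x)"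
  by (induction I rule: infinite_finite_induct) (auto intro: polyfun.intros)

lemma polyfun_linear: "polyfun (\<lambda>x. ((A::complex^'k^'l) *v x) $ i)"
  unfolding matrix_vector_mult_def
  by (simp, intro polyfun_sum polyfun.mult polyfun.const polyfun.coord)

lemma continuous_on_polyfun: "polyfun f \<Longrightarrow> continuous_on UNIV f"
  by (induction rule: polyfun.induct) (auto intro!: continuous_intros)

lemma polyfun_on_line:
  assumes "polyfun p"
  obtains P where "\<And>c. p (x + c *s v) = poly P c"
  using assms
proof (induction arbitrary: thesis rule: polyfun.induct)
  case (const c)
  show ?case by (rule const[of "[:c:]"]) simp
next
  case (coord i)
  show ?case by (rule coord[of "[:x $ i, v $ i:]"]) simp
next
  case (add f g)
  from add.IH obtain P Q where "\<And>c. f (x + c *s v) = poly P c" "\<And>c. g (x + c *s v) = poly Q c"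
    by metis
  then show ?case by (intro add.prems[of "P + Q"]) simp
next
  case (mult f g)
  from mult.IH obtain P Q where "\<And>c. f (x + c *s v) = poly P c" "\<And>c. g (x + c *s v) = poly Q c"
    by metis
  then show ?case by (intro mult.prems[of "P * Q"]) simp
qed

text \<open>The product of two polynomials shows that the principal open sets are stable under
  intersection, so they form a basis and not just a subbasis.\<close>

lemma openin_zariski_iff:
  "openin zariski U \<longleftrightarrow> (\<forall>x\<in>U. \<exists>p. polyfun p \<and> p x \<noteq> 0 \<and> {y. p y \<noteq> 0} \<subseteq> U)"
proof
  assume "openin zariski U"
  then have "generate_topology_on {{x. f x \<noteq> 0} | f. polyfun f} U"
    unfolding zariski_def by (rule openin_topology_generated_by)
  then show "\<forall>x\<in>U. \<exists>p. polyfun p \<and> p x \<noteq> 0 \<and> {y. p y \<noteq> 0} \<subseteq> U"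
  proof (induction rule: generate_topology_on.induct)
    case (Int a b)
    show ?case
    proof
      fix x assume "x \<in> a \<inter> b"
      then obtain p q where "polyfun p" "p x \<noteq> 0" "{y. p y \<noteq> 0} \<subseteq> a"
        "polyfun q" "q x \<noteq> 0" "{y. q y \<noteq> 0} \<subseteq> b"
        using Int.IH by blast
      then show "\<exists>p. polyfun p \<and> p x \<noteq> 0 \<and> {y. p y \<noteq> 0} \<subseteq> a \<inter> b"
        by (intro exI[of _ "\<lambda>x. p x * q x"]) (auto intro: polyfun.mult)
    qed
  next
    case (UN K)
    then show ?case by (meson Union_iff Union_upper order_trans)
  qed auto
next
  assume *: "\<forall>x\<in>U. \<exists>p. polyfun p \<and> p x \<noteq> 0 \<and> {y. p y \<noteq> 0} \<subseteq> U"
  have "openin zariski (\<Union>{{y. p y \<noteq> 0} | p. polyfun p \<and> {y. p y \<noteq> 0} \<subseteq> U})"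
    unfolding zariski_def by (rule openin_Union) (auto intro!: topology_generated_by_Basis)
  moreover have "\<Union>{{y. p y \<noteq> 0} | p. polyfun p \<and> {y. p y \<noteq> 0} \<subseteq> U} = U"
    using * by blast
  ultimately show "openin zariski U" by simp
qed

lemma topspace_zariski [simp]: "topspace zariski = UNIV"
proof -
  have "openin zariski UNIV"
    unfolding openin_zariski_iff by (auto intro!: exI[of _ "\<lambda>x. 1"] polyfun.const)
  then show ?thesis using openin_subset by auto
qed

lemma closedin_zariski_iff:
  "closedin zariski C \<longleftrightarrow> (\<forall>x. x \<notin> C \<longrightarrow> (\<exists>p. polyfun p \<and> (\<forall>y\<in>C. p y = 0) \<and> p x \<noteq> 0))"
  unfolding closedin_def openin_zariski_iff by auto blast+

lemma closedin_zariski_zeros: "polyfun p \<Longrightarrow> closedin zariski {x. p x = 0}"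
  unfolding closedin_zariski_iff by auto

text \<open>This allows limits in the Euclidean topology to refute Zariski closedness of an
  orbit.\<close>

lemma closed_if_closedin_zariski:
  assumes "closedin zariski C"
  shows "closed C"
proof -
  have "C = (\<Inter>p\<in>{p. polyfun p \<and> (\<forall>y\<in>C. p y = 0)}. {x. p x = 0})"
    using assms unfolding closedin_zariski_iff by blast
  moreover have "closed \<dots>"
    by (intro closed_INT ballI closed_Collect_eq continuous_on_polyfun continuous_on_const) auto
  ultimately show ?thesis by simp
qed

text \<open>Irreducibility of the Zariski closure of \<open>S\<close>, phrased through the vanishing ideal.\<close>

definition prime_vanishing :: "(complex^'k) set \<Rightarrow> bool" where
  "prime_vanishing S \<longleftrightarrow> S \<noteq> {} \<and> (\<forall>p q. polyfun p \<and> polyfun q \<and> (\<forall>x\<in>S. p x * q x = 0) \<longrightarrow>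
     (\<forall>x\<in>S. p x = 0) \<or> (\<forall>x\<in>S. q x = 0))"

text \<open>The members of a chain of irreducible closed sets can thus be specified by convenient
  dense subsets.\<close>

lemma irreducible_in_closure:
  assumes "prime_vanishing S" "S \<subseteq> X"
  shows "irreducible_in (subtopology zariski X) (X \<inter> zariski closure_of S)"
  unfolding irreducible_in_def
proof (intro conjI allI impI)
  have sub: "S \<subseteq> X \<inter> zariski closure_of S"
    using assms closure_of_subset[of S zariski] by auto
  show "X \<inter> zariski closure_of S \<noteq> {}"
    using sub assms unfolding prime_vanishing_def by blast
  show "X \<inter> zariski closure_of S \<subseteq> topspace (subtopology zariski X)" by simp
  fix A B
  assume AB: "closedin (subtopology zariski X) A \<and> closedin (subtopology zariski X) B \<and>
    X \<inter> zariski closure_of S \<subseteq> A \<union> B"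
  then obtain A' B' where A': "closedin zariski A'" "A = A' \<inter> X" and B': "closedin zariski B'" "B = B' \<inter> X"
    unfolding closedin_subtopology by blast
  have "S \<subseteq> A' \<or> S \<subseteq> B'"
  proof (rule ccontr)
    assume "\<not> (S \<subseteq> A' \<or> S \<subseteq> B')"
    then obtain a b where "a \<in> S" "a \<notin> A'" "b \<in> S" "b \<notin> B'" by blast
    with A'(1) B'(1) obtain p q where pq: "polyfun p" "\<forall>y\<in>A'. p y = 0" "p a \<noteq> 0"
      "polyfun q" "\<forall>y\<in>B'. q y = 0" "q b \<noteq> 0"
      unfolding closedin_zariski_iff by metis
    have "\<forall>x\<in>S. p x * q x = 0" using pq AB A' B' sub by auto
    with assms(1) pq \<open>a \<in> S\<close> \<open>b \<in> S\<close> show False unfolding prime_vanishing_def by blast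
  qed
  then show "X \<inter> zariski closure_of S \<subseteq> A \<or> X \<inter> zariski closure_of S \<subseteq> B"
    using A' B' closure_of_minimal[of S A' zariski] closure_of_minimal[of S B' zariski] by blast
qed

text \<open>The relative closures of the sets \<open>S i\<close> form the chain. The polynomials
  guarantee that the inclusions remain strict after taking closures.\<close>

lemma zdim_ge:
  fixes X :: "(complex^'k) set" and n :: nat
  assumes "\<And>i. i \<le> n \<Longrightarrow> prime_vanishing (S i) \<and> S i \<subseteq> X"
    and "\<And>i. i < n \<Longrightarrow> S i \<subseteq> S (Suc i) \<and>
           (\<exists>p. polyfun p \<and> (\<forall>x\<in>S i. p x = 0) \<and> (\<exists>x\<in>S (Suc i). p x \<noteq> 0))"
  shows "ereal (real n) \<le> zdim X"
  unfolding zdim_def krull_dim_def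
proof (rule Sup_upper, intro CollectI exI conjI allI impI)
  show "ereal (real n) = ereal (real n)" ..
  fix i assume "i \<le> n"
  show "closedin (subtopology zariski X) (X \<inter> zariski closure_of S i)"
    by (simp add: closedin_subtopology_Int_closed)
  show "irreducible_in (subtopology zariski X) (X \<inter> zariski closure_of S i)"
    using irreducible_in_closure assms(1) \<open>i \<le> n\<close> by blast
next
  fix i assume "i < n"
  from assms(2)[OF this] obtain p x where p: "polyfun p" "\<forall>x\<in>S i. p x = 0" "x \<in> S (Suc i)" "p x \<noteq> 0"
    and sub: "S i \<subseteq> S (Suc i)" by blast
  have "zariski closure_of S i \<subseteq> {x. p x = 0}"
    using p by (intro closure_of_minimal closedin_zariski_zeros) auto
  then have "x \<notin> zariski closure_of S i" using p by auto
  moreover have "x \<in> zariski closure_of S (Suc i)"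
    using p(3) closure_of_subset[of "S (Suc i)" zariski] by auto
  moreover have "x \<in> X" using p(3) assms(1)[of "Suc i"] \<open>i < n\<close> by auto
  ultimately show "X \<inter> zariski closure_of S i \<subset> X \<inter> zariski closure_of S (Suc i)"
    using closure_of_mono[OF sub, of zariski] by blast
qed

text \<open>If p is nonzero at x and q at y, then on the line through x and y both become nonzero
  univariate polynomials, as the parameters 0 and 1 show, but their product has infinitely many
  roots.\<close>

lemma prime_vanishing_lines:
  assumes "S \<noteq> {}" "\<And>x y. x \<in> S \<Longrightarrow> y \<in> S \<Longrightarrow> infinite {c. x + c *s (y - x) \<in> S}"
  shows "prime_vanishing S"
  unfolding prime_vanishing_def
proof (intro conjI allI impI assms(1))
  fix p q assume pq: "polyfun p \<and> polyfun q \<and> (\<forall>x\<in>S. p x * q x = 0)"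
  show "(\<forall>x\<in>S. p x = 0) \<or> (\<forall>x\<in>S. q x = 0)"
  proof (rule ccontr)
    assume "\<not> ?thesis"
    then obtain x y where xy: "x \<in> S" "p x \<noteq> 0" "y \<in> S" "q y \<noteq> 0" by blast
    obtain P where P: "\<And>c. p (x + c *s (y - x)) = poly P c" using polyfun_on_line pq by metis
    obtain Q where Q: "\<And>c. q (x + c *s (y - x)) = poly Q c" using polyfun_on_line pq by metis
    have "{c. x + c *s (y - x) \<in> S} \<subseteq> {c. poly (P * Q) c = 0}"
      using pq P Q by auto
    then have "infinite {c. poly (P * Q) c = 0}"
      using assms(2)[OF xy(1) xy(3)] finite_subset by blast
    then have "P * Q = 0" using poly_roots_finite by blast
    then have "P = 0 \<or> Q = 0" by simp
    then show False using P[of 0] Q[of 1] xy by auto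
  qed
qed

subsection \<open>Linear relations between weights\<close>

text \<open>The coefficient ring is left open: integral relations provide exponents, real ones come
  from separation and from the shell.\<close>

definition relation :: "('k::finite \<Rightarrow> 'n \<Rightarrow> int) \<Rightarrow> ('k \<Rightarrow> 'a::comm_ring_1) \<Rightarrow> bool" where
  "relation w c \<longleftrightarrow> (\<forall>a. (\<Sum>k\<in>UNIV. c k * of_int (w k a)) = 0)"

lemma relation_add: "relation w c \<Longrightarrow> relation w d \<Longrightarrow> relation w (\<lambda>k. c k + d k)"
  by (simp add: relation_def algebra_simps sum.distrib)

lemma relation_diff: "relation w c \<Longrightarrow> relation w d \<Longrightarrow> relation w (\<lambda>k. c k - d k)"
  by (simp add: relation_def algebra_simps sum_subtractf)

lemma relation_scale: "relation w c \<Longrightarrow> relation w (\<lambda>k. b * c k)"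
  by (simp add: relation_def mult.assoc flip: sum_distrib_left)

lemma relation_of_int:
  fixes c :: "'k::finite \<Rightarrow> int"
  assumes "relation w c"
  shows "relation w (\<lambda>k. of_int (c k) :: 'a::comm_ring_1)"
  unfolding relation_def
proof
  fix a
  have "(\<Sum>k\<in>UNIV. of_int (c k) * of_int (w k a)) = (of_int (\<Sum>k\<in>UNIV. c k * w k a) :: 'a)" by simp
  also have "(\<Sum>k\<in>UNIV. c k * w k a) = 0" using assms by (simp add: relation_def)
  finally show "(\<Sum>k\<in>UNIV. of_int (c k) * of_int (w k a)) = (0::'a)" by simp
qed

text \<open>Simultaneous Dirichlet approximation: if the error is small enough, then the value of an
  approximating integer vector at the integral weights is an integer of absolute value below 1.\<close>

lemma integral_relation:
  fixes w :: "'k::finite \<Rightarrow> 'n::finite \<Rightarrow> int" and c :: "'k \<Rightarrow> real"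
  assumes "relation w c"
  obtains p :: "'k \<Rightarrow> int" where "relation w p" "\<And>k. p k > 0 \<longleftrightarrow> c k > 0" "\<And>k. p k < 0 \<longleftrightarrow> c k < 0"
proof -
  obtain e where e: "bij_betw e {0..<card (UNIV :: 'k set)} (UNIV :: 'k set)"
    using ex_bij_betw_nat_finite[OF finite_class.finite_UNIV] by blast
  \<comment> \<open>The first sum controls the total error in each equation. The second makes the
    error smaller than every nonzero \<open>\<bar>c k\<bar>\<close>, so that signs survive; for
    \<open>c k = 0\<close> its term is 0 by the convention for division. The final 1 makes both
    bounds strict and forces \<open>N > 0\<close>.\<close>
  define M where "M = (\<Sum>k\<in>UNIV. \<Sum>a\<in>UNIV. \<bar>real_of_int (w k a)\<bar>) + (\<Sum>k\<in>UNIV. 1 / \<bar>c k\<bar>) + 1"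
  have M_w: "(\<Sum>k\<in>UNIV. \<bar>real_of_int (w k a)\<bar>) < M" for a
  proof -
    have "(\<Sum>k\<in>UNIV. \<bar>real_of_int (w k a)\<bar>) \<le> (\<Sum>k\<in>UNIV. \<Sum>a\<in>UNIV. \<bar>real_of_int (w k a)\<bar>)"
      by (intro sum_mono member_le_sum) auto
    moreover have "0 \<le> (\<Sum>k\<in>UNIV. 1 / \<bar>c k\<bar>)" by (intro sum_nonneg) auto
    ultimately show ?thesis unfolding M_def by linarith
  qed
  have M_c: "1 / \<bar>c k\<bar> < M" for k
  proof -
    have "1 / \<bar>c k\<bar> \<le> (\<Sum>k\<in>UNIV. 1 / \<bar>c k\<bar>)" by (intro member_le_sum) auto
    moreover have "0 \<le> (\<Sum>k\<in>UNIV. \<Sum>a\<in>UNIV. \<bar>real_of_int (w k a)\<bar>)" by (intro sum_nonneg) auto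
    ultimately show ?thesis unfolding M_def by linarith
  qed
  have "M \<ge> 1" unfolding M_def by (simp add: sum_nonneg)
  obtain N :: nat where N: "M < real N" using reals_Archimedean2 by blast
  then have "N > 0" using \<open>M \<ge> 1\<close> by (cases N) auto
  obtain q P where q: "0 < q" and P: "\<And>i. i < card (UNIV :: 'k set) \<Longrightarrow>
      \<bar>of_int q * c (e i) - of_int (P i)\<bar> < 1 / real N"
    by (rule Dirichlet_approx_simult[OF \<open>N > 0\<close>, where \<theta> = "\<lambda>i. c (e i)" and n = "card (UNIV :: 'k set)"])
       blast
  define p where "p k = P (inv_into {0..<card (UNIV :: 'k set)} e k)" for k
  have p: "\<bar>of_int q * c k - of_int (p k)\<bar> < 1 / real N" for k
    using P[of "inv_into {0..<card (UNIV :: 'k set)} e k"] e unfolding p_def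
    by (metis atLeastLessThan_iff bij_betw_imp_surj_on bij_betw_inv_into_right inv_into_into UNIV_I)
  have N_c: "1 / real N < \<bar>c k\<bar>" if "c k \<noteq> 0" for k
  proof -
    have "1 / \<bar>c k\<bar> < real N" using M_c[of k] N by simp
    then have "1 < real N * \<bar>c k\<bar>" using that by (simp add: divide_less_eq)
    then show ?thesis using \<open>N > 0\<close> by (simp add: divide_less_eq mult.commute)
  qed
  have N_1: "1 / real N \<le> 1" using \<open>N > 0\<close> by simp
  have q1: "real_of_int q \<ge> 1" using q by simp
  have pos: "p k > 0" if "c k > 0" for k
  proof -
    have "1 / real N < c k" using N_c[of k] that by simp
    also have "\<dots> \<le> of_int q * c k" using q1 that by simp
    finally have "real_of_int (p k) > 0" using p[of k] by linarith
    then show ?thesis by simp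
  qed
  have neg: "p k < 0" if "c k < 0" for k
  proof -
    have "1 / real N < - c k" using N_c[of k] that by simp
    also have "\<dots> \<le> - (of_int q * c k)" using q1 that by simp
    finally have "real_of_int (p k) < 0" using p[of k] by linarith
    then show ?thesis by simp
  qed
  have zero: "p k = 0" if "c k = 0" for k
  proof -
    have "\<bar>real_of_int (p k)\<bar> < 1" using p[of k] N_1 that by simp
    then show ?thesis by linarith
  qed
  have "(\<Sum>k\<in>UNIV. p k * w k a) = 0" for a
  proof -
    have "(\<Sum>k\<in>UNIV. of_int q * c k * of_int (w k a)) = of_int q * (\<Sum>k\<in>UNIV. c k * of_int (w k a))"
      by (simp add: sum_distrib_left mult.assoc)
    also have "\<dots> = 0" using assms by (simp add: relation_def)
    finally have "real_of_int (\<Sum>k\<in>UNIV. p k * w k a) =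
        (\<Sum>k\<in>UNIV. (of_int (p k) - of_int q * c k) * of_int (w k a))"
      by (simp add: left_diff_distrib sum_subtractf)
    also have "\<bar>\<dots>\<bar> \<le> (\<Sum>k\<in>UNIV. \<bar>(of_int (p k) - of_int q * c k) * of_int (w k a)\<bar>)"
      by (rule sum_abs)
    also have "\<dots> \<le> (\<Sum>k\<in>UNIV. 1 / real N * \<bar>of_int (w k a)\<bar>)"
      unfolding abs_mult using p by (intro sum_mono mult_right_mono) (auto simp: abs_minus_commute less_imp_le)
    also have "\<dots> = (\<Sum>k\<in>UNIV. \<bar>real_of_int (w k a)\<bar>) / real N"
      by (simp add: sum_divide_distrib)
    also have "\<dots> < 1" using M_w[of a] N \<open>N > 0\<close> by simp
    finally show ?thesis by linarith
  qed
  then have "relation w p" by (simp add: relation_def)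
  moreover have "p k > 0 \<longleftrightarrow> c k > 0" "p k < 0 \<longleftrightarrow> c k < 0" for k
    using pos[of k] neg[of k] zero[of k] by (cases "c k" "0::real" rule: linorder_cases; force)+
  ultimately show ?thesis using that by blast
qed

section \<open>Convex cones, spans and separation\<close>

lemma convex_cone_hull_image_combination:
  fixes f :: "'k::finite \<Rightarrow> 'a::euclidean_space"
  assumes "x \<in> convex_cone hull (f ` S)"
  obtains c where "\<And>k. c k \<ge> 0" "\<And>k. k \<notin> S \<Longrightarrow> c k = 0" "x = (\<Sum>k\<in>UNIV. c k *\<^sub>R f k)"
proof -
  \<comment> \<open>Coefficients are indexed by \<open>k\<close> and not by the vectors, since
    \<open>f\<close> need not be injective.\<close>
  let ?C = "{\<Sum>k\<in>UNIV. c k *\<^sub>R f k | c. (\<forall>k. c k \<ge> 0) \<and> (\<forall>k. k \<notin> S \<longrightarrow> c k = 0)}"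
  have CI: "(\<Sum>k\<in>UNIV. c k *\<^sub>R f k) \<in> ?C" if "\<And>k. c k \<ge> 0" "\<And>k. k \<notin> S \<Longrightarrow> c k = 0" for c
    using that by blast
  have "convex_cone ?C"
    unfolding convex_cone_iff
  proof (intro conjI ballI allI impI)
    show "0 \<in> ?C" using CI[of "\<lambda>_. 0"] by simp
    fix x y assume "x \<in> ?C" "y \<in> ?C"
    then obtain c d where
      "x = (\<Sum>k\<in>UNIV. c k *\<^sub>R f k)" "\<And>k. c k \<ge> 0" "\<And>k. k \<notin> S \<Longrightarrow> c k = 0"
      "y = (\<Sum>k\<in>UNIV. d k *\<^sub>R f k)" "\<And>k. d k \<ge> 0" "\<And>k. k \<notin> S \<Longrightarrow> d k = 0" by blast
    then show "x + y \<in> ?C"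
      using CI[of "\<lambda>k. c k + d k"] by (simp add: scaleR_left_distrib sum.distrib)
  next
    fix x and b :: real assume "x \<in> ?C" "0 \<le> b"
    then obtain c where "x = (\<Sum>k\<in>UNIV. c k *\<^sub>R f k)" "\<And>k. c k \<ge> 0" "\<And>k. k \<notin> S \<Longrightarrow> c k = 0"
      by blast
    with \<open>0 \<le> b\<close> show "b *\<^sub>R x \<in> ?C"
      using CI[of "\<lambda>k. b * c k"] by (simp add: scaleR_right.sum)
  qed
  moreover have "f ` S \<subseteq> ?C"
  proof
    fix x assume "x \<in> f ` S"
    then obtain k where k: "k \<in> S" "x = f k" by blast
    have "(\<Sum>j\<in>UNIV. (if j = k then 1 else 0) *\<^sub>R f j) = f k"
      by (simp add: if_distrib[of "\<lambda>r. r *\<^sub>R _"] cong: if_cong)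
    moreover have "(\<Sum>j\<in>UNIV. (if j = k then 1 else 0) *\<^sub>R f j) \<in> ?C"
      by (rule CI) (use k in auto)
    ultimately show "x \<in> ?C" unfolding k(2) by (simp only:)
  qed
  ultimately have "convex_cone hull (f ` S) \<subseteq> ?C" by (intro hull_minimal)
  then show ?thesis using assms that by blast
qed

text \<open>The cone generated by finitely many vectors is closed. If it missed some
  \<open>- f k\<close>, a separating functional would be nonnegative on all generators and nonzero
  at \<open>f k\<close>. So every \<open>- f k\<close> is a nonnegative combination, which gives a
  relation with coefficient at least 1 at \<open>k\<close>; the sum of these relations is strictly
  positive on \<open>S\<close>.\<close>

lemma Stiemke:
  fixes f :: "'k::finite \<Rightarrow> 'a::euclidean_space"
  assumes "\<And>a. (\<forall>k\<in>S. a \<bullet> f k \<ge> 0) \<Longrightarrow> (\<forall>k\<in>S. a \<bullet> f k = 0)"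
  obtains c where "\<And>k. k \<in> S \<Longrightarrow> c k > 0" "\<And>k. k \<notin> S \<Longrightarrow> c k = 0" "(\<Sum>k\<in>UNIV. c k *\<^sub>R f k) = 0"
proof -
  let ?C = "convex_cone hull (f ` S)"
  have mem: "- f k \<in> ?C" if "k \<in> S" for k
  proof (rule ccontr)
    assume "- f k \<notin> ?C"
    have "closed ?C" by (intro closed_convex_cone_hull) auto
    then obtain a b where ab: "a \<bullet> (- f k) < b" "\<forall>x\<in>?C. a \<bullet> x > b"
      using separating_hyperplane_closed_point[OF convex_convex_cone_hull _ \<open>- f k \<notin> ?C\<close>] by blast
    have "b < 0" using ab(2) convex_cone_hull_contains_0[of "f ` S"] by force
    have "a \<bullet> f j \<ge> 0" if "j \<in> S" for j
    proof (rule ccontr)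
      assume neg: "\<not> a \<bullet> f j \<ge> 0"
      have "f j \<in> ?C" using that by (simp add: hull_inc)
      \<comment> \<open>Both \<open>b\<close> and the denominator are negative, so the factor is
        positive. It moves \<open>f j\<close> onto the hyperplane itself, which the cone must not
        meet.\<close>
      then have "(b / (a \<bullet> f j)) *\<^sub>R f j \<in> ?C"
        using neg \<open>b < 0\<close> by (intro convex_cone_hull_mul) (auto simp: zero_le_divide_iff)
      with ab(2) have "a \<bullet> ((b / (a \<bullet> f j)) *\<^sub>R f j) > b" by blast
      then show False using neg by simp
    qed
    then have "a \<bullet> f k = 0" using assms that by blast
    then show False using ab(1) \<open>b < 0\<close> by simp
  qed
  have "\<exists>c. (\<forall>j. c j \<ge> 0) \<and> (\<forall>j. j \<notin> S \<longrightarrow> c j = 0) \<and> - f k = (\<Sum>j\<in>UNIV. c j *\<^sub>R f j)" if "k \<in> S" for k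
    using convex_cone_hull_image_combination[OF mem[OF that]] by metis
  then obtain c where c: "\<And>k j. k \<in> S \<Longrightarrow> c k j \<ge> 0" "\<And>k j. k \<in> S \<Longrightarrow> j \<notin> S \<Longrightarrow> c k j = 0"
      "\<And>k. k \<in> S \<Longrightarrow> - f k = (\<Sum>j\<in>UNIV. c k j *\<^sub>R f j)"
    by metis
  define d where "d j = (\<Sum>k\<in>S. c k j + (if j = k then 1 else 0))" for j
  show ?thesis
  proof (rule that[of d])
    fix j assume "j \<in> S"
    have "(\<Sum>k\<in>S. if j = k then 1 else 0) \<le> d j"
      unfolding d_def by (intro sum_mono) (use c(1) in auto)
    then show "d j > 0" using \<open>j \<in> S\<close> by simp
  next
    fix j assume "j \<notin> S"
    then show "d j = 0" unfolding d_def by (intro sum.neutral) (auto simp: c(2))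
  next
    have "(\<Sum>j\<in>UNIV. d j *\<^sub>R f j) = (\<Sum>k\<in>S. \<Sum>j\<in>UNIV. (c k j + (if j = k then 1 else 0)) *\<^sub>R f j)"
      unfolding d_def scaleR_left.sum by (rule sum.swap)
    also have "\<dots> = (\<Sum>k\<in>S. (\<Sum>j\<in>UNIV. c k j *\<^sub>R f j) + f k)"
      by (intro sum.cong refl)
         (simp add: scaleR_left_distrib sum.distrib if_distrib[of "\<lambda>r. r *\<^sub>R _"] cong: if_cong)
    also have "\<dots> = 0" by (intro sum.neutral ballI) (simp flip: c(3))
    finally show "(\<Sum>j\<in>UNIV. d j *\<^sub>R f j) = 0" .
  qed
qed

lemma span_image_combination:
  fixes f :: "'k::finite \<Rightarrow> 'a::real_vector"
  assumes "x \<in> span (f ` S)"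
  obtains c where "\<And>k. k \<notin> S \<Longrightarrow> c k = 0" "x = (\<Sum>k\<in>UNIV. c k *\<^sub>R f k)"
proof -
  let ?C = "{\<Sum>k\<in>UNIV. c k *\<^sub>R f k | c. \<forall>k. k \<notin> S \<longrightarrow> c k = 0}"
  have CI: "(\<Sum>k\<in>UNIV. c k *\<^sub>R f k) \<in> ?C" if "\<And>k. k \<notin> S \<Longrightarrow> c k = 0" for c
    using that by blast
  have "subspace ?C"
  proof (rule subspaceI)
    show "0 \<in> ?C" using CI[of "\<lambda>_. 0"] by simp
    fix x y assume "x \<in> ?C" "y \<in> ?C"
    then obtain c d where
      "x = (\<Sum>k\<in>UNIV. c k *\<^sub>R f k)" "\<And>k. k \<notin> S \<Longrightarrow> c k = 0"
      "y = (\<Sum>k\<in>UNIV. d k *\<^sub>R f k)" "\<And>k. k \<notin> S \<Longrightarrow> d k = 0" by blast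
    then show "x + y \<in> ?C"
      using CI[of "\<lambda>k. c k + d k"] by (simp add: scaleR_left_distrib sum.distrib)
  next
    fix x and b :: real assume "x \<in> ?C"
    then obtain c where "x = (\<Sum>k\<in>UNIV. c k *\<^sub>R f k)" "\<And>k. k \<notin> S \<Longrightarrow> c k = 0"
      by blast
    then show "b *\<^sub>R x \<in> ?C"
      using CI[of "\<lambda>k. b * c k"] by (simp add: scaleR_right.sum)
  qed
  moreover have "f ` S \<subseteq> ?C"
  proof
    fix x assume "x \<in> f ` S"
    then obtain k where k: "k \<in> S" "x = f k" by blast
    have "(\<Sum>j\<in>UNIV. (if j = k then 1 else 0) *\<^sub>R f j) = f k"
      by (simp add: if_distrib[of "\<lambda>r. r *\<^sub>R _"] cong: if_cong)
    moreover have "(\<Sum>j\<in>UNIV. (if j = k then 1 else 0) *\<^sub>R f j) \<in> ?C"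
      by (rule CI) (use k in auto)
    ultimately show "x \<in> ?C" unfolding k(2) by (simp only:)
  qed
  ultimately have "span (f ` S) \<subseteq> ?C" by (intro span_minimal)
  then show ?thesis using assms that by blast
qed

text \<open>The component of \<open>x\<close> orthogonal to the span serves as the
  functional.\<close>

lemma not_in_span_separation:
  fixes x :: "'a::euclidean_space"
  assumes "x \<notin> span B"
  obtains a where "\<And>b. b \<in> B \<Longrightarrow> a \<bullet> b = 0" "a \<bullet> x \<noteq> 0"
proof -
  obtain y z where yz: "y \<in> span B" "\<And>w. w \<in> span B \<Longrightarrow> orthogonal z w" "x = y + z"
    using orthogonal_subspace_decomp_exists[of B x] by blast
  have "z \<noteq> 0" using assms yz by auto
  moreover have "z \<bullet> x = z \<bullet> z"
    using yz(2)[OF yz(1)] by (simp add: yz(3) inner_add_right orthogonal_def)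
  ultimately show ?thesis using yz(2) that[of z] by (simp add: orthogonal_def span_base)
qed

lemma small_perturbation:
  fixes c d :: "'k::finite \<Rightarrow> real"
  shows "\<exists>\<delta>. \<forall>k. sgn (c k + \<delta> * d k) = (if c k = 0 then sgn (d k) else sgn (c k))"
proof -
  \<comment> \<open>The inserted 1 covers the case \<open>c = 0\<close>. The denominator
    \<open>\<bar>d k\<bar> + 1\<close> is never zero and makes the bound on
    \<open>\<delta> * d k\<close> strict.\<close>
  define \<delta> where "\<delta> = Min (insert 1 ((\<lambda>k. \<bar>c k\<bar> / (\<bar>d k\<bar> + 1)) ` {k. c k \<noteq> 0}))"
  have "\<delta> > 0" unfolding \<delta>_def by (subst Min_gr_iff) (auto intro!: divide_pos_pos)
  have bound: "\<bar>\<delta> * d k\<bar> < \<bar>c k\<bar>" if "c k \<noteq> 0" for k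
  proof -
    have "\<delta> \<le> \<bar>c k\<bar> / (\<bar>d k\<bar> + 1)" unfolding \<delta>_def using that by (intro Min_le) auto
    then have "\<delta> * (\<bar>d k\<bar> + 1) \<le> \<bar>c k\<bar>" by (simp add: pos_le_divide_eq add_nonneg_pos)
    then show ?thesis using \<open>\<delta> > 0\<close> by (simp add: abs_mult algebra_simps)
  qed
  have "sgn (c k + \<delta> * d k) = sgn (c k)" if "c k \<noteq> 0" for k
  proof (cases "c k > 0")
    case True
    then have "c k + \<delta> * d k > 0" using bound[OF that] by linarith
    then show ?thesis using True by simp
  next
    case False
    then have "c k < 0" using that by simp
    moreover from this have "c k + \<delta> * d k < 0" using bound[OF that] by linarith
    ultimately show ?thesis by simp
  qed
  moreover have "sgn (c k + \<delta> * d k) = sgn (d k)" if "c k = 0" for k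
    using that \<open>\<delta> > 0\<close> by (simp add: sgn_mult)
  ultimately show ?thesis by (intro exI[of _ \<delta>]) simp
qed

text \<open>A sufficiently small multiple of a relation that is nonzero at a new index can be added
  without destroying the nonzero coefficients obtained so far.\<close>

lemma full_support_relation:
  fixes w :: "'k::finite \<Rightarrow> 'n \<Rightarrow> int"
  assumes "\<And>i. i \<in> F \<Longrightarrow> \<exists>c::'k \<Rightarrow> real. relation w c \<and> (\<forall>k. k \<notin> F \<longrightarrow> c k = 0) \<and> c i \<noteq> 0"
  shows "\<exists>c::'k \<Rightarrow> real. relation w c \<and> (\<forall>k. c k \<noteq> 0 \<longleftrightarrow> k \<in> F)"
proof -
  have "\<exists>c::'k \<Rightarrow> real. relation w c \<and> (\<forall>k. k \<notin> F \<longrightarrow> c k = 0) \<and> (\<forall>k\<in>A. c k \<noteq> 0)"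
    if "finite A" "A \<subseteq> F" for A
    using that
  proof (induction A)
    case empty
    show ?case by (intro exI[of _ "\<lambda>_. 0"]) (simp add: relation_def)
  next
    case (insert i A)
    then obtain c d :: "'k \<Rightarrow> real" where c: "relation w c" "\<forall>k. k \<notin> F \<longrightarrow> c k = 0" "\<forall>k\<in>A. c k \<noteq> 0"
      and d: "relation w d" "\<forall>k. k \<notin> F \<longrightarrow> d k = 0" "d i \<noteq> 0"
      using assms[of i] by auto
    from small_perturbation[of c d] obtain \<delta> where
      \<delta>: "\<forall>k. sgn (c k + \<delta> * d k) = (if c k = 0 then sgn (d k) else sgn (c k))" by (rule exE)
    have "c k + \<delta> * d k \<noteq> 0" if "k \<in> insert i A" for k
      using \<delta>[rule_format, of k] c(3) d(3) that by (metis insertE sgn_0_0)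
    then show ?case using c d
      by (intro exI[of _ "\<lambda>k. c k + \<delta> * d k"]) (auto intro: relation_add relation_scale)
  qed
  from this[of F] show ?thesis by (metis finite subset_refl)
qed

subsection \<open>Characters of the torus\<close>

definition tchar :: "('n \<Rightarrow> int) \<Rightarrow> complex^'n::finite \<Rightarrow> complex" where
  "tchar \<alpha> t = (\<Prod>i\<in>UNIV. (t $ i) powi \<alpha> i)"

lemma torus_nonzero: "t \<in> torus J \<Longrightarrow> t $ i \<noteq> 0"
  unfolding torus_def by (cases "i \<in> J") auto

lemma one_in_torus: "1 \<in> torus J"
  by (auto simp: torus_def)

lemma mult_in_torus: "s \<in> torus J \<Longrightarrow> t \<in> torus J \<Longrightarrow> s * t \<in> torus J"
  by (auto simp: torus_def)

lemma vinv_in_torus: "t \<in> torus J \<Longrightarrow> vinv t \<in> torus J"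
  by (auto simp: torus_def vinv_def)

lemma tchar_mult: "tchar \<alpha> (s * t) = tchar \<alpha> s * tchar \<alpha> t"
  by (simp add: tchar_def power_int_mult_distrib prod.distrib)

lemma tchar_one [simp]: "tchar \<alpha> 1 = 1"
  by (simp add: tchar_def)

lemma tchar_zero [simp]: "tchar (\<lambda>i. 0) t = 1"
  by (simp add: tchar_def)

lemma tchar_nonzero: "t \<in> torus J \<Longrightarrow> tchar \<alpha> t \<noteq> 0"
  by (simp add: tchar_def torus_nonzero)

lemma tchar_vinv: "tchar \<alpha> (vinv t) = inverse (tchar \<alpha> t)"
  by (simp add: tchar_def vinv_def power_int_inverse prod_inversef[symmetric] o_def)

lemma tchar_uminus: "tchar (\<lambda>i. - \<alpha> i) t = inverse (tchar \<alpha> t)"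
  by (simp add: tchar_def power_int_minus prod_inversef[symmetric] o_def)

lemma tchar_add:
  "t \<in> torus J \<Longrightarrow> tchar (\<lambda>i. \<alpha> i + \<beta> i) t = tchar \<alpha> t * tchar \<beta> t"
  by (simp add: tchar_def power_int_add torus_nonzero prod.distrib)

lemma prod_power_int: "(\<Prod>k\<in>K. f k) powi n = (\<Prod>k\<in>K. f k powi n)" for f :: "'a \<Rightarrow> 'b::field"
  by (induction K rule: infinite_finite_induct) (auto simp: power_int_mult_distrib)

lemma power_int_sum_exponent:
  "x \<noteq> 0 \<Longrightarrow> x powi (\<Sum>k\<in>K. c k) = (\<Prod>k\<in>K. x powi c k)" for x :: "'b::field"
  by (induction K rule: infinite_finite_induct) (auto simp: power_int_add)

lemma tchar_combination:
  assumes "t \<in> torus J"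
  shows "tchar (\<lambda>i. \<Sum>k\<in>K. c k * w k i) t = (\<Prod>k\<in>K. tchar (w k) t powi c k)"
proof -
  have "tchar (\<lambda>i. \<Sum>k\<in>K. c k * w k i) t = (\<Prod>i\<in>UNIV. \<Prod>k\<in>K. (t $ i) powi (w k i * c k))"
    unfolding tchar_def using torus_nonzero[OF assms]
    by (simp add: power_int_sum_exponent mult.commute)
  also have "\<dots> = (\<Prod>k\<in>K. \<Prod>i\<in>UNIV. (t $ i) powi (w k i * c k))" by (rule prod.swap)
  also have "\<dots> = (\<Prod>k\<in>K. tchar (w k) t powi c k)"
    by (simp add: tchar_def prod_power_int power_int_mult)
  finally show ?thesis .
qed

lemma tchar_unit: "tchar (\<lambda>i. if i = a then 1 else 0) t = t $ a"
proof -
  have "tchar (\<lambda>i. if i = a then 1 else 0) t = (\<Prod>i\<in>UNIV. if i = a then t $ i else 1)"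
    unfolding tchar_def by (intro prod.cong) auto
  then show ?thesis by simp
qed

text \<open>The assignment \<open>w k \<mapsto> z k\<close> for \<open>k \<in> I\<close> extends to a homomorphism from the lattice generated
  by these vectors to the multiplicative group. Divisibility of the latter makes it possible to
  extend the homomorphism further, one vector at a time.\<close>

definition compatible ::
    "('k::finite \<Rightarrow> 'n \<Rightarrow> int) \<Rightarrow> 'k set \<Rightarrow> ('k \<Rightarrow> complex) \<Rightarrow> bool" where
  "compatible w I z \<longleftrightarrow> (\<forall>k. z k \<noteq> 0) \<and>
     (\<forall>c::'k \<Rightarrow> int. relation w c \<and> (\<forall>k. k \<notin> I \<longrightarrow> c k = 0) \<longrightarrow> (\<Prod>k\<in>UNIV. z k powi c k) = 1)"

text \<open>The coefficients at \<open>k\<close> of the integral relations supported in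
  \<open>I\<close> form an ideal of the integers, and \<open>c0\<close> realizes a generator of
  it.\<close>

lemma generating_relation:
  fixes w :: "'k::finite \<Rightarrow> 'n \<Rightarrow> int"
  obtains c0 :: "'k \<Rightarrow> int" where "relation w c0" "\<And>j. j \<notin> I \<Longrightarrow> c0 j = 0"
    "\<And>c::'k \<Rightarrow> int. relation w c \<Longrightarrow> (\<And>j. j \<notin> I \<Longrightarrow> c j = 0) \<Longrightarrow> c0 k dvd c k"
proof -
  define R where "R = {c::'k \<Rightarrow> int. relation w c \<and> (\<forall>j. j \<notin> I \<longrightarrow> c j = 0)}"
  have R0: "(\<lambda>_. 0) \<in> R" by (simp add: R_def relation_def)
  have R_diff: "(\<lambda>j. c j - q * d j) \<in> R" if "c \<in> R" "d \<in> R" for c d q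
    using that by (auto simp: R_def intro: relation_diff relation_scale)
  show ?thesis
  proof (cases "\<exists>n>0. \<exists>c\<in>R. c k = int n")
    case False
    have "c k = 0" if "c \<in> R" for c
    proof (rule ccontr)
      assume "c k \<noteq> 0"
      then have pos: "nat \<bar>c k\<bar> > 0" by simp
      have "c k \<noteq> int (nat \<bar>c k\<bar>)" using False pos that by metis
      moreover have "0 - 1 * c k \<noteq> int (nat \<bar>c k\<bar>)"
        using False pos R_diff[OF R0 that, of 1] by metis
      ultimately show False by linarith
    qed
    then show ?thesis using that[of "\<lambda>_. 0"] R0 unfolding R_def by auto
  next
    case True
    define n where "n = (LEAST n. n > 0 \<and> (\<exists>c\<in>R. c k = int n))"
    have "n > 0 \<and> (\<exists>c\<in>R. c k = int n)" unfolding n_def using True by (rule LeastI_ex)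
    then obtain c0 where c0: "n > 0" "c0 \<in> R" "c0 k = int n" by blast
    have "c0 k dvd c k" if "c \<in> R" for c
    proof (rule ccontr)
      assume "\<not> c0 k dvd c k"
      then have "c k mod c0 k \<noteq> 0" by (simp add: dvd_eq_mod_eq_0)
      moreover have "c k mod c0 k \<ge> 0" using c0 by simp
      moreover have "c k mod c0 k < int n" using c0 by simp
      ultimately have m: "c k mod c0 k > 0" "c k mod c0 k < int n" by linarith+
      have "(\<lambda>j. c j - (c k div c0 k) * c0 j) \<in> R" using R_diff that c0 by blast
      moreover have "c k - (c k div c0 k) * c0 k = int (nat (c k mod c0 k))"
        using m by (simp add: minus_div_mult_eq_mod)
      ultimately have "n \<le> nat (c k mod c0 k)"
        unfolding n_def using m(1) by (intro Least_le conjI bexI) simp_all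
      then show False using m by simp
    qed
    then show ?thesis using that[of c0] c0 unfolding R_def by auto
  qed
qed

text \<open>Every relation on the larger index set differs from a multiple of \<open>c0\<close> by a
  relation without the index \<open>k\<close>. Hence \<open>c0\<close> imposes the only new
  condition.\<close>

lemma compatible_insert:
  fixes w :: "'k::finite \<Rightarrow> 'n \<Rightarrow> int"
  assumes "compatible w I z" "k \<notin> I" "relation w c0" "\<And>j. j \<notin> insert k I \<Longrightarrow> c0 j = 0"
    and dvd: "\<And>c::'k \<Rightarrow> int. relation w c \<Longrightarrow> (\<And>j. j \<notin> insert k I \<Longrightarrow> c j = 0) \<Longrightarrow> c0 k dvd c k"
    and "\<zeta> \<noteq> 0" "(\<Prod>j\<in>UNIV. (z(k := \<zeta>)) j powi c0 j) = 1"
  shows "compatible w (insert k I) (z(k := \<zeta>))"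
  unfolding compatible_def
proof (intro conjI allI impI)
  have z': "(z(k := \<zeta>)) j \<noteq> 0" for j using assms(1,6) by (simp add: compatible_def)
  then show "(z(k := \<zeta>)) j \<noteq> 0" for j .
  fix c :: "'k \<Rightarrow> int" assume c: "relation w c \<and> (\<forall>j. j \<notin> insert k I \<longrightarrow> c j = 0)"
  then obtain q where q: "c k = q * c0 k" using dvd by (metis dvd_def mult.commute)
  define d where "d j = c j - q * c0 j" for j
  have "relation w d" unfolding d_def using c assms(3) by (intro relation_diff relation_scale) auto
  moreover have dk: "d k = 0" by (simp add: d_def q)
  moreover have "\<forall>j. j \<notin> I \<longrightarrow> d j = 0"
    using c assms(4) dk by (metis d_def insertE mult_zero_right diff_zero)
  ultimately have "(\<Prod>j\<in>UNIV. z j powi d j) = 1" using assms(1) by (simp add: compatible_def)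
  moreover have "(\<Prod>j\<in>UNIV. (z(k := \<zeta>)) j powi d j) = (\<Prod>j\<in>UNIV. z j powi d j)"
    by (intro prod.cong) (auto simp: dk)
  moreover have "(\<Prod>j\<in>UNIV. (z(k := \<zeta>)) j powi c j) =
      (\<Prod>j\<in>UNIV. (z(k := \<zeta>)) j powi d j * ((z(k := \<zeta>)) j powi c0 j) powi q)"
  proof (intro prod.cong refl)
    fix j
    have "c j = d j + c0 j * q" by (simp add: d_def)
    then show "(z(k := \<zeta>)) j powi c j = (z(k := \<zeta>)) j powi d j * ((z(k := \<zeta>)) j powi c0 j) powi q"
      using power_int_add[OF disjI1[OF z'], of j "d j" "c0 j * q"] by (simp only: power_int_mult)
  qed
  ultimately show "(\<Prod>j\<in>UNIV. (z(k := \<zeta>)) j powi c j) = 1"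
    using assms(7) by (simp only: prod.distrib prod_power_int[symmetric]) simp
qed

text \<open>A logarithm gives one solution. If it is the forbidden value \<open>u\<close>, it is
  multiplied by exp(2 pi i / n), which is different from 1 unless n is 1 or -1.\<close>

lemma power_int_solution:
  fixes v :: complex
  assumes "v \<noteq> 0" "n \<noteq> 0"
  obtains \<zeta> where "\<zeta> \<noteq> 0" "\<zeta> powi n = v" "\<bar>n\<bar> \<noteq> 1 \<Longrightarrow> \<zeta> \<noteq> u"
proof -
  define \<zeta> where "\<zeta> = exp (ln v / of_int n)"
  have z: "\<zeta> powi n = v" using assms by (simp add: \<zeta>_def exp_power_int)
  show ?thesis
  proof (cases "\<zeta> = u \<and> \<bar>n\<bar> \<noteq> 1")
    case False
    then show ?thesis using that[of \<zeta>] z by (auto simp: \<zeta>_def)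
  next
    case True
    define \<epsilon> where "\<epsilon> = exp (Complex 0 (2 * pi / of_int n))"
    have "of_int n * Complex 0 (2 * pi / of_int n) = Complex 0 (2 * pi)"
      using assms by (simp add: complex_eq_iff)
    moreover have "exp (Complex 0 (2 * pi)) = 1"
      unfolding exp_eq_1 by (intro conjI exI[of _ 1]) simp_all
    ultimately have e: "\<epsilon> powi n = 1" by (simp only: \<epsilon>_def exp_power_int)
    have "\<epsilon> \<noteq> 1"
    proof
      assume "\<epsilon> = 1"
      then obtain m :: int where "2 * pi / of_int n = of_int (2 * m) * pi"
        unfolding \<epsilon>_def exp_eq_1 complex.sel by blast
      then have "1 = real_of_int (m * n)" using assms by (simp add: field_simps)
      then have "m * n = 1" by linarith
      then show False using True by (metis dvd_triv_right zdvd1_eq)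
    qed
    moreover have "\<zeta> \<noteq> 0" by (simp add: \<zeta>_def)
    ultimately have "\<zeta> * \<epsilon> \<noteq> u" using True by auto
    then show ?thesis using that[of "\<zeta> * \<epsilon>"] z e
      by (simp add: power_int_mult_distrib) (simp add: \<zeta>_def \<epsilon>_def)
  qed
qed

text \<open>A relation with coefficient 1 or -1 at \<open>k\<close> would express \<open>w k\<close>
  integrally by the vectors in \<open>I\<close> and so fix its value. If there is none, the value is
  either free or a root of order at least 2, and in both cases it can avoid
  \<open>u\<close>.\<close>

lemma compatible_extend1:
  fixes w :: "'k::finite \<Rightarrow> 'n \<Rightarrow> int"
  assumes "compatible w I z" "k \<notin> I"
  obtains \<zeta> where "compatible w (insert k I) (z(k := \<zeta>))"
    "(\<forall>c::'k \<Rightarrow> int. relation w c \<and> (\<forall>j. j \<notin> insert k I \<longrightarrow> c j = 0) \<longrightarrow> \<bar>c k\<bar> \<noteq> 1) \<longrightarrow> \<zeta> \<noteq> u"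
proof -
  obtain c0 :: "'k \<Rightarrow> int" where c0: "relation w c0" "\<And>j. j \<notin> insert k I \<Longrightarrow> c0 j = 0"
    "\<And>c::'k \<Rightarrow> int. relation w c \<Longrightarrow> (\<And>j. j \<notin> insert k I \<Longrightarrow> c j = 0) \<Longrightarrow> c0 k dvd c k"
    using generating_relation[of w "insert k I" k] by blast
  have split: "(\<Prod>j\<in>UNIV. (z(k := \<zeta>)) j powi c0 j) = \<zeta> powi c0 k * (\<Prod>j\<in>UNIV - {k}. z j powi c0 j)" for \<zeta>
    by (subst prod.remove[of _ k]) (auto intro!: prod.cong)
  show ?thesis
  proof (cases "c0 k = 0")
    case True
    then have "\<forall>j. j \<notin> I \<longrightarrow> c0 j = 0" using c0(2) by (metis insertE)
    then have "(\<Prod>j\<in>UNIV. z j powi c0 j) = 1" using assms(1) c0(1) by (simp add: compatible_def)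
    then have *: "(\<Prod>j\<in>UNIV. (z(k := \<zeta>)) j powi c0 j) = 1" for \<zeta>
      unfolding split using True by (subst (asm) prod.remove[of _ k]) auto
    obtain \<zeta> :: complex where "\<zeta> \<noteq> 0" "\<zeta> \<noteq> u"
    proof (cases "u = 1")
      case True
      show ?thesis by (rule that[of 2]) (simp_all add: True)
    next
      case False
      show ?thesis by (rule that[of 1]) (use False in auto)
    qed
    show ?thesis
    proof (rule that)
      show "compatible w (insert k I) (z(k := \<zeta>))"
        by (rule compatible_insert[where ?c0.0 = c0]) (fact assms c0 * \<open>\<zeta> \<noteq> 0\<close>)+
    qed (use \<open>\<zeta> \<noteq> u\<close> in auto)
  next
    case False
    have "inverse (\<Prod>j\<in>UNIV - {k}. z j powi c0 j) \<noteq> 0"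
      using assms(1) by (simp add: compatible_def)
    from power_int_solution[OF this False, of u]
    obtain \<zeta> where z: "\<zeta> \<noteq> 0" "\<zeta> powi c0 k = inverse (\<Prod>j\<in>UNIV - {k}. z j powi c0 j)"
      "\<bar>c0 k\<bar> \<noteq> 1 \<Longrightarrow> \<zeta> \<noteq> u" by blast
    have *: "(\<Prod>j\<in>UNIV. (z(k := \<zeta>)) j powi c0 j) = 1"
      unfolding split z(2) using assms(1) by (simp add: compatible_def)
    show ?thesis
    proof (rule that)
      show "compatible w (insert k I) (z(k := \<zeta>))"
        by (rule compatible_insert[where ?c0.0 = c0]) (fact assms c0 * z(1))+
    qed (use z(3) c0(1,2) in auto)
  qed
qed

lemma compatible_extend:
  fixes w :: "'k::finite \<Rightarrow> 'n \<Rightarrow> int"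
  assumes "compatible w I z"
  obtains z' where "compatible w (I \<union> A) z'" "\<And>k. k \<in> I \<Longrightarrow> z' k = z k"
proof -
  have "\<exists>z'. compatible w (I \<union> A) z' \<and> (\<forall>k\<in>I. z' k = z k)" if "finite A" for A
    using that
  proof (induction A)
    case empty
    show ?case using assms by auto
  next
    case (insert k A)
    then obtain z' where z': "compatible w (I \<union> A) z'" "\<forall>k\<in>I. z' k = z k" by blast
    show ?case
    proof (cases "k \<in> I")
      case True
      then have "I \<union> insert k A = I \<union> A" by blast
      with z' show ?thesis by auto
    next
      case False
      then have "k \<notin> I \<union> A" using insert by blast
      from compatible_extend1[OF z'(1) this]
      obtain \<zeta> where "compatible w (insert k (I \<union> A)) (z'(k := \<zeta>))" by metis
      then show ?thesis using z'(2) False by (intro exI[of _ "z'(k := \<zeta>)"]) (simp del: fun_upd_apply, auto)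
    qed
  qed
  then show ?thesis using that by (metis finite)
qed

text \<open>The standard basis of the character lattice is adjoined to the weights, because a value
  on the unit vector \<open>a\<close> is the same as a coordinate \<open>t $ a\<close> of a torus
  point.\<close>

definition with_units :: "('k \<Rightarrow> 'n \<Rightarrow> int) \<Rightarrow> 'k + 'n \<Rightarrow> 'n \<Rightarrow> int" where
  "with_units w = case_sum w (\<lambda>a i. if i = a then 1 else 0)"

lemma with_units_simps [simp]:
  "with_units w (Inl k) = w k" "with_units w (Inr a) = (\<lambda>i. if i = a then 1 else 0)"
  by (simp_all add: with_units_def)

lemma sum_UNIV_sum:
  "(\<Sum>x\<in>(UNIV :: ('a::finite + 'b::finite) set). f x) = (\<Sum>a\<in>UNIV. f (Inl a)) + (\<Sum>b\<in>UNIV. f (Inr b))"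
  by (simp add: UNIV_Plus_UNIV[symmetric] sum.Plus del: UNIV_Plus_UNIV)

lemma prod_UNIV_sum:
  "(\<Prod>x\<in>(UNIV :: ('a::finite + 'b::finite) set). f x) = (\<Prod>a\<in>UNIV. f (Inl a)) * (\<Prod>b\<in>UNIV. f (Inr b))"
  by (simp add: UNIV_Plus_UNIV[symmetric] prod.Plus del: UNIV_Plus_UNIV)

lemma relation_with_units:
  "relation (with_units w) c \<longleftrightarrow> (\<forall>a. (\<Sum>k\<in>UNIV. c (Inl k) * w k a) + c (Inr a) = (0::int))"
proof -
  have "(\<Sum>b\<in>UNIV. c (Inr b) * (if a = b then 1 else 0)) = c (Inr a)" for a
    by (simp add: if_distrib[of "\<lambda>x. _ * x"] cong: if_cong)
  then show ?thesis by (simp add: relation_def sum_UNIV_sum)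
qed

text \<open>After extension to the units in \<open>J\<close>, the values on these units are the
  coordinates of the required point.\<close>

lemma torus_point_from_compatible:
  fixes w :: "'k::finite \<Rightarrow> 'n::finite \<Rightarrow> int"
  assumes "compatible (with_units w) (Inl ` S \<union> Inr ` B) z" "B \<subseteq> J"
    and supp: "\<And>k i. i \<notin> J \<Longrightarrow> w k i = 0"
  obtains t where "t \<in> torus J" "\<And>k. k \<in> S \<Longrightarrow> tchar (w k) t = z (Inl k)"
    "\<And>b. b \<in> B \<Longrightarrow> t $ b = z (Inr b)"
proof -
  obtain z' where z': "compatible (with_units w) (Inl ` S \<union> Inr ` B \<union> Inr ` J) z'"
    "\<And>k. k \<in> Inl ` S \<union> Inr ` B \<Longrightarrow> z' k = z k"
    using compatible_extend[OF assms(1)] by metis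
  define t :: "complex^'n" where "t = (\<chi> i. if i \<in> J then z' (Inr i) else 1)"
  have t: "t \<in> torus J" using z'(1) by (auto simp: t_def torus_def compatible_def)
  have "tchar (w k) t = z (Inl k)" if "k \<in> S" for k
  proof -
    \<comment> \<open>This relation expresses \<open>w k\<close> by the units. Only units in
      \<open>J\<close> occur, by \<open>supp\<close>.\<close>
    define c :: "'k + 'n \<Rightarrow> int" where
      "c = case_sum (\<lambda>j. if j = k then 1 else 0) (\<lambda>a. - w k a)"
    have "relation (with_units w) c"
      unfolding relation_with_units
      by (simp add: c_def if_distrib[of "\<lambda>x. x * _"] cong: if_cong)
    moreover have "\<forall>j. j \<notin> Inl ` S \<union> Inr ` B \<union> Inr ` J \<longrightarrow> c j = 0"
      using that supp by (auto simp: c_def image_iff split: sum.splits)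
    ultimately have "(\<Prod>j\<in>UNIV. z' j powi c j) = 1" using z'(1) unfolding compatible_def by blast
    moreover have "(\<Prod>j\<in>UNIV. z' (Inl j) powi c (Inl j)) = (\<Prod>j\<in>UNIV. if j = k then z' (Inl k) else 1)"
      by (intro prod.cong) (auto simp: c_def)
    moreover have "(\<Prod>i\<in>UNIV. z' (Inr i) powi c (Inr i)) = tchar (\<lambda>i. - w k i) t"
      unfolding tchar_def by (intro prod.cong) (auto simp: c_def t_def supp)
    ultimately have "z' (Inl k) * inverse (tchar (w k) t) = 1" by (simp add: prod_UNIV_sum tchar_uminus)
    then have "tchar (w k) t = z' (Inl k)" by (simp add: tchar_nonzero[OF t] field_simps)
    then show ?thesis using z'(2) that by simp
  qed
  moreover have "t $ b = z (Inr b)" if "b \<in> B" for b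
    using z'(2)[of "Inr b"] that assms(2) by (auto simp: t_def)
  ultimately show ?thesis using that t by blast
qed

lemma torus_point:
  fixes w :: "'k::finite \<Rightarrow> 'n::finite \<Rightarrow> int"
  assumes "compatible w S z" "\<And>k i. i \<notin> J \<Longrightarrow> w k i = 0"
  obtains t where "t \<in> torus J" "\<And>k. k \<in> S \<Longrightarrow> tchar (w k) t = z k"
proof -
  have "compatible (with_units w) (Inl ` S \<union> Inr ` {}) (case_sum z (\<lambda>_. 1))"
    unfolding compatible_def relation_with_units
  proof (intro conjI allI impI)
    show "case_sum z (\<lambda>_. 1) j \<noteq> 0" for j
      using assms(1) by (cases j) (auto simp: compatible_def)
    fix c :: "'k + 'n \<Rightarrow> int"
    assume c: "(\<forall>a. (\<Sum>k\<in>UNIV. c (Inl k) * w k a) + c (Inr a) = 0) \<and>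
      (\<forall>j. j \<notin> Inl ` S \<union> Inr ` {} \<longrightarrow> c j = 0)"
    then have "c (Inr a) = 0" for a by auto
    then have "relation w (\<lambda>k. c (Inl k))" using c by (simp add: relation_def)
    moreover have "\<forall>k. k \<notin> S \<longrightarrow> c (Inl k) = 0" using c by auto
    ultimately show "(\<Prod>j\<in>UNIV. case_sum z (\<lambda>_. 1) j powi c j) = 1"
      using assms(1) by (simp add: prod_UNIV_sum compatible_def)
  qed
  from torus_point_from_compatible[OF this _ assms(2)] show ?thesis using that by auto
qed

text \<open>If the unit vector at \<open>a\<close> were not in the lattice generated by the weights,
  the trivial homomorphism on that lattice would extend with a value other than 1 at this unit. The
  resulting torus point would act trivially without being 1.\<close>

lemma weights_generate_if_faithful:
  fixes w :: "'k::finite \<Rightarrow> 'n::finite \<Rightarrow> int"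
  assumes faithful: "\<And>t. t \<in> torus J \<Longrightarrow> (\<And>k. tchar (w k) t = 1) \<Longrightarrow> t = 1"
    and supp: "\<And>k i. i \<notin> J \<Longrightarrow> w k i = 0" and "a \<in> J"
  shows "\<exists>c::'k \<Rightarrow> int. \<forall>i. (\<Sum>k\<in>UNIV. c k * w k i) = (if i = a then 1 else 0)"
proof (rule ccontr)
  assume no: "\<not> ?thesis"
  have "compatible (with_units w) (range Inl) (\<lambda>_. 1)" by (simp add: compatible_def)
  moreover have "Inr a \<notin> range Inl" by auto
  ultimately obtain \<zeta> where z: "compatible (with_units w) (insert (Inr a) (range Inl)) ((\<lambda>_. 1)(Inr a := \<zeta>))"
    "(\<forall>c::'k + 'n \<Rightarrow> int. relation (with_units w) c \<and>
        (\<forall>j. j \<notin> insert (Inr a) (range Inl) \<longrightarrow> c j = 0) \<longrightarrow> \<bar>c (Inr a)\<bar> \<noteq> 1) \<longrightarrow> \<zeta> \<noteq> 1"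
    by (rule compatible_extend1[where u = 1])
  have "\<zeta> \<noteq> 1"
  proof (rule z(2)[rule_format], rule notI, erule conjE)
    fix c :: "'k + 'n \<Rightarrow> int"
    assume c: "relation (with_units w) c" "\<forall>j. j \<notin> insert (Inr a) (range Inl) \<longrightarrow> c j = 0"
      and 1: "\<bar>c (Inr a)\<bar> = 1"
    \<comment> \<open>The coefficient at the unit is 1 or -1, so multiplication by its negative
      solves the relation for the unit in both cases.\<close>
    have "(\<Sum>k\<in>UNIV. - c (Inr a) * c (Inl k) * w k i) = (if i = a then 1 else 0)" for i
    proof -
      have "(\<Sum>k\<in>UNIV. c (Inl k) * w k i) = - c (Inr i)"
        using c(1) unfolding relation_with_units by (simp add: eq_neg_iff_add_eq_0)
      then have "(\<Sum>k\<in>UNIV. - c (Inr a) * c (Inl k) * w k i) = c (Inr a) * c (Inr i)"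
        by (simp add: mult.assoc sum_negf flip: sum_distrib_left)
      moreover have "c (Inr i) = 0" if "i \<noteq> a" using c(2)[rule_format, of "Inr i"] that by auto
      moreover have "c (Inr a) * c (Inr a) = 1" using 1 by (auto simp: abs_if split: if_splits)
      ultimately show ?thesis by auto
    qed
    then show False
      using no[unfolded not_ex, THEN spec, of "\<lambda>k. - c (Inr a) * c (Inl k)"] by simp
  qed
  have eq: "insert (Inr a) (range Inl) = Inl ` UNIV \<union> Inr ` {a}" by auto
  obtain t where t: "t \<in> torus J" "\<And>k. k \<in> UNIV \<Longrightarrow> tchar (w k) t = ((\<lambda>_. 1)(Inr a := \<zeta>)) (Inl k)"
    "\<And>b. b \<in> {a} \<Longrightarrow> t $ b = ((\<lambda>_. 1)(Inr a := \<zeta>)) (Inr b)"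
    by (rule torus_point_from_compatible[OF z(1)[unfolded eq] _ supp]) (use \<open>a \<in> J\<close> in auto)
  then have "t = 1" using faithful by simp
  then show False using t(3)[of a] \<open>\<zeta> \<noteq> 1\<close> by simp
qed

subsection \<open>Diagonal representations\<close>

lemma prime_vanishing_nonzero:
  assumes "prime_vanishing S" "polyfun p" "polyfun q" "x \<in> S" "p x \<noteq> 0" "y \<in> S" "q y \<noteq> 0"
  shows "\<exists>z\<in>S. p z * q z \<noteq> 0"
proof (rule ccontr)
  assume "\<not> (\<exists>z\<in>S. p z * q z \<noteq> 0)"
  then have "polyfun p \<and> polyfun q \<and> (\<forall>z\<in>S. p z * q z = 0)" using assms(2,3) by simp
  then have "(\<forall>x\<in>S. p x = 0) \<or> (\<forall>x\<in>S. q x = 0)"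
    using assms(1)[unfolded prime_vanishing_def, THEN conjunct2, THEN spec, THEN spec, of p q] by (rule rev_mp)
  then show False using assms(4-7) by blast
qed

text \<open>The columns of \<open>Q\<close> form a basis of weight vectors and \<open>Q'\<close>
  reads off coordinates. Keeping the base change explicit lets submodules stay inside the given
  space. Torus coordinates outside \<open>J\<close> are constantly 1, so \<open>supp\<close>
  normalizes the exponents there.\<close>

locale diagonal_rep =
  fixes J :: "'n::finite set"
    and \<tau> :: "complex^'n \<Rightarrow> complex^'k::finite^'k"
    and Q Q' :: "complex^'k^'k"
    and w :: "'k \<Rightarrow> 'n \<Rightarrow> int"
  assumes QQ': "Q ** Q' = mat 1" and Q'Q: "Q' ** Q = mat 1"
    and supp: "\<And>k i. i \<notin> J \<Longrightarrow> w k i = 0"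
    and diag: "\<And>t x k. t \<in> torus J \<Longrightarrow> (Q' *v (\<tau> t *v x)) $ k = tchar (w k) t * (Q' *v x) $ k"
begin

definition coord :: "complex^'k \<Rightarrow> 'k \<Rightarrow> complex" where
  "coord x k = (Q' *v x) $ k"

definition point :: "('k \<Rightarrow> complex) \<Rightarrow> complex^'k" where
  "point f = Q *v (\<chi> k. f k)"

definition coord_space :: "'k set \<Rightarrow> (complex^'k) set" where
  "coord_space T = {x. \<forall>k. k \<notin> T \<longrightarrow> coord x k = 0}"

definition monomial :: "('k \<Rightarrow> int) \<Rightarrow> complex^'k \<Rightarrow> complex" where
  "monomial c x = (\<Prod>k\<in>UNIV. coord x k ^ nat (c k))"

lemma coord_point [simp]: "coord (point f) k = f k"
  by (simp add: coord_def point_def matrix_vector_mul_assoc Q'Q)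

lemma point_coord [simp]: "point (coord x) = x"
  by (simp add: coord_def[abs_def] point_def matrix_vector_mul_assoc QQ')

lemma eq_iff_coord: "x = y \<longleftrightarrow> (\<forall>k. coord x k = coord y k)"
  by (metis ext point_coord)

lemma coord_act: "t \<in> torus J \<Longrightarrow> coord (\<tau> t *v x) k = tchar (w k) t * coord x k"
  by (simp add: coord_def diag)

lemma coord_add: "coord (x + y) k = coord x k + coord y k"
  by (simp add: coord_def matrix_vector_right_distrib)

lemma coord_diff: "coord (x - y) k = coord x k - coord y k"
  by (simp add: coord_def matrix_vector_mult_diff_distrib)

lemma coord_scale: "coord (c *s x) k = c * coord x k"
  by (simp add: coord_def matrix_vector_mult_def sum_distrib_left mult_ac)

lemma coord_zero [simp]: "coord 0 k = 0"
  by (simp add: coord_def)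

lemma polyfun_coord: "polyfun (\<lambda>x. coord x k)"
  unfolding coord_def by (rule polyfun_linear)

lemma polyfun_monomial: "polyfun (monomial c)"
  unfolding monomial_def by (intro polyfun_prod polyfun_power polyfun_coord)

lemma act_one: "\<tau> 1 *v x = x"
  by (simp add: eq_iff_coord coord_act one_in_torus)

lemma mem_orbit_self: "x \<in> orbit (torus J) \<tau> x"
  unfolding orbit_def using act_one one_in_torus by (metis image_eqI)

lemma orbit_coord_nonzero:
  "y \<in> orbit (torus J) \<tau> x \<Longrightarrow> coord y k \<noteq> 0 \<longleftrightarrow> coord x k \<noteq> 0"
  by (auto simp: orbit_def coord_act tchar_nonzero)

lemma mem_isotropy_iff:
  "t \<in> isotropy (torus J) \<tau> x \<longleftrightarrow> t \<in> torus J \<and> (\<forall>k. coord x k \<noteq> 0 \<longrightarrow> tchar (w k) t = 1)"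
  unfolding isotropy_def by (auto simp: eq_iff_coord coord_act)

lemma monomial_nonzero_iff:
  "monomial c x \<noteq> 0 \<longleftrightarrow> (\<forall>k. c k > 0 \<longrightarrow> coord x k \<noteq> 0)"
  by (auto simp: monomial_def)

lemma tchar_relation:
  fixes c :: "'k \<Rightarrow> int"
  assumes "relation w c" "t \<in> torus J"
  shows "(\<Prod>k\<in>UNIV. tchar (w k) t powi c k) = 1"
proof -
  have "(\<lambda>i. \<Sum>k\<in>UNIV. c k * w k i) = (\<lambda>i. 0)" using assms(1) by (simp add: relation_def)
  then show ?thesis using tchar_combination[OF assms(2), where K = UNIV and c = c and w = w] by simp
qed

lemma monomial_act:
  assumes "relation w c" "\<And>k. c k \<ge> 0" "t \<in> torus J"
  shows "monomial c (\<tau> t *v x) = monomial c x"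
proof -
  have "(\<Prod>k\<in>UNIV. tchar (w k) t ^ nat (c k)) = (\<Prod>k\<in>UNIV. tchar (w k) t powi c k)"
    by (simp add: power_int_nonneg_exp assms(2))
  then show ?thesis
    by (simp add: monomial_def coord_act assms(3) power_mult_distrib prod.distrib tchar_relation[OF assms(1,3)])
qed

lemma closedin_coord_space: "closedin zariski (coord_space T)"
  unfolding closedin_zariski_iff coord_space_def using polyfun_coord by blast

lemma coord_space_act: "t \<in> torus J \<Longrightarrow> x \<in> coord_space T \<Longrightarrow> \<tau> t *v x \<in> coord_space T"
  by (simp add: coord_space_def coord_act)

lemma subspace_coord_space: "vec.subspace (coord_space T)"
  by (intro vec.subspaceI) (auto simp: coord_space_def coord_add coord_scale)

lemma submodule_coord_space: "submodule (torus J) \<tau> (coord_space T)"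
  by (simp add: submodule_def subspace_coord_space coord_space_act)

lemma fixed_space_coord_space:
  assumes "H \<subseteq> torus J"
  shows "fixed_space H \<tau> (coord_space T) = coord_space {k \<in> T. \<forall>h\<in>H. tchar (w k) h = 1}"
  using assms by (fastforce simp: fixed_space_def coord_space_def eq_iff_coord coord_act)

lemma orbit_subset_coord_space:
  "x \<in> coord_space T \<Longrightarrow> orbit (torus J) \<tau> x \<subseteq> coord_space T"
  by (auto simp: orbit_def coord_space_act)

lemma prime_vanishing_coord_space: "prime_vanishing (coord_space T)"
proof (rule prime_vanishing_lines)
  show "coord_space T \<noteq> {}" using subspace_coord_space vec.subspace_0 by blast
  fix x y assume "x \<in> coord_space T" "y \<in> coord_space T"
  then have "x + c *s (y - x) \<in> coord_space T" for c
    by (simp add: coord_space_def coord_add coord_scale coord_diff)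
  then show "infinite {c. x + c *s (y - x) \<in> coord_space T}"
    by (simp add: infinite_UNIV_char_0)
qed

subsection \<open>Closed orbits\<close>

text \<open>If some real one-parameter group had only nonnegative weights on the support of \<open>x\<close>, not all
  zero, then it would drive \<open>x\<close> to a limit outside the orbit.\<close>

lemma closed_orbit_relation:
  assumes closed: "closedin zariski (orbit (torus J) \<tau> x)"
  shows "\<exists>p::'k \<Rightarrow> int. relation w p \<and> (\<forall>k. coord x k \<noteq> 0 \<longrightarrow> p k > 0) \<and>
    (\<forall>k. coord x k = 0 \<longrightarrow> p k = 0)"
proof -
  define f :: "'k \<Rightarrow> real^'n" where "f k = (\<chi> i. real_of_int (w k i))" for k
  define S where "S = {k. coord x k \<noteq> 0}"
  have no_ray: "\<forall>k\<in>S. a \<bullet> f k = 0" if nonneg: "\<forall>k\<in>S. a \<bullet> f k \<ge> 0" for a :: "real^'n"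
  proof (rule ccontr)
    assume "\<not> (\<forall>k\<in>S. a \<bullet> f k = 0)"
    then obtain k0 where k0: "k0 \<in> S" "a \<bullet> f k0 > 0" using nonneg by force
    \<comment> \<open>Because of the negative exponent, coordinates of positive weight decay for
      growing \<open>s\<close>, while those of weight 0 stay constant.\<close>
    define t :: "real \<Rightarrow> complex^'n" where
      "t s = (\<chi> i. if i \<in> J then exp (complex_of_real (- s * a $ i)) else 1)" for s
    have t: "t s \<in> torus J" for s by (simp add: t_def torus_def)
    have tchar_t: "tchar (w k) (t s) = exp (complex_of_real (- s * (a \<bullet> f k)))" for k s
    proof -
      have "tchar (w k) (t s) = (\<Prod>i\<in>UNIV. exp (of_int (w k i) * complex_of_real (- s * a $ i)))"
        unfolding tchar_def by (intro prod.cong) (auto simp: t_def exp_power_int supp)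
      also have "\<dots> = exp (\<Sum>i\<in>UNIV. of_int (w k i) * complex_of_real (- s * a $ i))"
        by (simp add: exp_sum)
      also have "(\<Sum>i\<in>UNIV. of_int (w k i) * complex_of_real (- s * a $ i)) =
          complex_of_real (- s * (a \<bullet> f k))"
        by (simp add: inner_vec_def f_def sum_distrib_left mult_ac sum_negf)
      finally show ?thesis .
    qed
    define z where "z k = (if k \<in> S \<and> a \<bullet> f k > 0 then 0 else coord x k)" for k
    have lim: "((\<lambda>s. exp (complex_of_real (- s * (a \<bullet> f k))) * coord x k) \<longlongrightarrow> z k) at_top" for k
    proof (cases "k \<in> S \<and> a \<bullet> f k > 0")
      case True
      have "((\<lambda>s. exp (- s * (a \<bullet> f k))) \<longlongrightarrow> 0) at_top"
      proof -
        have "filterlim (\<lambda>s. (a \<bullet> f k) * s) at_top at_top"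
          using True by (intro filterlim_tendsto_pos_mult_at_top[OF tendsto_const]) (auto simp: filterlim_ident)
        then have "filterlim (\<lambda>s. - ((a \<bullet> f k) * s)) at_bot at_top"
          by (simp add: filterlim_uminus_at_top)
        then show ?thesis
          using filterlim_compose[OF exp_at_bot] by (simp add: mult.commute)
      qed
      then have "((\<lambda>s. complex_of_real (exp (- s * (a \<bullet> f k))) * coord x k) \<longlongrightarrow> of_real 0 * coord x k) at_top"
        by (intro tendsto_mult tendsto_of_real tendsto_const)
      then show ?thesis using True by (simp only: z_def exp_of_real if_True simp_thms of_real_0 mult_zero_left)
    next
      case False
      then have "exp (complex_of_real (- s * (a \<bullet> f k))) * coord x k = z k" for s
        using nonneg by (auto simp: z_def S_def order_less_le)
      then show ?thesis by simp
    qed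
    have "((\<lambda>s. \<tau> (t s) *v x) \<longlongrightarrow> point z) at_top"
    proof -
      have eq: "\<tau> (t s) *v x = point (\<lambda>k. exp (complex_of_real (- s * (a \<bullet> f k))) * coord x k)" for s
        by (simp add: eq_iff_coord coord_act t tchar_t)
      show ?thesis
        unfolding eq unfolding point_def matrix_vector_mult_def vec_lambda_beta
        by (intro tendsto_vec_lambda tendsto_sum tendsto_mult[OF tendsto_const lim])
    qed
    moreover have "closed (orbit (torus J) \<tau> x)"
      using closed by (rule closed_if_closedin_zariski)
    moreover have "\<tau> (t s) *v x \<in> orbit (torus J) \<tau> x" for s
      using t by (auto simp: orbit_def)
    ultimately have "point z \<in> orbit (torus J) \<tau> x"
      using Lim_in_closed_set[of "orbit (torus J) \<tau> x" "\<lambda>s. \<tau> (t s) *v x" at_top] by simp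
    \<comment> \<open>All points of an orbit have the same support, but the limit has lost the
      coordinate \<open>k0\<close>.\<close>
    from orbit_coord_nonzero[OF this, of k0] show False using k0 by (simp add: z_def S_def)
  qed
  obtain c where c: "\<And>k. k \<in> S \<Longrightarrow> c k > 0" "\<And>k. k \<notin> S \<Longrightarrow> c k = 0" "(\<Sum>k\<in>UNIV. c k *\<^sub>R f k) = 0"
    by (rule Stiemke[of S f, OF no_ray]) blast+
  have "(\<Sum>k\<in>UNIV. c k * of_int (w k i)) = (\<Sum>k\<in>UNIV. c k *\<^sub>R f k) $ i" for i
    by (simp add: f_def)
  then have "relation w c" by (simp add: relation_def c(3))
  then obtain p :: "'k \<Rightarrow> int" where p: "relation w p" "\<And>k. p k > 0 \<longleftrightarrow> c k > 0" "\<And>k. p k < 0 \<longleftrightarrow> c k < 0"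
    using integral_relation by blast
  have "p k > 0" if "coord x k \<noteq> 0" for k using p(2) c(1) that by (simp add: S_def)
  moreover have "p k = 0" if "coord x k = 0" for k
  proof -
    have "c k = 0" using c(2) that by (simp add: S_def)
    then show ?thesis using p(2)[of k] p(3)[of k] by simp
  qed
  ultimately show ?thesis using p(1) by blast
qed

text \<open>A point \<open>z\<close> whose support differs from \<open>T\<close> is separated from
  the orbit by a coordinate or by the invariant monomial of \<open>n\<close>. Otherwise the ratios
  of the coordinates of \<open>z\<close> and \<open>x\<close> cannot be compatible, since a torus
  point with these character values would move \<open>x\<close> to \<open>z\<close>. A violated
  relation turns into an invariant monomial after a multiple of \<open>n\<close> is added.\<close>

lemma closedin_orbit:
  fixes n :: "'k \<Rightarrow> int"
  assumes n: "relation w n" "\<And>k. k \<in> T \<Longrightarrow> n k > 0" "\<And>k. k \<notin> T \<Longrightarrow> n k = 0"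
    and x: "\<And>k. coord x k \<noteq> 0 \<longleftrightarrow> k \<in> T"
  shows "closedin zariski (orbit (torus J) \<tau> x)"
  unfolding closedin_zariski_iff
proof (intro allI impI)
  fix z assume z: "z \<notin> orbit (torus J) \<tau> x"
  have n_nonneg: "n k \<ge> 0" for k using n(2)[of k] n(3)[of k] by (cases "k \<in> T") auto
  let ?goal = "\<exists>p. polyfun p \<and> (\<forall>y\<in>orbit (torus J) \<tau> x. p y = 0) \<and> p z \<noteq> 0"
  have by_monomial: ?goal if "relation w c" "\<And>k. c k \<ge> 0" "monomial c z \<noteq> monomial c x" for c
  proof (intro exI conjI)
    show "polyfun (\<lambda>y. monomial c y - monomial c x)"
      by (intro polyfun_diff polyfun_monomial polyfun.const)
    show "\<forall>y\<in>orbit (torus J) \<tau> x. monomial c y - monomial c x = 0"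
      using that(1,2) by (auto simp: orbit_def monomial_act)
    show "monomial c z - monomial c x \<noteq> 0" using that(3) by simp
  qed
  show ?goal
  proof (cases "(\<exists>k. k \<notin> T \<and> coord z k \<noteq> 0) \<or> monomial n z \<noteq> monomial n x")
    case True
    then show ?thesis
    proof
      assume "\<exists>k. k \<notin> T \<and> coord z k \<noteq> 0"
      then obtain k where "k \<notin> T" "coord z k \<noteq> 0" by blast
      then show ?thesis
        using x orbit_coord_nonzero by (intro exI[of _ "\<lambda>x. coord x k"] conjI polyfun_coord) blast+
    next
      assume "monomial n z \<noteq> monomial n x"
      then show ?thesis using by_monomial n(1) n_nonneg by blast
    qed
  next
    case False
    have "monomial n x \<noteq> 0" unfolding monomial_nonzero_iff using n(3) x by force
    then have "monomial n z \<noteq> 0" using False by simp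
    then have zT: "coord z k \<noteq> 0 \<longleftrightarrow> k \<in> T" for k
      unfolding monomial_nonzero_iff using n(2) False by blast
    define r where "r k = (if k \<in> T then coord z k / coord x k else 1)" for k
    have r0: "r k \<noteq> 0" for k using x zT by (simp add: r_def)
    have ratio: "(\<Prod>k\<in>UNIV. r k powi c k) = monomial c z / monomial c x"
      if "\<And>k. c k \<ge> 0" "\<And>k. k \<notin> T \<Longrightarrow> c k = 0" for c
    proof -
      have "r k powi c k = coord z k ^ nat (c k) / coord x k ^ nat (c k)" for k
        using that by (simp add: r_def power_int_nonneg_exp power_divide)
      then show ?thesis by (simp add: monomial_def prod_dividef)
    qed
    have "\<not> compatible w T r"
    proof
      assume compat: "compatible w T r"
      obtain t where t: "t \<in> torus J" "\<And>k. k \<in> T \<Longrightarrow> tchar (w k) t = r k"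
        by (rule torus_point[OF compat supp]) blast+
      have "coord z k = coord (\<tau> t *v x) k" for k
        using t x[of k] zT[of k] by (cases "k \<in> T") (auto simp: coord_act r_def)
      then have "z = \<tau> t *v x" by (simp add: eq_iff_coord)
      then show False using z t(1) by (auto simp: orbit_def)
    qed
    then obtain c :: "'k \<Rightarrow> int" where c: "relation w c" "\<And>k. k \<notin> T \<Longrightarrow> c k = 0" "(\<Prod>k\<in>UNIV. r k powi c k) \<noteq> 1"
      unfolding compatible_def using r0 by blast
    \<comment> \<open>\<open>N\<close> bounds every \<open>\<bar>c k\<bar>\<close>, and
      \<open>n k\<close> is at least 1 on \<open>T\<close>, so \<open>c + N n\<close> has no
      negative coefficient.\<close>
    define N where "N = (\<Sum>k\<in>UNIV. \<bar>c k\<bar>)"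
    define c' where "c' k = c k + N * n k" for k
    have "relation w c'" unfolding c'_def by (intro relation_add relation_scale c(1) n(1))
    moreover have c'_nonneg: "c' k \<ge> 0" for k
    proof (cases "k \<in> T")
      case True
      have "\<bar>c k\<bar> \<le> N" unfolding N_def by (intro member_le_sum) auto
      moreover have "N * 1 \<le> N * n k"
        using n(2)[OF True] calculation by (intro mult_left_mono) auto
      ultimately show ?thesis by (simp add: c'_def)
    qed (simp add: c'_def c(2) n(3))
    moreover have "monomial c' z \<noteq> monomial c' x"
    proof
      assume eq: "monomial c' z = monomial c' x"
      have "monomial c' x \<noteq> 0" unfolding monomial_nonzero_iff using x c(2) n(3) by (force simp: c'_def)
      then have "(\<Prod>k\<in>UNIV. r k powi c' k) = 1"
        using ratio[of c'] c'_nonneg eq c(2) n(3) by (simp add: c'_def)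
      moreover have "(\<Prod>k\<in>UNIV. r k powi n k) = 1"
        using ratio[of n] n_nonneg n(3) False \<open>monomial n x \<noteq> 0\<close> by simp
      moreover have "(\<Prod>k\<in>UNIV. r k powi c' k) =
          (\<Prod>k\<in>UNIV. r k powi c k) * (\<Prod>k\<in>UNIV. r k powi n k) powi N"
        unfolding prod_power_int prod.distrib[symmetric]
        by (simp add: c'_def power_int_add r0 power_int_mult mult.commute[of N])
      ultimately show False using c(3) by simp
    qed
    ultimately show ?thesis using by_monomial by blast
  qed
qed

lemma closed_orbits_coord_space:
  assumes "x \<in> coord_space T"
  shows "orbit (torus J) \<tau> x \<in> closed_orbits (torus J) \<tau> (coord_space T) \<longleftrightarrow>
    closedin zariski (orbit (torus J) \<tau> x)"
proof
  assume "orbit (torus J) \<tau> x \<in> closed_orbits (torus J) \<tau> (coord_space T)"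
  then show "closedin zariski (orbit (torus J) \<tau> x)"
    unfolding closed_orbits_def using closedin_trans_full closedin_coord_space by blast
next
  assume "closedin zariski (orbit (torus J) \<tau> x)"
  then show "orbit (torus J) \<tau> x \<in> closed_orbits (torus J) \<tau> (coord_space T)"
    unfolding closed_orbits_def using assms orbit_subset_coord_space[OF assms]
    by (auto intro!: bexI[of _ x] closedin_subset_topspace)
qed

end

section \<open>The categorical quotient and the stability of coordinate subspaces\<close>

lemma openin_categorical_quotient:
  assumes "openin (categorical_quotient G \<rho> X) U" "C \<in> U"
  shows "\<exists>f. polyfun f \<and> invariant_on G \<rho> X f \<and> (\<forall>x\<in>C. f x \<noteq> 0) \<and>
    {C \<in> closed_orbits G \<rho> X. \<forall>x\<in>C. f x \<noteq> 0} \<subseteq> U"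
proof -
  have "generate_topology_on {{C \<in> closed_orbits G \<rho> X. \<forall>x\<in>C. f x \<noteq> 0} | f. polyfun f \<and> invariant_on G \<rho> X f} U"
    using assms(1) unfolding categorical_quotient_def by (rule openin_topology_generated_by)
  then have "\<forall>C\<in>U. \<exists>f. polyfun f \<and> invariant_on G \<rho> X f \<and> (\<forall>x\<in>C. f x \<noteq> 0) \<and>
    {C \<in> closed_orbits G \<rho> X. \<forall>x\<in>C. f x \<noteq> 0} \<subseteq> U"
  proof (induction rule: generate_topology_on.induct)
    case (Int a b)
    show ?case
    proof
      fix C assume C: "C \<in> a \<inter> b"
      obtain f where f: "polyfun f" "invariant_on G \<rho> X f" "\<forall>x\<in>C. f x \<noteq> 0"
        "{C \<in> closed_orbits G \<rho> X. \<forall>x\<in>C. f x \<noteq> 0} \<subseteq> a"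
        using bspec[OF Int.IH(1) IntD1[OF C]] by blast
      obtain g where g: "polyfun g" "invariant_on G \<rho> X g" "\<forall>x\<in>C. g x \<noteq> 0"
        "{C \<in> closed_orbits G \<rho> X. \<forall>x\<in>C. g x \<noteq> 0} \<subseteq> b"
        using bspec[OF Int.IH(2) IntD2[OF C]] by blast
      note fg = f g
      show "\<exists>f. polyfun f \<and> invariant_on G \<rho> X f \<and> (\<forall>x\<in>C. f x \<noteq> 0) \<and>
        {C \<in> closed_orbits G \<rho> X. \<forall>x\<in>C. f x \<noteq> 0} \<subseteq> a \<inter> b"
      proof (intro exI conjI)
        show "polyfun (\<lambda>x. f x * g x)" using fg by (intro polyfun.mult)
        show "invariant_on G \<rho> X (\<lambda>x. f x * g x)" using fg by (simp add: invariant_on_def)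
        show "\<forall>x\<in>C. f x * g x \<noteq> 0" using fg by simp
        show "{C \<in> closed_orbits G \<rho> X. \<forall>x\<in>C. f x * g x \<noteq> 0} \<subseteq> a \<inter> b" using fg by auto
      qed
    qed
  next
    case (UN K)
    then show ?case by (meson Union_iff Union_upper order_trans)
  qed blast+
  then show ?thesis using assms(2) by (rule bspec)
qed

lemma topspace_categorical_quotient:
  "topspace (categorical_quotient G \<rho> X) = closed_orbits G \<rho> X"
proof -
  have "closed_orbits G \<rho> X \<in> {{C \<in> closed_orbits G \<rho> X. \<forall>x\<in>C. f x \<noteq> 0} | f. polyfun f \<and> invariant_on G \<rho> X f}"
    by (intro CollectI exI[of _ "\<lambda>x. 1"]) (auto simp: invariant_on_def intro: polyfun.const)
  then show ?thesis
    unfolding categorical_quotient_def topology_generated_by_topspace by blast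
qed

text \<open>Combinatorial form of the condition that the points with support exactly
  \<open>T\<close> have closed orbits.\<close>

definition positively_dependent :: "('k::finite \<Rightarrow> 'n \<Rightarrow> int) \<Rightarrow> 'k set \<Rightarrow> bool" where
  "positively_dependent w T \<longleftrightarrow> (\<exists>n::'k \<Rightarrow> int. relation w n \<and> (\<forall>k\<in>T. n k > 0) \<and> (\<forall>k. k \<notin> T \<longrightarrow> n k = 0))"

context diagonal_rep
begin

lemma closed_orbit_full_support:
  assumes "positively_dependent w T" "x \<in> coord_space T" "\<And>k. k \<in> T \<Longrightarrow> coord x k \<noteq> 0"
  shows "orbit (torus J) \<tau> x \<in> closed_orbits (torus J) \<tau> (coord_space T)"
proof -
  obtain n :: "'k \<Rightarrow> int" where n: "relation w n" "\<forall>k\<in>T. n k > 0" "\<forall>k. k \<notin> T \<longrightarrow> n k = 0"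
    using assms(1) unfolding positively_dependent_def by blast
  have "coord x k \<noteq> 0 \<longleftrightarrow> k \<in> T" for k using assms(2,3) by (auto simp: coord_space_def)
  then show ?thesis
    unfolding closed_orbits_coord_space[OF assms(2)] using closedin_orbit[of n T x] n by blast
qed

lemma stable_coord_space:
  assumes "positively_dependent w T"
  shows "stable_variety (torus J) \<tau> (coord_space T)"
  unfolding stable_variety_def
proof (intro exI conjI ballI)
  let ?O = "coord_space T \<inter> {x. (\<Prod>k\<in>T. coord x k) \<noteq> 0}"
  have O_iff: "x \<in> ?O \<longleftrightarrow> x \<in> coord_space T \<and> (\<forall>k\<in>T. coord x k \<noteq> 0)" for x by auto
  have "openin zariski {x. (\<Prod>k\<in>T. coord x k) \<noteq> 0}"
    unfolding openin_zariski_iff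
    by (auto intro!: exI[of _ "\<lambda>x. \<Prod>k\<in>T. coord x k"] polyfun_prod polyfun_coord)
  then show "openin (subtopology zariski (coord_space T)) ?O"
    by (simp add: openin_subtopology_Int2)
  have "point (\<lambda>k. if k \<in> T then 1 else 0) \<in> ?O" by (simp add: coord_space_def)
  then show "?O \<noteq> {}" by blast
  fix x assume x: "x \<in> ?O"
  then show "orbit (torus J) \<tau> x \<in> closed_orbits (torus J) \<tau> (coord_space T)"
    unfolding O_iff by (intro closed_orbit_full_support assms) auto
  show "orbit (torus J) \<tau> x \<subseteq> ?O"
    using x orbit_subset_coord_space orbit_coord_nonzero unfolding O_iff subset_iff by blast
qed

text \<open>Openness: the positive relation of a closed orbit gives an invariant monomial that is
  nonzero exactly where the support contains that of the orbit. There the isotropy group can only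
  shrink, while the common kernel \<open>?K\<close> is contained in every isotropy group. Density:
  the subspace is irreducible, so an invariant that is nonzero somewhere on it is nonzero at a point
  of full support.\<close>

lemma principal_isotropy_coord_space:
  assumes pos: "positively_dependent w T"
  shows "principal_isotropy (torus J) \<tau> (coord_space T) {t \<in> torus J. \<forall>k\<in>T. tchar (w k) t = 1}"
    (is "principal_isotropy ?G \<tau> ?X ?K")
  unfolding principal_isotropy_def
proof
  have isotropy_orbit: "isotropy ?G \<tau> y = isotropy ?G \<tau> x" if "y \<in> orbit ?G \<tau> x" for x y
    using orbit_coord_nonzero[OF that] by (auto simp: mem_isotropy_iff)
  have K_sub: "?K \<subseteq> isotropy ?G \<tau> x" if "x \<in> ?X" for x
    using that by (simp add: subset_iff mem_isotropy_iff coord_space_def) blast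
  show "openin (categorical_quotient ?G \<tau> ?X) (isotropy_stratum ?G \<tau> ?X ?K)"
  proof (subst openin_subopen, intro ballI)
    fix C assume "C \<in> isotropy_stratum ?G \<tau> ?X ?K"
    then obtain x y where x: "x \<in> ?X" "C = orbit ?G \<tau> x" "C \<in> closed_orbits ?G \<tau> ?X"
      and y: "y \<in> C" "isotropy ?G \<tau> y = ?K"
      unfolding isotropy_stratum_def closed_orbits_def by blast
    have isoK: "isotropy ?G \<tau> x = ?K" using isotropy_orbit y x by metis
    have closed: "closedin zariski (orbit ?G \<tau> x)"
      using x closed_orbits_coord_space[OF x(1)] by simp
    obtain p :: "'k \<Rightarrow> int" where p: "relation w p" "\<forall>k. coord x k \<noteq> 0 \<longrightarrow> p k > 0"
      "\<forall>k. coord x k = 0 \<longrightarrow> p k = 0"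
      using closed_orbit_relation[OF closed] by blast
    have p_nonneg: "p k \<ge> 0" for k using p(2,3) by (metis order_less_imp_le order_refl)
    let ?B = "{C \<in> closed_orbits ?G \<tau> ?X. \<forall>x\<in>C. monomial p x \<noteq> 0}"
    have "openin (categorical_quotient ?G \<tau> ?X) ?B"
      unfolding categorical_quotient_def
      by (rule topology_generated_by_Basis)
         (use polyfun_monomial monomial_act p(1) p_nonneg in \<open>auto simp: invariant_on_def\<close>)
    moreover have "C \<in> ?B"
      using x p(3) orbit_coord_nonzero unfolding monomial_nonzero_iff by force
    moreover have "?B \<subseteq> isotropy_stratum ?G \<tau> ?X ?K"
    proof
      fix C' assume C': "C' \<in> ?B"
      then obtain x' where x': "x' \<in> ?X" "C' = orbit ?G \<tau> x'" unfolding closed_orbits_def by blast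
      have "monomial p x' \<noteq> 0" using C' x' mem_orbit_self by blast
      then have "isotropy ?G \<tau> x' \<subseteq> isotropy ?G \<tau> x"
        using p(2) unfolding monomial_nonzero_iff by (auto simp: mem_isotropy_iff)
      then have "isotropy ?G \<tau> x' = ?K" using isoK K_sub[OF x'(1)] by blast
      then show "C' \<in> isotropy_stratum ?G \<tau> ?X ?K"
        unfolding isotropy_stratum_def using C' x'(2) mem_orbit_self by blast
    qed
    ultimately show "\<exists>B. openin (categorical_quotient ?G \<tau> ?X) B \<and> C \<in> B \<and> B \<subseteq> isotropy_stratum ?G \<tau> ?X ?K"
      by blast
  qed
  show "categorical_quotient ?G \<tau> ?X closure_of isotropy_stratum ?G \<tau> ?X ?K =
    topspace (categorical_quotient ?G \<tau> ?X)"
    unfolding dense_intersects_open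
  proof (intro allI impI)
    fix U assume U: "openin (categorical_quotient ?G \<tau> ?X) U \<and> U \<noteq> {}"
    then obtain C where C: "C \<in> U" by blast
    then obtain f where f: "polyfun f" "invariant_on ?G \<tau> ?X f" "\<forall>x\<in>C. f x \<noteq> 0"
      "{C \<in> closed_orbits ?G \<tau> ?X. \<forall>x\<in>C. f x \<noteq> 0} \<subseteq> U"
      using openin_categorical_quotient[OF conjunct1[OF U] C] by blast
    have "U \<subseteq> closed_orbits ?G \<tau> ?X"
      using openin_subset[OF conjunct1[OF U]] by (simp only: topspace_categorical_quotient)
    then obtain x0 where x0: "x0 \<in> ?X" "C = orbit ?G \<tau> x0"
      using C unfolding closed_orbits_def by blast
    then have fx0: "f x0 \<noteq> 0" using f(3) mem_orbit_self by blast
    have poly: "polyfun (\<lambda>x. \<Prod>k\<in>T. coord x k)" by (intro polyfun_prod polyfun_coord)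
    let ?x1 = "point (\<lambda>k. if k \<in> T then 1 else 0)"
    have "?x1 \<in> ?X" "(\<Prod>k\<in>T. coord ?x1 k) \<noteq> 0" by (simp_all add: coord_space_def)
    then obtain x where x: "x \<in> ?X" "f x * (\<Prod>k\<in>T. coord x k) \<noteq> 0"
      using prime_vanishing_nonzero[OF prime_vanishing_coord_space f(1) poly x0(1) fx0] by blast
    then have xT: "coord x k \<noteq> 0" if "k \<in> T" for k using that by auto
    have closed: "orbit ?G \<tau> x \<in> closed_orbits ?G \<tau> ?X"
      using closed_orbit_full_support[OF pos x(1) xT] .
    have "\<forall>y\<in>orbit ?G \<tau> x. f y \<noteq> 0"
      using f(2) x by (auto simp: orbit_def invariant_on_def)
    with closed f(4) have "orbit ?G \<tau> x \<in> U" by blast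
    moreover have "isotropy ?G \<tau> x = ?K"
      using K_sub[OF x(1)] xT by (auto simp: mem_isotropy_iff)
    then have "orbit ?G \<tau> x \<in> isotropy_stratum ?G \<tau> ?X ?K"
      unfolding isotropy_stratum_def using closed mem_orbit_self by blast
    ultimately show "isotropy_stratum ?G \<tau> ?X ?K \<inter> U \<noteq> {}" by blast
  qed
qed

end

subsection \<open>Diagonalization of rational representations\<close>

text \<open>Dedekind's argument: translating the dependence by \<open>s\<close> and subtracting
  \<open>tchar \<beta> s\<close> times the original one eliminates \<beta>, and \<open>s\<close> can
  be chosen so as to distinguish \<alpha> from \<beta>.\<close>

lemma tchar_independent:
  fixes A :: "('n::finite \<Rightarrow> int) set"
  assumes "finite A" "\<And>\<alpha> i. \<alpha> \<in> A \<Longrightarrow> i \<notin> J \<Longrightarrow> \<alpha> i = 0"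
    and "\<And>t. t \<in> torus J \<Longrightarrow> (\<Sum>\<alpha>\<in>A. c \<alpha> * tchar \<alpha> t) = 0" and "\<alpha> \<in> A"
  shows "c \<alpha> = 0"
  using assms
proof (induction A arbitrary: c \<alpha>)
  case empty
  then show ?case by simp
next
  case (insert \<beta> A)
  have eq: "c \<beta> * tchar \<beta> t + (\<Sum>\<alpha>\<in>A. c \<alpha> * tchar \<alpha> t) = 0" if "t \<in> torus J" for t
    using insert.prems(2)[OF that] insert.hyps by simp
  have cA: "c \<alpha> = 0" if "\<alpha> \<in> A" for \<alpha>
  proof -
    have diff: "c \<alpha> * (tchar \<alpha> s - tchar \<beta> s) = 0" if s: "s \<in> torus J" for s
    proof (rule insert.IH[where c = "\<lambda>\<alpha>. c \<alpha> * (tchar \<alpha> s - tchar \<beta> s)"])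
      show "\<alpha> i = 0" if "\<alpha> \<in> A" "i \<notin> J" for \<alpha> i using insert.prems(1) that by blast
      show "\<alpha> \<in> A" by fact
      fix t :: "complex^'n" assume t: "t \<in> torus J"
      have "(\<Sum>\<alpha>\<in>A. c \<alpha> * (tchar \<alpha> s - tchar \<beta> s) * tchar \<alpha> t) =
          (c \<beta> * tchar \<beta> (s * t) + (\<Sum>\<alpha>\<in>A. c \<alpha> * tchar \<alpha> (s * t))) -
          tchar \<beta> s * (c \<beta> * tchar \<beta> t + (\<Sum>\<alpha>\<in>A. c \<alpha> * tchar \<alpha> t))"
        by (simp add: tchar_mult sum_distrib_left sum_subtractf algebra_simps)
      then show "(\<Sum>\<alpha>\<in>A. c \<alpha> * (tchar \<alpha> s - tchar \<beta> s) * tchar \<alpha> t) = 0"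
        using eq[OF t] eq[OF mult_in_torus[OF s t]] by simp
    qed
    have "\<alpha> \<noteq> \<beta>" using that insert.hyps by blast
    then obtain i where i: "\<alpha> i \<noteq> \<beta> i" by blast
    have "i \<in> J"
    proof (rule ccontr)
      assume "i \<notin> J"
      then show False using insert.prems(1)[of \<alpha> i] insert.prems(1)[of \<beta> i] that i by simp
    qed
    \<comment> \<open>At this point the characters take the values \<open>exp (\<alpha> i)\<close>
      and \<open>exp (\<beta> i)\<close>, which have different absolute values.\<close>
    define s :: "complex^'n" where "s = (\<chi> j. if j = i then exp 1 else 1)"
    have s: "s \<in> torus J" using \<open>i \<in> J\<close> by (auto simp: s_def torus_def)
    have tchar_s: "tchar \<gamma> s = exp (of_int (\<gamma> i))" for \<gamma>
    proof -
      have "tchar \<gamma> s = (\<Prod>j\<in>UNIV. if j = i then exp (of_int (\<gamma> i)) else 1)"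
        unfolding tchar_def by (intro prod.cong) (auto simp: s_def exp_power_int)
      then show ?thesis by simp
    qed
    have "norm (exp (complex_of_int (\<alpha> i))) \<noteq> norm (exp (complex_of_int (\<beta> i)))" using i by simp
    then have "tchar \<alpha> s \<noteq> tchar \<beta> s" unfolding tchar_s by metis
    then show ?thesis using diff[OF s] by simp
  qed
  then have "c \<beta> = 0" using eq[OF one_in_torus] by simp
  then show ?case using cA insert.prems(3) by blast
qed

text \<open>The exponents vanish outside \<open>J\<close> so that different exponents are different
  characters, as linear independence requires.\<close>

definition laurent_on :: "'n::finite set \<Rightarrow> (complex^'n \<Rightarrow> complex) \<Rightarrow> bool" where
  "laurent_on J f \<longleftrightarrow> (\<exists>A c. finite A \<and> (\<forall>\<alpha>\<in>A. \<forall>i. i \<notin> J \<longrightarrow> \<alpha> i = 0) \<and>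
     (\<forall>t\<in>torus J. f t = (\<Sum>\<alpha>\<in>A. c \<alpha> * tchar \<alpha> t)))"

lemma laurent_on_cong:
  "(\<And>t. t \<in> torus J \<Longrightarrow> f t = g t) \<Longrightarrow> laurent_on J f \<longleftrightarrow> laurent_on J g"
  by (simp add: laurent_on_def)

lemma laurent_on_term: "(\<And>i. i \<notin> J \<Longrightarrow> \<alpha> i = 0) \<Longrightarrow> laurent_on J (\<lambda>t. c * tchar \<alpha> t)"
  unfolding laurent_on_def by (intro exI[of _ "{\<alpha>}"] exI[of _ "\<lambda>_. c"]) simp

lemma laurent_on_const: "laurent_on J (\<lambda>t. c)"
  using laurent_on_term[of J "\<lambda>i. 0" c] by simp

lemma laurent_on_add:
  assumes "laurent_on J f" "laurent_on J g"
  shows "laurent_on J (\<lambda>t. f t + g t)"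
proof -
  obtain A c where A: "finite A" "\<forall>\<alpha>\<in>A. \<forall>i. i \<notin> J \<longrightarrow> \<alpha> i = 0"
    "\<forall>t\<in>torus J. f t = (\<Sum>\<alpha>\<in>A. c \<alpha> * tchar \<alpha> t)"
    using assms(1) unfolding laurent_on_def by blast
  obtain B d where B: "finite B" "\<forall>\<alpha>\<in>B. \<forall>i. i \<notin> J \<longrightarrow> \<alpha> i = 0"
    "\<forall>t\<in>torus J. g t = (\<Sum>\<alpha>\<in>B. d \<alpha> * tchar \<alpha> t)"
    using assms(2) unfolding laurent_on_def by blast
  have extend: "(\<Sum>\<alpha>\<in>C. e \<alpha> * tchar \<alpha> t) = (\<Sum>\<alpha>\<in>A \<union> B. (if \<alpha> \<in> C then e \<alpha> else 0) * tchar \<alpha> t)"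
    if "C \<subseteq> A \<union> B" for C e and t :: "complex^'a"
    using that A(1) B(1) by (intro sum.mono_neutral_cong_left) auto
  show ?thesis
    unfolding laurent_on_def
  proof (intro exI conjI ballI)
    show "finite (A \<union> B)" using A B by simp
    show "\<forall>i. i \<notin> J \<longrightarrow> \<alpha> i = 0" if "\<alpha> \<in> A \<union> B" for \<alpha> using that A(2) B(2) by blast
    fix t :: "complex^'a" assume t: "t \<in> torus J"
    show "f t + g t = (\<Sum>\<alpha>\<in>A \<union> B. ((if \<alpha> \<in> A then c \<alpha> else 0) + (if \<alpha> \<in> B then d \<alpha> else 0)) * tchar \<alpha> t)"
      using A(3) B(3) t extend[of A c t] extend[of B d t] by (simp add: distrib_right sum.distrib)
  qed
qed

lemma laurent_on_sum: "(\<And>i. i \<in> I \<Longrightarrow> laurent_on J (f i)) \<Longrightarrow> laurent_on J (\<lambda>t. \<Sum>i\<in>I. f i t)"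
  by (induction I rule: infinite_finite_induct) (auto intro: laurent_on_add laurent_on_const)

lemma laurent_on_mult:
  assumes "laurent_on J f" "laurent_on J g"
  shows "laurent_on J (\<lambda>t. f t * g t)"
proof -
  obtain A c where A: "finite A" "\<forall>\<alpha>\<in>A. \<forall>i. i \<notin> J \<longrightarrow> \<alpha> i = 0"
    "\<forall>t\<in>torus J. f t = (\<Sum>\<alpha>\<in>A. c \<alpha> * tchar \<alpha> t)"
    using assms(1) unfolding laurent_on_def by blast
  obtain B d where B: "finite B" "\<forall>\<alpha>\<in>B. \<forall>i. i \<notin> J \<longrightarrow> \<alpha> i = 0"
    "\<forall>t\<in>torus J. g t = (\<Sum>\<alpha>\<in>B. d \<alpha> * tchar \<alpha> t)"
    using assms(2) unfolding laurent_on_def by blast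
  have "laurent_on J (\<lambda>t. \<Sum>\<alpha>\<in>A. \<Sum>\<beta>\<in>B. (c \<alpha> * d \<beta>) * tchar (\<lambda>i. \<alpha> i + \<beta> i) t)"
    using A(2) B(2) by (intro laurent_on_sum laurent_on_term) auto
  moreover have "f t * g t = (\<Sum>\<alpha>\<in>A. \<Sum>\<beta>\<in>B. (c \<alpha> * d \<beta>) * tchar (\<lambda>i. \<alpha> i + \<beta> i) t)"
    if "t \<in> torus J" for t
    using A(3) B(3) that by (simp add: sum_product tchar_add mult_ac)
  ultimately show ?thesis by (simp cong: laurent_on_cong)
qed

lemma laurent_on_polyfun: "polyfun p \<Longrightarrow> laurent_on J p"
proof (induction rule: polyfun.induct)
  case (coord i)
  show ?case
  proof (cases "i \<in> J")
    case True
    then have "laurent_on J (\<lambda>t. 1 * tchar (\<lambda>j. if j = i then 1 else 0) t)"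
      by (intro laurent_on_term) auto
    then show ?thesis by (simp add: tchar_unit)
  next
    case False
    then have "t $ i = 1" if "t \<in> torus J" for t :: "complex^'a" using that by (simp add: torus_def)
    then show ?thesis using laurent_on_const[of J 1] by (simp cong: laurent_on_cong)
  qed
qed (auto intro: laurent_on_const laurent_on_add laurent_on_mult)

lemma laurent_on_regular:
  assumes "regular_on (torus J) f"
  shows "laurent_on J f"
proof -
  obtain p k where pk: "polyfun p" "\<forall>t\<in>torus J. f t = p t / (\<Prod>i\<in>UNIV. t $ i) ^ k"
    using assms unfolding regular_on_def by blast
  \<comment> \<open>The denominator of a regular function is the inverse of a character; the
    coordinates outside \<open>J\<close> are 1 and get exponent 0.\<close>
  define \<alpha> where "\<alpha> i = (if i \<in> J then - int k else 0)" for i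
  have "f t = p t * (1 * tchar \<alpha> t)" if "t \<in> torus J" for t
  proof -
    have "tchar \<alpha> t = (\<Prod>i\<in>UNIV. inverse (t $ i ^ k))"
      unfolding tchar_def
      using that by (intro prod.cong) (auto simp: \<alpha>_def torus_def power_int_minus)
    also have "\<dots> = inverse ((\<Prod>i\<in>UNIV. t $ i) ^ k)"
      by (simp add: prod_power_distrib prod_inversef[symmetric] o_def)
    finally show ?thesis using pk(2) that by (simp add: field_simps)
  qed
  moreover have "laurent_on J (\<lambda>t. p t * (1 * tchar \<alpha> t))"
    by (intro laurent_on_mult laurent_on_polyfun pk laurent_on_term) (simp add: \<alpha>_def)
  ultimately show ?thesis by (simp cong: laurent_on_cong)
qed

text \<open>The matrices \<open>M \<alpha>\<close> are the coefficients of the characters in the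
  entries of \<rho>. Expanding both sides of \<open>\<rho> t ** \<rho> s = \<rho> (t * s)\<close> in
  characters of \<open>s\<close> and comparing coefficients shows that their columns are weight
  vectors.\<close>

lemma weight_space_expansion:
  fixes \<rho> :: "complex^'n::finite \<Rightarrow> complex^'m::finite^'m"
  assumes "rational_rep (torus J) \<rho>"
  shows "\<exists>A M. finite A \<and> (\<forall>\<alpha>\<in>A. \<forall>i. i \<notin> J \<longrightarrow> \<alpha> i = 0) \<and>
    (\<forall>t\<in>torus J. \<forall>i j. \<rho> t $ i $ j = (\<Sum>\<alpha>\<in>A. M \<alpha> $ i $ j * tchar \<alpha> t)) \<and>
    (\<forall>\<alpha>\<in>A. \<forall>t\<in>torus J. \<forall>i j. (\<rho> t ** M \<alpha>) $ i $ j = tchar \<alpha> t * M \<alpha> $ i $ j)"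
proof -
  have "\<exists>F. finite (fst F) \<and> (\<forall>\<alpha>\<in>fst F. \<forall>l. l \<notin> J \<longrightarrow> \<alpha> l = 0) \<and>
      (\<forall>t\<in>torus J. \<rho> t $ i $ j = (\<Sum>\<alpha>\<in>fst F. snd F \<alpha> * tchar \<alpha> t))" for i j
  proof -
    have "laurent_on J (\<lambda>t. \<rho> t $ i $ j)"
      using assms by (simp add: rational_rep_def laurent_on_regular)
    then show ?thesis unfolding laurent_on_def by simp
  qed
  then have "\<forall>ij. \<exists>F. finite (fst F) \<and> (\<forall>\<alpha>\<in>fst F. \<forall>l. l \<notin> J \<longrightarrow> \<alpha> l = 0) \<and>
      (\<forall>t\<in>torus J. \<rho> t $ fst ij $ snd ij = (\<Sum>\<alpha>\<in>fst F. snd F \<alpha> * tchar \<alpha> t))" by blast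
  from choice[OF this] obtain F where
    F: "\<forall>ij. finite (fst (F ij)) \<and> (\<forall>\<alpha>\<in>fst (F ij). \<forall>l. l \<notin> J \<longrightarrow> \<alpha> l = 0) \<and>
      (\<forall>t\<in>torus J. \<rho> t $ fst ij $ snd ij = (\<Sum>\<alpha>\<in>fst (F ij). snd (F ij) \<alpha> * tchar \<alpha> t))"
    by (rule exE)
  define A' where "A' i j = fst (F (i, j))" for i j
  define c where "c i j = snd (F (i, j))" for i j
  have A': "finite (A' i j)" "\<forall>\<alpha>\<in>A' i j. \<forall>l. l \<notin> J \<longrightarrow> \<alpha> l = 0"
    "\<forall>t\<in>torus J. \<rho> t $ i $ j = (\<Sum>\<alpha>\<in>A' i j. c i j \<alpha> * tchar \<alpha> t)" for i j
    using F[rule_format, of "(i, j)"] by (simp_all add: A'_def c_def)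
  define A where "A = (\<Union>i. \<Union>j. A' i j)"
  define M :: "('n \<Rightarrow> int) \<Rightarrow> complex^'m^'m" where
    "M \<alpha> = (\<chi> i j. if \<alpha> \<in> A' i j then c i j \<alpha> else 0)" for \<alpha>
  have finA: "finite A" unfolding A_def using A'(1) by auto
  have suppA: "\<alpha> i = 0" if "\<alpha> \<in> A" "i \<notin> J" for \<alpha> i using that A'(2) unfolding A_def by blast
  have expand: "\<rho> t $ i $ j = (\<Sum>\<alpha>\<in>A. M \<alpha> $ i $ j * tchar \<alpha> t)" if "t \<in> torus J" for t i j
  proof -
    have "(\<Sum>\<alpha>\<in>A' i j. c i j \<alpha> * tchar \<alpha> t) = (\<Sum>\<alpha>\<in>A. M \<alpha> $ i $ j * tchar \<alpha> t)"
      using finA by (intro sum.mono_neutral_cong_left) (auto simp: A_def M_def)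
    then show ?thesis using A'(3) that by simp
  qed
  have "(\<rho> t ** M \<alpha>) $ i $ j = tchar \<alpha> t * M \<alpha> $ i $ j" if "\<alpha> \<in> A" and t: "t \<in> torus J" for \<alpha> t i j
  proof -
    have "(\<rho> t ** M \<alpha>) $ i $ j - tchar \<alpha> t * M \<alpha> $ i $ j = 0"
    proof (rule tchar_independent[where c = "\<lambda>\<alpha>. (\<rho> t ** M \<alpha>) $ i $ j - tchar \<alpha> t * M \<alpha> $ i $ j" and J = J])
      fix s assume s: "s \<in> torus J"
      have "(\<Sum>\<alpha>\<in>A. (\<rho> t ** M \<alpha>) $ i $ j * tchar \<alpha> s) = (\<Sum>\<alpha>\<in>A. \<Sum>l\<in>UNIV. \<rho> t $ i $ l * (M \<alpha> $ l $ j * tchar \<alpha> s))"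
        by (simp add: matrix_matrix_mult_def sum_distrib_right mult.assoc)
      also have "\<dots> = (\<Sum>l\<in>UNIV. \<rho> t $ i $ l * \<rho> s $ l $ j)"
        by (subst sum.swap) (simp add: expand[OF s] sum_distrib_left)
      also have "\<dots> = (\<rho> t ** \<rho> s) $ i $ j" by (simp add: matrix_matrix_mult_def)
      also have "\<dots> = \<rho> (t * s) $ i $ j" using assms t s by (simp add: rational_rep_def)
      also have "\<dots> = (\<Sum>\<alpha>\<in>A. tchar \<alpha> t * M \<alpha> $ i $ j * tchar \<alpha> s)"
        by (simp add: expand mult_in_torus t s tchar_mult mult_ac)
      finally show "(\<Sum>\<alpha>\<in>A. ((\<rho> t ** M \<alpha>) $ i $ j - tchar \<alpha> t * M \<alpha> $ i $ j) * tchar \<alpha> s) = 0"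
        by (simp add: left_diff_distrib sum_subtractf)
    qed (use finA suppA \<open>\<alpha> \<in> A\<close> in auto)
    then show ?thesis by simp
  qed
  with finA suppA expand show ?thesis by (intro exI[of _ A] exI[of _ M] conjI) auto
qed

text \<open>The expansion at the point 1 writes every \<open>v\<close> as the sum of the weight
  vectors \<open>M \<alpha> *v v\<close>.\<close>

lemma weight_vectors_span:
  fixes \<rho> :: "complex^'n::finite \<Rightarrow> complex^'m::finite^'m"
  assumes rep: "rational_rep (torus J) \<rho>"
  shows "vec.span {v. \<exists>\<alpha>. (\<forall>i. i \<notin> J \<longrightarrow> \<alpha> i = 0) \<and> (\<forall>t\<in>torus J. \<rho> t *v v = tchar \<alpha> t *s v)} = UNIV"
    (is "vec.span ?E = _")
proof -
  obtain A M where A: "finite A" "\<forall>\<alpha>\<in>A. \<forall>i. i \<notin> J \<longrightarrow> \<alpha> i = 0"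
    and expand: "\<forall>t\<in>torus J. \<forall>i j. \<rho> t $ i $ j = (\<Sum>\<alpha>\<in>A. M \<alpha> $ i $ j * tchar \<alpha> t)"
    and M: "\<forall>\<alpha>\<in>A. \<forall>t\<in>torus J. \<forall>i j. (\<rho> t ** M \<alpha>) $ i $ j = tchar \<alpha> t * M \<alpha> $ i $ j"
    using weight_space_expansion[OF rep] by (elim exE conjE) (rule that)
  have "v \<in> vec.span ?E" for v
  proof -
    have mem: "M \<alpha> *v v \<in> ?E" if "\<alpha> \<in> A" for \<alpha>
    proof -
      have "\<rho> t *v (M \<alpha> *v v) = tchar \<alpha> t *s (M \<alpha> *v v)" if t: "t \<in> torus J" for t
      proof -
        have "\<rho> t *v (M \<alpha> *v v) = (\<rho> t ** M \<alpha>) *v v" by (simp add: matrix_vector_mul_assoc)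
        also have "\<dots> = tchar \<alpha> t *s (M \<alpha> *v v)"
          unfolding vec_eq_iff matrix_vector_mult_def
          by (simp add: M[rule_format, OF \<open>\<alpha> \<in> A\<close> t] sum_distrib_left mult.assoc)
        finally show ?thesis .
      qed
      then show ?thesis using A(2) that by blast
    qed
    have "v = \<rho> 1 *v v" using rep by (simp add: rational_rep_def)
    also have "\<dots> = (\<Sum>\<alpha>\<in>A. M \<alpha> *v v)"
    proof -
      have "(\<rho> 1 *v v) $ i = (\<Sum>\<alpha>\<in>A. M \<alpha> *v v) $ i" for i
      proof -
        have "(\<rho> 1 *v v) $ i = (\<Sum>j\<in>UNIV. \<Sum>\<alpha>\<in>A. M \<alpha> $ i $ j * v $ j)"
          by (simp add: matrix_vector_mult_def expand[rule_format, OF one_in_torus] sum_distrib_right)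
        also have "\<dots> = (\<Sum>\<alpha>\<in>A. \<Sum>j\<in>UNIV. M \<alpha> $ i $ j * v $ j)" by (rule sum.swap)
        finally show ?thesis by (simp add: matrix_vector_mult_def)
      qed
      then show ?thesis by (simp add: vec_eq_iff)
    qed
    also have "\<dots> \<in> vec.span ?E" by (intro vec.span_sum vec.span_base mem)
    finally show ?thesis .
  qed
  then show ?thesis by blast
qed

lemma diagonalization:
  fixes \<rho> :: "complex^'n::finite \<Rightarrow> complex^'m::finite^'m"
  assumes rep: "rational_rep (torus J) \<rho>"
  obtains P P' w where "diagonal_rep J \<rho> P P' w"
proof -
  let ?E = "{v. \<exists>\<alpha>. (\<forall>i. i \<notin> J \<longrightarrow> \<alpha> i = 0) \<and> (\<forall>t\<in>torus J. \<rho> t *v v = tchar \<alpha> t *s v)}"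
  obtain B where B: "B \<subseteq> ?E" "vec.independent B" "?E \<subseteq> vec.span B"
    by (rule vec.maximal_independent_subset[of ?E])
  have "UNIV \<subseteq> vec.span B"
    using vec.span_minimal[OF B(3) vec.subspace_span] unfolding weight_vectors_span[OF rep] .
  then have spanB: "vec.span B = UNIV" by (rule top.extremum_uniqueI)
  have "finite B" using B(2) by (rule vec.finiteI_independent)
  moreover have "card B = card (UNIV :: 'm set)"
    using vec.basis_card_eq_dim[OF _ _ B(2), of UNIV] spanB by (simp add: vec.dim_UNIV card_cart_basis)
  ultimately obtain f :: "'m \<Rightarrow> complex^'m" where f: "bij_betw f UNIV B"
    using finite_same_card_bij[of "UNIV :: 'm set" B] by auto
  have "\<forall>k. \<exists>\<alpha>. (\<forall>i. i \<notin> J \<longrightarrow> \<alpha> i = 0) \<and> (\<forall>t\<in>torus J. \<rho> t *v f k = tchar \<alpha> t *s f k)"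
  proof
    fix k
    have "f k \<in> ?E" by (rule subsetD[OF B(1) bij_betw_apply[OF f UNIV_I]])
    then show "\<exists>\<alpha>. (\<forall>i. i \<notin> J \<longrightarrow> \<alpha> i = 0) \<and> (\<forall>t\<in>torus J. \<rho> t *v f k = tchar \<alpha> t *s f k)"
      by (rule CollectD)
  qed
  from choice[OF this] obtain w where
    "\<forall>k. (\<forall>i. i \<notin> J \<longrightarrow> w k i = 0) \<and> (\<forall>t\<in>torus J. \<rho> t *v f k = tchar (w k) t *s f k)"
    by (rule exE)
  then have w: "\<And>k i. i \<notin> J \<Longrightarrow> w k i = 0"
    "\<And>k t. t \<in> torus J \<Longrightarrow> \<rho> t *v f k = tchar (w k) t *s f k" by simp_all
  define P :: "complex^'m^'m" where "P = (\<chi> i j. f j $ i)"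
  have "column k P = f k" for k by (simp add: P_def column_def vec_eq_iff)
  then have "columns P = B" using f by (auto simp: columns_def bij_betw_def)
  then obtain P' where PP': "P ** P' = mat 1"
    using matrix_right_invertible_span_columns[of P] spanB by auto
  then have P'P: "P' ** P = mat 1" using matrix_left_right_inverse by blast
  have "(P' *v (\<rho> t *v x)) $ k = tchar (w k) t * (P' *v x) $ k" if t: "t \<in> torus J" for t x k
  proof -
    define y where "y = P' *v x"
    have x: "x = P *v y" by (simp add: y_def matrix_vector_mul_assoc PP')
    have "\<rho> t *v (P *v y) = P *v (\<chi> k. tchar (w k) t * y $ k)"
    proof -
      have "(\<rho> t ** P) $ i $ k = tchar (w k) t * P $ i $ k" for i k
      proof -
        have "(\<rho> t ** P) $ i $ k = (\<rho> t *v f k) $ i"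
          by (simp add: matrix_matrix_mult_def matrix_vector_mult_def P_def)
        then show ?thesis by (simp add: w(2)[OF t] P_def)
      qed
      then show ?thesis
        unfolding matrix_vector_mul_assoc
        by (simp add: matrix_vector_mult_def vec_eq_iff mult_ac)
    qed
    then have "P' *v (\<rho> t *v x) = (\<chi> k. tchar (w k) t * y $ k)"
      unfolding x by (simp add: matrix_vector_mul_assoc P'P)
    then show ?thesis by (simp add: y_def)
  qed
  then have "diagonal_rep J \<rho> P P' w"
    by unfold_locales (use PP' P'P w(1) in auto)
  then show ?thesis using that by blast
qed

subsection \<open>Modularity\<close>

lemma closedin_zariski_finite: "finite F \<Longrightarrow> closedin zariski F"
proof -
  assume "finite F"
  have "closedin zariski {y}" for y :: "complex^'a"
    unfolding closedin_zariski_iff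
  proof (intro allI impI)
    fix x assume "x \<notin> {y}"
    then obtain i where "x $ i \<noteq> y $ i" by (auto simp: vec_eq_iff)
    then show "\<exists>p. polyfun p \<and> (\<forall>z\<in>{y}. p z = 0) \<and> p x \<noteq> 0"
      by (intro exI[of _ "\<lambda>x. x $ i - y $ i"]) (auto intro!: polyfun_diff polyfun.coord polyfun.const)
  qed
  then have "closedin zariski (\<Union>y\<in>F. {y})"
    using \<open>finite F\<close> by (intro closedin_Union) auto
  then show ?thesis by simp
qed

section \<open>Krull dimension of one-parameter groups\<close>

definition one_parameter :: "('n::finite \<Rightarrow> int) \<Rightarrow> complex \<Rightarrow> complex^'n" where
  "one_parameter \<nu> s = (\<chi> a. s powi \<nu> a)"

text \<open>Along the group a polynomial becomes a Laurent polynomial in \<open>s\<close>, and a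
  power of \<open>s\<close> clears the negative exponents.\<close>

lemma polyfun_one_parameter:
  assumes "polyfun p"
  shows "\<exists>P N. \<forall>s. s \<noteq> 0 \<longrightarrow> p (one_parameter \<nu> s) * s ^ N = poly P s"
  using assms
proof (induction rule: polyfun.induct)
  case (const c)
  show ?case by (intro exI[of _ "[:c:]"] exI[of _ 0]) simp
next
  case (coord a)
  show ?case
  proof (intro exI allI impI)
    fix s :: complex assume "s \<noteq> 0"
    have "s powi \<nu> a * s ^ nat (- \<nu> a) = s powi (\<nu> a + int (nat (- \<nu> a)))"
      by (simp only: power_int_add[OF disjI1[OF \<open>s \<noteq> 0\<close>]] power_int_of_nat)
    also have "\<nu> a + int (nat (- \<nu> a)) = int (nat (\<nu> a))" by simp
    finally show "one_parameter \<nu> s $ a * s ^ nat (- \<nu> a) = poly (monom 1 (nat (\<nu> a))) s"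
      by (simp only: one_parameter_def vec_lambda_beta power_int_of_nat poly_monom mult_1_left)
  qed
next
  case (add f g)
  from add.IH(1) obtain P N where
    f: "\<forall>s. s \<noteq> 0 \<longrightarrow> f (one_parameter \<nu> s) * s ^ N = poly P s" by (elim exE)
  from add.IH(2) obtain Q M where
    g: "\<forall>s. s \<noteq> 0 \<longrightarrow> g (one_parameter \<nu> s) * s ^ M = poly Q s" by (elim exE)
  have "(f (one_parameter \<nu> s) + g (one_parameter \<nu> s)) * s ^ (N + M) =
      poly (P * monom 1 M + Q * monom 1 N) s" if "s \<noteq> 0" for s
    using that by (simp add: poly_monom power_add algebra_simps f[rule_format, symmetric] g[rule_format, symmetric])
  then show ?case by (intro exI allI impI)
next
  case (mult f g)
  from mult.IH(1) obtain P N where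
    f: "\<forall>s. s \<noteq> 0 \<longrightarrow> f (one_parameter \<nu> s) * s ^ N = poly P s" by (elim exE)
  from mult.IH(2) obtain Q M where
    g: "\<forall>s. s \<noteq> 0 \<longrightarrow> g (one_parameter \<nu> s) * s ^ M = poly Q s" by (elim exE)
  have "f (one_parameter \<nu> s) * g (one_parameter \<nu> s) * s ^ (N + M) = poly (P * Q) s" if "s \<noteq> 0" for s
    using that by (simp add: power_add mult_ac f[rule_format, symmetric] g[rule_format, symmetric])
  then show ?case by (intro exI allI impI)
qed

lemma finite_zeros_one_parameter:
  assumes "polyfun p" "s0 \<noteq> 0" "p (one_parameter \<nu> s0) \<noteq> 0"
  shows "finite {s. s \<noteq> 0 \<and> p (one_parameter \<nu> s) = 0}"
proof -
  obtain P N where P: "\<forall>s. s \<noteq> 0 \<longrightarrow> p (one_parameter \<nu> s) * s ^ N = poly P s"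
    using polyfun_one_parameter[OF assms(1)] by blast
  have "poly P s0 \<noteq> 0" using P assms(2,3) by (metis mult_eq_0_iff power_not_zero)
  then have "P \<noteq> 0" by auto
  then have "finite {s. poly P s = 0}" by (rule poly_roots_finite)
  moreover have "{s. s \<noteq> 0 \<and> p (one_parameter \<nu> s) = 0} \<subseteq> {s. poly P s = 0}"
    using P by (auto simp flip: P[rule_format])
  ultimately show ?thesis by (rule finite_subset[rotated])
qed

lemma infinite_units: "infinite (- {0::complex})"
  by (simp add: infinite_UNIV_char_0 Compl_eq_Diff_UNIV)

text \<open>A secant of this curve may meet it in finitely many points, so the root count is done in
  the parameter \<open>s\<close> and not along lines.\<close>

lemma prime_vanishing_one_parameter: "prime_vanishing (one_parameter \<nu> ` (- {0}))"
  unfolding prime_vanishing_def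
proof (intro conjI allI impI)
  have "(1::complex) \<in> - {0}" by simp
  then show "one_parameter \<nu> ` (- {0}) \<noteq> {}" by blast
  fix p q
  assume pq: "polyfun p \<and> polyfun q \<and> (\<forall>x\<in>one_parameter \<nu> ` (- {0}). p x * q x = 0)"
  show "(\<forall>x\<in>one_parameter \<nu> ` (- {0}). p x = 0) \<or> (\<forall>x\<in>one_parameter \<nu> ` (- {0}). q x = 0)"
  proof (rule ccontr)
    assume "\<not> ?thesis"
    then obtain s1 s2 where "s1 \<noteq> 0" "p (one_parameter \<nu> s1) \<noteq> 0" "s2 \<noteq> 0" "q (one_parameter \<nu> s2) \<noteq> 0"
      by auto
    then have "finite ({s. s \<noteq> 0 \<and> p (one_parameter \<nu> s) = 0} \<union> {s. s \<noteq> 0 \<and> q (one_parameter \<nu> s) = 0})"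
      using finite_zeros_one_parameter pq by blast
    moreover have "- {0} \<subseteq> {s. s \<noteq> 0 \<and> p (one_parameter \<nu> s) = 0} \<union> {s. s \<noteq> 0 \<and> q (one_parameter \<nu> s) = 0}"
      using pq by auto
    ultimately show False using infinite_units finite_subset by blast
  qed
qed

lemma one_parameter_1: "one_parameter \<nu> 1 = 1"
  by (simp add: one_parameter_def vec_eq_iff)

lemma zdim_ge_1:
  assumes "\<nu> a \<noteq> 0" "one_parameter \<nu> ` (- {0}) \<subseteq> X"
  shows "1 \<le> zdim X"
proof -
  let ?S = "\<lambda>i::nat. if i = 0 then {1} else one_parameter \<nu> ` (- {0})"
  have 1: "1 \<in> one_parameter \<nu> ` (- {0})" using one_parameter_1 by (metis ComplI image_eqI singletonD zero_neq_one)
  have "prime_vanishing {1 :: complex^'a}" by (auto simp: prime_vanishing_def)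
  moreover have "polyfun (\<lambda>x. x $ a - 1)" by (intro polyfun_diff polyfun.coord polyfun.const)
  \<comment> \<open>The parameter 2 is not a root of unity, so it yields a point other than
    1.\<close>
  moreover have "one_parameter \<nu> 2 $ a - 1 \<noteq> 0"
  proof
    assume "one_parameter \<nu> 2 $ a - 1 = 0"
    then have "(2::complex) powi \<nu> a = 1" by (simp add: one_parameter_def)
    then have "norm ((2::complex) powi \<nu> a) = 1" by simp
    then have "(2::real) powi \<nu> a = 1" by (simp add: norm_power_int)
    then have "(2::real) powi \<nu> a = 2 powi 0" by simp
    then show False using assms(1) power_int_strict_increasing[of "\<nu> a" 0 "2::real"]
      power_int_strict_increasing[of 0 "\<nu> a" "2::real"] by (cases "\<nu> a < 0") auto
  qed
  moreover have "one_parameter \<nu> 2 \<in> one_parameter \<nu> ` (- {0})" by simp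
  ultimately have "ereal (real 1) \<le> zdim X"
    using 1 assms(2) prime_vanishing_one_parameter
    by (intro zdim_ge[where S = ?S]) (auto intro!: exI[of _ "\<lambda>x. x $ a - 1"])
  then show ?thesis by (simp add: one_ereal_def)
qed

text \<open>A closed proper subset of the curve is finite, and a finite irreducible set is a single
  point. This excludes chains with three members.\<close>

lemma zdim_one_parameter:
  assumes "\<nu> a \<noteq> 0"
  shows "zdim (one_parameter \<nu> ` (- {0})) = 1"
proof (rule antisym)
  let ?K = "one_parameter \<nu> ` (- {0})"
  show "1 \<le> zdim ?K" by (rule zdim_ge_1[of \<nu> a, OF assms order_refl])
  show "zdim ?K \<le> 1"
    unfolding zdim_def krull_dim_def
  proof (rule Sup_least, clarify)
    fix k and Z :: "nat \<Rightarrow> (complex^'a) set"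
    assume Z: "\<forall>i\<le>k. closedin (subtopology zariski ?K) (Z i) \<and> irreducible_in (subtopology zariski ?K) (Z i)"
      and chain: "\<forall>i<k. Z i \<subset> Z (Suc i)"
    have "k \<le> 1"
    proof (rule ccontr)
      assume "\<not> k \<le> 1"
      then have k: "0 < k" "1 < k" "1 \<le> k" "2 \<le> k" by auto
      have Z01: "Z 0 \<subset> Z 1" and Z12: "Z 1 \<subset> Z 2" using chain k by (auto simp: numeral_2_eq_2)
      obtain C where C: "closedin zariski C" "Z 1 = C \<inter> ?K"
        using Z k(3) unfolding closedin_subtopology by blast
      obtain x where x: "x \<in> Z 2" "x \<notin> Z 1" using Z12 by blast
      have "x \<in> ?K" using x(1) Z k(4) closedin_subset by fastforce
      then obtain s0 where s0: "s0 \<noteq> 0" "x = one_parameter \<nu> s0" by auto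
      have "x \<notin> C" using x(2) C(2) \<open>x \<in> ?K\<close> by blast
      then obtain p where p: "polyfun p" "\<forall>y\<in>C. p y = 0" "p x \<noteq> 0"
        using C(1) unfolding closedin_zariski_iff by blast
      have "Z 1 \<subseteq> one_parameter \<nu> ` {s. s \<noteq> 0 \<and> p (one_parameter \<nu> s) = 0}"
        using C(2) p(2) by auto
      then have fin: "finite (Z 1)"
        using finite_zeros_one_parameter[OF p(1) s0(1)] p(3) s0(2) finite_surj by blast
      have "Z 0 \<noteq> {}" using Z unfolding irreducible_in_def by blast
      then obtain y y' where y: "y \<in> Z 0" "y' \<in> Z 1" "y' \<notin> Z 0" using Z01 by blast
      have sub: "Z 1 \<subseteq> ?K" using C(2) by blast
      have "closedin (subtopology zariski ?K) {y}" "closedin (subtopology zariski ?K) (Z 1 - {y})"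
        using sub y(1) Z01 fin by (auto intro!: closedin_subset_topspace closedin_zariski_finite)
      moreover have "irreducible_in (subtopology zariski ?K) (Z 1)" using Z k(3) by blast
      ultimately have "Z 1 \<subseteq> {y} \<or> Z 1 \<subseteq> Z 1 - {y}"
        unfolding irreducible_in_def by blast
      then show False using y Z01 by blast
    qed
    then show "ereal (real k) \<le> 1" by (simp add: one_ereal_def)
  qed
qed

context diagonal_rep
begin

lemma zdim_ge_generic_hyperplane:
  assumes "{v. coord v i = 0 \<and> (\<forall>k. k \<noteq> i \<longrightarrow> coord v k \<noteq> 0)} \<subseteq> X"
  shows "ereal (real (CARD('k) - 1)) \<le> zdim X"
proof -
  define n where "n = CARD('k) - 1"
  have "card (UNIV - {i}) = n" by (simp add: n_def card_Diff_singleton)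
  then obtain g where g: "bij_betw g {0..<n} (UNIV - {i})"
    using ex_bij_betw_nat_finite[of "UNIV - {i}"] by auto
  have g_ne: "g l \<noteq> i" if "l < n" for l using g that by (auto simp: bij_betw_def)
  have g_surj: "\<exists>l<n. k = g l" if "k \<noteq> i" for k
  proof -
    have "k \<in> g ` {0..<n}" using bij_betw_imp_surj_on[OF g] that by simp
    then show ?thesis by auto
  qed
  have g_inj: "g l = g l' \<longleftrightarrow> l = l'" if "l < n" "l' < n" for l l'
    using g that by (auto simp: bij_betw_def inj_on_def)
  \<comment> \<open>In \<open>S j\<close> the first \<open>j\<close> of the remaining coordinates
    vary in the nonzero numbers and the others are 1. Excluding 0 keeps the whole chain inside the
    generic part of the hyperplane.\<close>
  define S where "S j = {v. coord v i = 0 \<and> (\<forall>l<n. coord v (g l) \<noteq> 0 \<and> (j \<le> l \<longrightarrow> coord v (g l) = 1))}" for j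
  have prime: "prime_vanishing (S j)" for j
  proof (rule prime_vanishing_lines)
    have "point (\<lambda>k. if k = i then 0 else 1) \<in> S j" using g_ne by (simp add: S_def)
    then show "S j \<noteq> {}" by blast
    fix x y assume xy: "x \<in> S j" "y \<in> S j"
    have fin: "finite {c. coord x (g l) + c * (coord y (g l) - coord x (g l)) = 0}" if "l < n" for l
    proof -
      have x0: "coord x (g l) \<noteq> 0" using xy(1) that by (simp add: S_def)
      have "{c. coord x (g l) + c * (coord y (g l) - coord x (g l)) = 0} \<subseteq>
          {- coord x (g l) / (coord y (g l) - coord x (g l))}"
      proof
        fix c assume "c \<in> {c. coord x (g l) + c * (coord y (g l) - coord x (g l)) = 0}"
        then have c: "c * (coord y (g l) - coord x (g l)) = - coord x (g l)"
          by (simp add: eq_neg_iff_add_eq_0 add.commute)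
        then have "coord y (g l) - coord x (g l) \<noteq> 0" using x0 by auto
        from iffD2[OF nonzero_eq_divide_eq[OF this] c] show "c \<in> {- coord x (g l) / (coord y (g l) - coord x (g l))}"
          by (simp only: singleton_iff)
      qed
      then show ?thesis by (rule finite_subset) simp
    qed
    \<comment> \<open>The parameters at which the line through x and y meets a coordinate
      hyperplane; there are finitely many, because no such coordinate vanishes at x.\<close>
    let ?bad = "\<Union>l\<in>{0..<n}. {c. coord x (g l) + c * (coord y (g l) - coord x (g l)) = 0}"
    have "finite ?bad" using fin by auto
    then have "infinite (- ?bad)"
      using Diff_infinite_finite infinite_UNIV_char_0 unfolding Compl_eq_Diff_UNIV by blast
    moreover have "- ?bad \<subseteq> {c. x + c *s (y - x) \<in> S j}"
    proof
      fix c assume "c \<in> - ?bad"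
      then have ne: "coord x (g l) + c * (coord y (g l) - coord x (g l)) \<noteq> 0" if "l < n" for l
        using that by auto
      have line: "coord (x + c *s (y - x)) k = coord x k + c * (coord y k - coord x k)" for k
        by (simp only: coord_add coord_scale coord_diff)
      show "c \<in> {c. x + c *s (y - x) \<in> S j}"
        unfolding S_def mem_Collect_eq line
        by (intro conjI allI impI) (use xy ne in \<open>simp_all add: S_def\<close>)
    qed
    ultimately show "infinite {c. x + c *s (y - x) \<in> S j}"
      by (rule infinite_super[rotated])
  qed
  have "ereal (real n) \<le> zdim X"
  proof (rule zdim_ge[where S = S], goal_cases)
    case (1 j)
    have "S j \<subseteq> {v. coord v i = 0 \<and> (\<forall>k. k \<noteq> i \<longrightarrow> coord v k \<noteq> 0)}"
      using g_surj by (auto simp: S_def)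
    then show ?case using prime assms by blast
  next
    case (2 j)
    have "polyfun (\<lambda>v. coord v (g j) - 1)" by (intro polyfun_diff polyfun_coord polyfun.const)
    moreover have "point (\<lambda>k. if k = i then 0 else if k = g j then 2 else 1) \<in> S (Suc j)"
      using g_ne g_inj 2 by (auto simp: S_def)
    moreover have "coord (point (\<lambda>k. if k = i then 0 else if k = g j then 2 else 1)) (g j) - 1 \<noteq> 0"
      using g_ne 2 by simp
    moreover have "\<forall>v\<in>S j. coord v (g j) - 1 = 0" using 2 by (simp add: S_def)
    moreover have "S j \<subseteq> S (Suc j)" by (auto simp: S_def)
    ultimately show ?case by blast
  qed
  then show ?thesis by (simp add: n_def)
qed

text \<open>If the weight \<open>w i\<close> is not involved in any relation, then faithfulness provides a one-parameter
  group acting with weight 1 on the coordinate \<open>i\<close> and trivially on the others; it is the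
  isotropy group of the generic points of the hyperplane on which the coordinate \<open>i\<close> vanishes.\<close>

lemma relation_if_modular:
  assumes faithful: "\<And>t. t \<in> torus J \<Longrightarrow> (\<And>k. tchar (w k) t = 1) \<Longrightarrow> t = 1"
    and modular: "modular 1 (torus J) \<tau>"
  shows "\<exists>c::'k \<Rightarrow> real. relation w c \<and> c i \<noteq> 0"
proof (rule ccontr)
  assume no: "\<not> ?thesis"
  define f :: "'k \<Rightarrow> real^'n" where "f k = (\<chi> a. real_of_int (w k a))" for k
  have "f i \<notin> span (f ` (- {i}))"
  proof
    assume "f i \<in> span (f ` (- {i}))"
    then obtain c where c: "\<And>k. k \<notin> - {i} \<Longrightarrow> c k = 0" "f i = (\<Sum>k\<in>UNIV. c k *\<^sub>R f k)"
      by (rule span_image_combination) blast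
    define d where "d k = c k - (if k = i then 1 else 0)" for k
    have "(\<Sum>k\<in>UNIV. d k * of_int (w k a)) = (\<Sum>k\<in>UNIV. c k *\<^sub>R f k) $ a - f i $ a" for a
      by (simp add: d_def f_def left_diff_distrib sum_subtractf if_distrib[of "\<lambda>x. x * _"] cong: if_cong)
    then have "relation w d" using c(2) by (simp add: relation_def)
    moreover have "d i \<noteq> 0" using c(1) by (simp add: d_def)
    ultimately show False using no by blast
  qed
  then obtain \<mu> where \<mu>: "\<And>v. v \<in> f ` (- {i}) \<Longrightarrow> \<mu> \<bullet> v = 0" "\<mu> \<bullet> f i \<noteq> 0"
    by (rule not_in_span_separation) blast
  have "\<exists>c::'k \<Rightarrow> int. \<forall>b. (\<Sum>k\<in>UNIV. c k * w k b) = (if b = a then 1 else 0)" if "a \<in> J" for a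
    by (rule weights_generate_if_faithful[OF faithful supp that])
  then have "\<forall>a\<in>J. \<exists>c::'k \<Rightarrow> int. \<forall>b. (\<Sum>k\<in>UNIV. c k * w k b) = (if b = a then 1 else 0)" by simp
  from bchoice[OF this] obtain C :: "'n \<Rightarrow> 'k \<Rightarrow> int" where
    "\<forall>a\<in>J. \<forall>b. (\<Sum>k\<in>UNIV. C a k * w k b) = (if b = a then 1 else 0)" by (rule exE)
  then have C: "\<And>a b. a \<in> J \<Longrightarrow> (\<Sum>k\<in>UNIV. C a k * w k b) = (if b = a then 1 else 0)" by simp
  \<comment> \<open>The separating vector \<mu> is real. Integrality comes from writing the unit
    vector \<open>a\<close> as an integral combination of weights: pairing with \<mu> leaves only
    the term of \<open>w i\<close>, so on \<open>J\<close> \<mu> is a multiple of the integral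
    vector of the coefficients at \<open>w i\<close>.\<close>
  define \<nu> where "\<nu> a = (if a \<in> J then C a i else 0)" for a
  have \<mu>_f: "\<mu> \<bullet> f k = (if k = i then \<mu> \<bullet> f i else 0)" for k using \<mu>(1) by auto
  have \<mu>_\<nu>: "\<mu> $ a = of_int (\<nu> a) * (\<mu> \<bullet> f i)" if "a \<in> J" for a
  proof -
    have "(\<Sum>k\<in>UNIV. of_int (C a k) *\<^sub>R f k) $ b = (axis a 1 :: real^'n) $ b" for b
    proof -
      have "(\<Sum>k\<in>UNIV. of_int (C a k) *\<^sub>R f k) $ b = of_int (\<Sum>k\<in>UNIV. C a k * w k b)"
        by (simp add: f_def)
      then show ?thesis by (simp add: C[OF that] axis_def)
    qed
    then have "(\<Sum>k\<in>UNIV. of_int (C a k) *\<^sub>R f k) = (axis a 1 :: real^'n)"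
      by (simp add: vec_eq_iff)
    then have "\<mu> $ a = \<mu> \<bullet> (\<Sum>k\<in>UNIV. of_int (C a k) *\<^sub>R f k)" by (simp add: inner_axis)
    also have "\<dots> = (\<Sum>k\<in>UNIV. of_int (C a k) * (if k = i then \<mu> \<bullet> f i else 0))"
      unfolding inner_sum_right inner_scaleR_right using \<mu>_f by (intro sum.cong) auto
    also have "\<dots> = of_int (\<nu> a) * (\<mu> \<bullet> f i)"
      using that by (simp add: \<nu>_def if_distrib[of "\<lambda>x. _ * x"] cong: if_cong)
    finally show ?thesis .
  qed
  have \<nu>_w: "(\<Sum>a\<in>UNIV. \<nu> a * w k a) = (if k = i then 1 else 0)" for k
  proof -
    have "\<mu> \<bullet> f k = (\<Sum>a\<in>UNIV. \<mu> $ a * of_int (w k a))" by (simp add: inner_vec_def f_def)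
    also have "\<dots> = (\<Sum>a\<in>UNIV. of_int (\<nu> a * w k a) * (\<mu> \<bullet> f i))"
    proof (rule sum.cong[OF refl])
      fix a show "\<mu> $ a * of_int (w k a) = of_int (\<nu> a * w k a) * (\<mu> \<bullet> f i)"
        by (cases "a \<in> J") (simp_all add: \<mu>_\<nu> supp)
    qed
    also have "\<dots> = of_int (\<Sum>a\<in>UNIV. \<nu> a * w k a) * (\<mu> \<bullet> f i)" by (simp add: sum_distrib_right)
    finally have "of_int (\<Sum>a\<in>UNIV. \<nu> a * w k a) * (\<mu> \<bullet> f i) = (if k = i then \<mu> \<bullet> f i else 0)"
      using \<mu>_f[of k] by simp
    then have "real_of_int (\<Sum>a\<in>UNIV. \<nu> a * w k a) = of_int (if k = i then 1 else 0)"
      using \<mu>(2) by (auto split: if_splits)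
    then show ?thesis by (simp only: of_int_eq_iff)
  qed
  have "\<exists>a. \<nu> a \<noteq> 0"
  proof (rule ccontr)
    assume "\<not> ?thesis"
    then show False using \<nu>_w[of i] by simp
  qed
  then obtain a where a: "\<nu> a \<noteq> 0" by blast
  have in_torus: "one_parameter \<nu> s \<in> torus J" if "s \<noteq> 0" for s
    using that by (auto simp: one_parameter_def torus_def \<nu>_def)
  have tchar_one_parameter: "tchar (w k) (one_parameter \<nu> s) = (if k = i then s else 1)" if "s \<noteq> 0" for s k
  proof -
    have "tchar (w k) (one_parameter \<nu> s) = s powi (\<Sum>a\<in>UNIV. \<nu> a * w k a)"
      using that by (simp add: tchar_def one_parameter_def power_int_sum_exponent power_int_mult)
    then show ?thesis by (simp add: \<nu>_w)
  qed
  have isotropy: "isotropy (torus J) \<tau> v = one_parameter \<nu> ` (- {0})"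
    if v: "coord v i = 0" "\<And>k. k \<noteq> i \<Longrightarrow> coord v k \<noteq> 0" for v
  proof (intro equalityI subsetI)
    fix t assume "t \<in> isotropy (torus J) \<tau> v"
    then have t: "t \<in> torus J" "\<And>k. k \<noteq> i \<Longrightarrow> tchar (w k) t = 1"
      using v(2) by (auto simp: mem_isotropy_iff)
    have "t $ b = one_parameter \<nu> (tchar (w i) t) $ b" for b
    proof (cases "b \<in> J")
      case True
      \<comment> \<open>Faithfulness recovers the coordinates of \<open>t\<close> from its character
        values, of which only the one at \<open>w i\<close> can differ from 1.\<close>
      have "t $ b = tchar (\<lambda>a. \<Sum>k\<in>UNIV. C b k * w k a) t" by (simp add: C[OF True] tchar_unit)
      also have "\<dots> = (\<Prod>k\<in>UNIV. tchar (w k) t powi C b k)" by (rule tchar_combination[OF t(1)])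
      also have "\<dots> = (\<Prod>k\<in>UNIV. if k = i then tchar (w i) t powi C b i else 1)"
        using t(2) by (intro prod.cong) auto
      finally show ?thesis using True by (simp add: one_parameter_def \<nu>_def)
    next
      case False
      then show ?thesis using t(1) by (simp add: one_parameter_def \<nu>_def torus_def)
    qed
    then have "t = one_parameter \<nu> (tchar (w i) t)" by (simp add: vec_eq_iff)
    moreover have "tchar (w i) t \<in> - {0}" using tchar_nonzero[OF t(1)] by simp
    ultimately show "t \<in> one_parameter \<nu> ` (- {0})" by blast
  next
    fix t assume "t \<in> one_parameter \<nu> ` (- {0})"
    then show "t \<in> isotropy (torus J) \<tau> v"
      using v(1) in_torus tchar_one_parameter by (auto simp: mem_isotropy_iff)
  qed
  let ?V = "{v. zdim (isotropy (torus J) \<tau> v) = ereal (real 1)}"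
  let ?A = "{v. coord v i = 0 \<and> (\<forall>k. k \<noteq> i \<longrightarrow> coord v k \<noteq> 0)}"
  have "?A \<subseteq> ?V"
    using isotropy zdim_one_parameter[of \<nu> a, OF a] by (auto simp: one_ereal_def)
  then have "ereal (real (CARD('k) - 1)) \<le> zdim ?V"
    by (rule zdim_ge_generic_hyperplane)
  moreover have "ereal (real 1) \<le> zdim (torus J)"
    using zdim_ge_1[of \<nu> a, OF a] in_torus by (auto simp: one_ereal_def)
  \<comment> \<open>Modularity for r = 1 demands codimension at least 2, but the stratum contains
    the generic part of a hyperplane.\<close>
  then have "ereal (real (1 + 1)) \<le> zcodim ?V"
    using modular unfolding modular_def by blast
  moreover have "1 \<le> CARD('k)" using zero_less_card_finite[where 'a = 'k] by linarith
  ultimately show False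
    unfolding zcodim_def by (cases "zdim ?V") (auto simp: of_nat_diff)
qed

end

subsection \<open>The double of a diagonal representation\<close>

definition diagm :: "('m \<Rightarrow> complex) \<Rightarrow> complex^'m::finite^'m" where
  "diagm f = (\<chi> i j. if i = j then f i else 0)"

definition block_diag :: "complex^'m^'m \<Rightarrow> complex^'m^'m \<Rightarrow> complex^('m::finite + 'm)^('m + 'm)" where
  "block_diag A B = (\<chi> i j. case (i, j) of
       (Inl a, Inl b) \<Rightarrow> A $ a $ b
     | (Inr a, Inr b) \<Rightarrow> B $ a $ b
     | _ \<Rightarrow> 0)"

definition double_weights :: "('m \<Rightarrow> 'n \<Rightarrow> int) \<Rightarrow> 'm + 'm \<Rightarrow> 'n \<Rightarrow> int" where
  "double_weights w = case_sum w (\<lambda>k i. - w k i)"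

lemma double_weights_simps [simp]:
  "double_weights w (Inl k) = w k" "double_weights w (Inr k) = (\<lambda>i. - w k i)"
  by (simp_all add: double_weights_def)

lemma double_rep_block: "double_rep \<rho> t = block_diag (\<rho> t) (dual_rep \<rho> t)"
  by (simp add: double_rep_def block_diag_def)

lemma diagm_mult_vec: "diagm f *v x = (\<chi> i. f i * x $ i)"
  by (simp add: diagm_def matrix_vector_mult_def vec_eq_iff if_distrib[of "\<lambda>x. x * _"] cong: if_cong)

lemma block_diag_mult_Inl: "(block_diag A B *v u) $ Inl k = (A *v vpart u) $ k"
  by (simp add: block_diag_def matrix_vector_mult_def sum_UNIV_sum vpart_def)

lemma block_diag_mult_Inr: "(block_diag A B *v u) $ Inr k = (B *v dpart u) $ k"
  by (simp add: block_diag_def matrix_vector_mult_def sum_UNIV_sum dpart_def)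

lemma vec_eq_iff_sum:
  "u = w \<longleftrightarrow> (\<forall>k. u $ Inl k = w $ Inl k) \<and> (\<forall>k. u $ Inr k = w $ Inr k)"
  unfolding vec_eq_iff by (metis sum.exhaust)

lemma vpart_block_diag: "vpart (block_diag A B *v u) = A *v vpart u"
  by (simp add: vec_eq_iff vpart_def[of "block_diag A B *v u"] block_diag_mult_Inl)

lemma dpart_block_diag: "dpart (block_diag A B *v u) = B *v dpart u"
  by (simp add: vec_eq_iff dpart_def[of "block_diag A B *v u"] block_diag_mult_Inr)

lemma block_diag_inverse:
  assumes "A ** A' = mat 1" "B ** B' = mat 1"
  shows "block_diag A B ** block_diag A' B' = mat 1"
  unfolding matrix_eq matrix_vector_mul_assoc[symmetric]
proof
  fix u
  have "A *v (A' *v vpart u) = vpart u" "B *v (B' *v dpart u) = dpart u"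
    by (simp_all add: matrix_vector_mul_assoc assms)
  then show "block_diag A B *v (block_diag A' B' *v u) = mat 1 *v u"
    by (simp add: vec_eq_iff_sum block_diag_mult_Inl block_diag_mult_Inr vpart_block_diag dpart_block_diag)
       (simp add: vpart_def dpart_def)
qed

lemma pairing_transpose: "pairing \<xi> (A *v v) = pairing (transpose A *v \<xi>) v"
proof -
  have "pairing \<xi> (A *v v) = (\<Sum>i\<in>UNIV. \<Sum>j\<in>UNIV. \<xi> $ i * (A $ i $ j * v $ j))"
    by (simp add: pairing_def matrix_vector_mult_def sum_distrib_left)
  also have "\<dots> = (\<Sum>j\<in>UNIV. \<Sum>i\<in>UNIV. \<xi> $ i * (A $ i $ j * v $ j))" by (rule sum.swap)
  also have "\<dots> = pairing (transpose A *v \<xi>) v"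
    unfolding pairing_def matrix_vector_mult_def transpose_def vec_lambda_beta sum_distrib_right
    by (simp add: mult_ac)
  finally show ?thesis .
qed

lemma tchar_vexp: "tchar \<alpha> (vexp a) = exp (\<Sum>i\<in>UNIV. of_int (\<alpha> i) * a $ i)"
  by (simp add: tchar_def vexp_def exp_power_int exp_sum)

lemma vexp_in_torus: "(\<And>i. i \<notin> J \<Longrightarrow> a $ i = 0) \<Longrightarrow> vexp a \<in> torus J"
  by (simp add: vexp_def torus_def)

lemma mem_lie_algebra_torus: "(\<And>i. i \<notin> J \<Longrightarrow> a $ i = 0) \<Longrightarrow> a \<in> lie_algebra (torus J)"
  unfolding lie_algebra_def by (auto intro!: vexp_in_torus)

context diagonal_rep
begin

lemma QQ'_vec: "Q *v (Q' *v x) = x"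
  by (simp only: matrix_vector_mul_assoc QQ' matrix_vector_mul_lid)

lemma Q'Q_vec: "Q' *v (Q *v x) = x"
  by (simp only: matrix_vector_mul_assoc Q'Q matrix_vector_mul_lid)

lemma rep_matrix: "t \<in> torus J \<Longrightarrow> \<tau> t = Q ** diagm (\<lambda>k. tchar (w k) t) ** Q'"
  unfolding matrix_eq matrix_vector_mul_assoc[symmetric]
proof
  fix x assume t: "t \<in> torus J"
  have "Q' *v (\<tau> t *v x) = diagm (\<lambda>k. tchar (w k) t) *v (Q' *v x)"
    by (simp add: vec_eq_iff diag[OF t] diagm_mult_vec)
  then have "Q *v (Q' *v (\<tau> t *v x)) = Q *v (diagm (\<lambda>k. tchar (w k) t) *v (Q' *v x))" by simp
  then show "\<tau> t *v x = Q *v (diagm (\<lambda>k. tchar (w k) t) *v (Q' *v x))"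
    by (simp only: QQ'_vec)
qed

lemma rep_entry:
  "t \<in> torus J \<Longrightarrow> \<tau> t $ i $ j = (\<Sum>k\<in>UNIV. Q $ i $ k * tchar (w k) t * Q' $ k $ j)"
  unfolding rep_matrix
  by (simp add: matrix_matrix_mult_def diagm_def if_distrib[of "\<lambda>x. _ * x"] cong: if_cong)

text \<open>The dual basis is given by the transpose of \<open>Q'\<close>. Transposing the
  diagonalization at the inverse of \<open>t\<close> shows that it has the negative weights.\<close>

lemma double: "diagonal_rep J (double_rep \<tau>) (block_diag Q (transpose Q')) (block_diag Q' (transpose Q))
    (double_weights w)"
proof
  have T: "transpose Q' ** transpose Q = mat 1" "transpose Q ** transpose Q' = mat 1"
    by (simp_all add: matrix_transpose_mul[symmetric] QQ' Q'Q)
  show "block_diag Q (transpose Q') ** block_diag Q' (transpose Q) = mat 1"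
    "block_diag Q' (transpose Q) ** block_diag Q (transpose Q') = mat 1"
    by (intro block_diag_inverse QQ' Q'Q T)+
  show "double_weights w k i = 0" if "i \<notin> J" for k i
    using that by (cases k) (simp_all add: supp)
  fix t x and k :: "'k + 'k" assume t: "t \<in> torus J"
  show "(block_diag Q' (transpose Q) *v (double_rep \<tau> t *v x)) $ k =
      tchar (double_weights w k) t * (block_diag Q' (transpose Q) *v x) $ k"
  proof (cases k)
    case (Inl l)
    then show ?thesis
      by (simp add: block_diag_mult_Inl double_rep_block vpart_block_diag diag[OF t])
  next
    case (Inr l)
    define D where "D = diagm (\<lambda>k. tchar (w k) (vinv t))"
    have DT: "transpose D = D" by (auto simp: D_def diagm_def transpose_def vec_eq_iff)
    have "\<tau> (vinv t) ** Q = Q ** D"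
      unfolding rep_matrix[OF vinv_in_torus[OF t]] D_def[symmetric]
      by (simp add: matrix_mul_assoc[symmetric] Q'Q)
    then have "transpose (\<tau> (vinv t) ** Q) = transpose (Q ** D)" by simp
    then have "transpose Q ** dual_rep \<tau> t = D ** transpose Q"
      by (simp add: matrix_transpose_mul dual_rep_def DT)
    then have "transpose Q *v (dual_rep \<tau> t *v dpart x) = D *v (transpose Q *v dpart x)"
      by (simp only: matrix_vector_mul_assoc)
    then show ?thesis
      using Inr by (simp add: block_diag_mult_Inr double_rep_block dpart_block_diag D_def
          diagm_mult_vec tchar_vinv tchar_uminus)
  qed
qed

lemma infinitesimal_entry:
  assumes "a \<in> lie_algebra (torus J)"
  shows "infinitesimal \<tau> a $ i $ j =
    (\<Sum>k\<in>UNIV. Q $ i $ k * (\<Sum>l\<in>UNIV. of_int (w k l) * a $ l) * Q' $ k $ j)"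
proof -
  have "vexp (s *s a) \<in> torus J" for s using assms by (simp add: lie_algebra_def)
  then have "\<tau> (vexp (s *s a)) $ i $ j =
      (\<Sum>k\<in>UNIV. Q $ i $ k * exp (s * (\<Sum>l\<in>UNIV. of_int (w k l) * a $ l)) * Q' $ k $ j)" for s
    by (simp add: rep_entry tchar_vexp sum_distrib_left mult_ac)
  moreover have "((\<lambda>s. \<Sum>k\<in>UNIV. Q $ i $ k * exp (s * (\<Sum>l\<in>UNIV. of_int (w k l) * a $ l)) * Q' $ k $ j)
      has_field_derivative
      (\<Sum>k\<in>UNIV. Q $ i $ k * (\<Sum>l\<in>UNIV. of_int (w k l) * a $ l) * Q' $ k $ j)) (at 0)"
    by (auto intro!: derivative_eq_intros sum.cong)
  ultimately show ?thesis
    by (simp add: infinitesimal_def DERIV_imp_deriv)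
qed

text \<open>In these coordinates the moment mapping is the combination of the weights with
  coefficients v k times \<xi> k, so points of the shell yield complex relations.\<close>

lemma moment_eq:
  assumes "a \<in> lie_algebra (torus J)"
  shows "moment \<tau> u a = (\<Sum>k\<in>UNIV. (\<Sum>l\<in>UNIV. of_int (w k l) * a $ l) *
    ((block_diag Q' (transpose Q) *v u) $ Inl k * (block_diag Q' (transpose Q) *v u) $ Inr k))"
proof -
  let ?e = "\<lambda>k. \<Sum>l\<in>UNIV. of_int (w k l) * a $ l"
  have "infinitesimal \<tau> a = Q ** diagm ?e ** Q'"
    by (simp add: vec_eq_iff infinitesimal_entry[OF assms] matrix_matrix_mult_def diagm_def
        if_distrib[of "\<lambda>x. _ * x"] cong: if_cong)
  then have "moment \<tau> u a = pairing (dpart u) (Q *v (diagm ?e *v (Q' *v vpart u)))"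
    by (simp only: moment_def matrix_vector_mul_assoc matrix_mul_assoc)
  also have "\<dots> = pairing (transpose Q *v dpart u) (diagm ?e *v (Q' *v vpart u))"
    by (rule pairing_transpose)
  also have "\<dots> = (\<Sum>k\<in>UNIV. (transpose Q *v dpart u) $ k * (?e k * (Q' *v vpart u) $ k))"
    by (simp add: pairing_def diagm_mult_vec)
  also have "\<dots> = (\<Sum>k\<in>UNIV. ?e k * ((Q' *v vpart u) $ k * (transpose Q *v dpart u) $ k))"
    by (simp add: mult_ac)
  finally show ?thesis by (simp add: block_diag_mult_Inl block_diag_mult_Inr)
qed

lemma polyfun_moment: "polyfun (\<lambda>u. moment \<tau> u a)"
  unfolding moment_def pairing_def matrix_vector_mult_def vpart_def dpart_def vec_lambda_beta
  by (intro polyfun_sum polyfun.mult polyfun.coord polyfun.const)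

lemma closedin_shell: "closedin zariski (shell (torus J) \<tau>)"
  unfolding closedin_zariski_iff
proof (intro allI impI)
  fix x assume "x \<notin> shell (torus J) \<tau>"
  then obtain a where "a \<in> lie_algebra (torus J)" "moment \<tau> x a \<noteq> 0" unfolding shell_def by blast
  then show "\<exists>p. polyfun p \<and> (\<forall>y\<in>shell (torus J) \<tau>. p y = 0) \<and> p x \<noteq> 0"
    using polyfun_moment by (intro exI[of _ "\<lambda>u. moment \<tau> u a"]) (auto simp: shell_def)
qed

lemma symp_block_diag:
  "symp (block_diag Q (transpose Q') *v u) (block_diag Q (transpose Q') *v v) = symp u v"
proof -
  have "pairing (transpose Q' *v \<xi>) (Q *v x) = pairing \<xi> x" for \<xi> x
    by (simp only: pairing_transpose[symmetric] Q'Q_vec)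
  then show ?thesis by (simp add: symp_def vpart_block_diag dpart_block_diag)
qed

end

section \<open>Lagrangian submodules given by a choice of signs\<close>

lemma regular_on_tchar: "regular_on (torus J) (tchar \<alpha>)"
  unfolding regular_on_def
proof (intro exI conjI ballI)
  \<comment> \<open>A common shift that makes all exponents nonnegative; it is undone by the power
    of the product of the coordinates.\<close>
  define N where "N = (\<Sum>i\<in>UNIV. \<bar>\<alpha> i\<bar>)"
  have N: "\<bar>\<alpha> i\<bar> \<le> N" for i unfolding N_def by (intro member_le_sum) auto
  show "polyfun (\<lambda>t. \<Prod>i\<in>UNIV. t $ i ^ nat (\<alpha> i + N))"
    by (intro polyfun_prod polyfun_power polyfun.coord)
  fix t :: "complex^'a" assume t: "t \<in> torus J"
  have "t $ i ^ nat (\<alpha> i + N) = (t $ i) powi \<alpha> i * t $ i ^ nat N" for i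
  proof -
    have "\<alpha> i + N \<ge> 0" "N \<ge> 0" using N[of i] by linarith+
    then show ?thesis using torus_nonzero[OF t, of i]
      by (simp add: power_int_nonneg_exp[symmetric] power_int_add)
  qed
  then show "tchar \<alpha> t = (\<Prod>i\<in>UNIV. t $ i ^ nat (\<alpha> i + N)) / (\<Prod>i\<in>UNIV. t $ i) ^ nat N"
    using torus_nonzero[OF t] by (simp add: tchar_def prod.distrib prod_power_distrib)
qed

lemma rational_rep_diagm: "rational_rep (torus J) (\<lambda>t. diagm (\<lambda>k. tchar (w k) t))"
  unfolding rational_rep_def
proof (intro conjI ballI allI)
  show "diagm (\<lambda>k. tchar (w k) 1) = mat 1" by (simp add: diagm_def mat_def)
  show "diagm (\<lambda>k. tchar (w k) (s * t)) = diagm (\<lambda>k. tchar (w k) s) ** diagm (\<lambda>k. tchar (w k) t)" for s t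
    by (simp add: matrix_eq matrix_vector_mul_assoc[symmetric] diagm_mult_vec tchar_mult mult.assoc)
  have "regular_on (torus J) (\<lambda>t. 0)"
    unfolding regular_on_def by (intro exI[of _ "\<lambda>x. 0"]) (auto intro: polyfun.const)
  then show "regular_on (torus J) (\<lambda>t. diagm (\<lambda>k. tchar (w k) t) $ i $ j)" for i j
    using regular_on_tchar[of J "w i"] by (cases "i = j") (simp_all add: diagm_def)
qed

lemma diagonal_rep_diagm:
  "(\<And>k i. i \<notin> J \<Longrightarrow> w k i = 0) \<Longrightarrow> diagonal_rep J (\<lambda>t. diagm (\<lambda>k. tchar (w k) t)) (mat 1) (mat 1) w"
  by unfold_locales (simp_all add: diagm_mult_vec)

text \<open>The symplectic map that exchanges \<open>v k\<close> and \<open>\<xi> k\<close>, up to sign, for \<open>k \<notin> E\<close>.\<close>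

definition flip :: "'m set \<Rightarrow> complex^('m::finite + 'm)^('m + 'm)" where
  "flip E = (\<chi> i j. case i of
       Inl k \<Rightarrow> if k \<in> E then (if j = Inl k then 1 else 0) else (if j = Inr k then - 1 else 0)
     | Inr k \<Rightarrow> if k \<in> E then (if j = Inr k then 1 else 0) else (if j = Inl k then 1 else 0))"

lemma flip_Inl: "(flip E *v u) $ Inl k = (if k \<in> E then u $ Inl k else - u $ Inr k)"
  by (simp add: flip_def matrix_vector_mult_def if_distrib[of "\<lambda>x. x * _"] cong: if_cong)

lemma flip_Inr: "(flip E *v u) $ Inr k = (if k \<in> E then u $ Inr k else u $ Inl k)"
  by (simp add: flip_def matrix_vector_mult_def if_distrib[of "\<lambda>x. x * _"] cong: if_cong)

text \<open>Outside \<open>E\<close> the flip is a quarter turn in each plane, so its inverse is its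
  third power.\<close>

lemma flip_flip_flip_flip: "flip E *v (flip E *v (flip E *v (flip E *v u))) = u"
  by (simp add: vec_eq_iff_sum flip_Inl flip_Inr)

lemma invertible_flip: "invertible (flip E)"
  unfolding invertible_def
  by (intro exI[of _ "flip E ** flip E ** flip E"])
     (simp add: matrix_eq matrix_vector_mul_assoc[symmetric] flip_flip_flip_flip)

lemma symp_flip: "symp (flip E *v u) (flip E *v v) = symp u v"
  unfolding symp_def pairing_def vpart_def dpart_def sum_subtractf[symmetric]
  by (intro sum.cong) (auto simp: flip_Inl flip_Inr algebra_simps)

text \<open>A separate locale, because doubling as a sublocale of \<open>diagonal_rep\<close> itself would be iterated
  forever.\<close>

locale doubled_diagonal_rep = diagonal_rep J \<tau> Q Q' w
  for J :: "'n::finite set"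
    and \<tau> :: "complex^'n \<Rightarrow> complex^'k::finite^'k"
    and Q Q' :: "complex^'k^'k"
    and w :: "'k \<Rightarrow> 'n \<Rightarrow> int"
begin

sublocale double: diagonal_rep J "double_rep \<tau>" "block_diag Q (transpose Q')" "block_diag Q' (transpose Q)"
    "double_weights w"
  by (rule double)

text \<open>Picks one coordinate from each dual pair: \<open>v k\<close> for \<open>k\<close> in
  \<open>E\<close>, \<xi> k otherwise.\<close>

definition half :: "'k set \<Rightarrow> ('k + 'k) set" where
  "half E = Inl ` E \<union> Inr ` (- E)"

definition half_rep :: "'k set \<Rightarrow> complex^'n \<Rightarrow> complex^'k^'k" where
  "half_rep E t = diagm (\<lambda>k. tchar (if k \<in> E then w k else (\<lambda>i. - w k i)) t)"

text \<open>Exchanging the coordinates of a dual pair with one sign change preserves the symplectic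
  form and negates their product. Exactly there the weight is replaced by its negative, so the terms
  of the moment mapping agree.\<close>

lemma double_iso_half:
  "double_iso (torus J) (half_rep E) \<tau> (double.coord_space (half E)) (block_diag Q (transpose Q') ** flip E)"
    (is "double_iso ?G ?\<sigma> \<tau> _ ?\<Phi>")
proof -
  let ?Q = "block_diag Q (transpose Q')"
  let ?w = "\<lambda>k. if k \<in> E then w k else (\<lambda>i. - w k i)"
  have \<sigma>_def: "?\<sigma> = (\<lambda>t. diagm (\<lambda>k. tchar (?w k) t))" by (simp add: half_rep_def fun_eq_iff)
  interpret \<sigma>: doubled_diagonal_rep J ?\<sigma> "mat 1" "mat 1" ?w
    unfolding \<sigma>_def doubled_diagonal_rep_def by (rule diagonal_rep_diagm) (simp add: supp)
  have block_1: "block_diag (mat 1) (mat 1) = (mat 1 :: complex^('k + 'k)^('k + 'k))"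
    by (simp add: matrix_eq vec_eq_iff_sum block_diag_mult_Inl block_diag_mult_Inr transpose_mat vpart_def dpart_def)
  have \<Phi>: "?\<Phi> *v u = ?Q *v (flip E *v u)" for u by (simp add: matrix_vector_mul_assoc)
  have coord_\<Phi>: "double.coord (?\<Phi> *v u) k = (flip E *v u) $ k" for u k
    by (simp only: \<Phi> double.coord_def double.Q'Q_vec)
  have inv: "invertible ?\<Phi>"
    using double.QQ' double.Q'Q by (intro invertible_mult invertible_flip) (auto simp: invertible_def)
  have surj: "\<exists>u. x = ?\<Phi> *v u" for x
  proof -
    obtain \<Psi> where "?\<Phi> ** \<Psi> = mat 1" using inv unfolding invertible_def by blast
    then have "x = ?\<Phi> *v (\<Psi> *v x)" by (simp add: matrix_vector_mul_assoc)
    then show ?thesis ..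
  qed
  have mem: "?\<Phi> *v u \<in> double.coord_space (half E) \<longleftrightarrow> dpart u = 0" for u
  proof -
    have "?\<Phi> *v u \<in> double.coord_space (half E) \<longleftrightarrow>
        (\<forall>k. k \<notin> E \<longrightarrow> (flip E *v u) $ Inl k = 0) \<and> (\<forall>k. k \<in> E \<longrightarrow> (flip E *v u) $ Inr k = 0)"
      unfolding double.coord_space_def mem_Collect_eq coord_\<Phi> split_sum_all by (auto simp: half_def)
    also have "\<dots> \<longleftrightarrow> (\<forall>k. u $ Inr k = 0)" by (auto simp: flip_Inl flip_Inr)
    also have "\<dots> \<longleftrightarrow> dpart u = 0" by (simp add: dpart_def vec_eq_iff)
    finally show ?thesis .
  qed
  have image: "(\<lambda>u. ?\<Phi> *v u) ` {u. dpart u = 0} = double.coord_space (half E)"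
  proof (intro equalityI subsetI)
    fix x assume "x \<in> double.coord_space (half E)"
    moreover obtain u where "x = ?\<Phi> *v u" using surj by blast
    ultimately show "x \<in> (\<lambda>u. ?\<Phi> *v u) ` {u. dpart u = 0}" by (simp add: mem)
  qed (auto simp: mem)
  have equivariant: "?\<Phi> ** double_rep ?\<sigma> t = double_rep \<tau> t ** ?\<Phi>" if t: "t \<in> ?G" for t
    unfolding matrix_eq
  proof
    fix u
    have \<sigma>t: "(double_rep ?\<sigma> t *v u) $ k = tchar (double_weights ?w k) t * u $ k" for k
      using \<sigma>.double.coord_act[OF t, of u k] unfolding \<sigma>.double.coord_def
      by (simp add: block_1 transpose_mat)
    have "double.coord (?\<Phi> *v (double_rep ?\<sigma> t *v u)) k = double.coord (double_rep \<tau> t *v (?\<Phi> *v u)) k" for k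
      unfolding double.coord_act[OF t] coord_\<Phi>
      by (cases k) (auto simp: flip_Inl flip_Inr \<sigma>t tchar_uminus)
    then have "?\<Phi> *v (double_rep ?\<sigma> t *v u) = double_rep \<tau> t *v (?\<Phi> *v u)"
      by (intro double.eq_iff_coord[THEN iffD2] allI)
    then show "(?\<Phi> ** double_rep ?\<sigma> t) *v u = (double_rep \<tau> t ** ?\<Phi>) *v u"
      by (simp only: matrix_vector_mul_assoc)
  qed
  have moment: "moment \<tau> (?\<Phi> *v u) a = moment ?\<sigma> u a" if a: "a \<in> lie_algebra ?G" for u a
  proof -
    have "moment \<tau> (?\<Phi> *v u) a = (\<Sum>k\<in>UNIV. (\<Sum>l\<in>UNIV. of_int (w k l) * a $ l) *
        ((flip E *v u) $ Inl k * (flip E *v u) $ Inr k))"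
      unfolding moment_eq[OF a] double.coord_def[symmetric] coord_\<Phi> ..
    also have "\<dots> = (\<Sum>k\<in>UNIV. (\<Sum>l\<in>UNIV. of_int (?w k l) * a $ l) * (u $ Inl k * u $ Inr k))"
      by (intro sum.cong) (auto simp: flip_Inl flip_Inr sum_negf)
    also have "\<dots> = moment ?\<sigma> u a" unfolding \<sigma>.moment_eq[OF a] by (simp add: block_1 transpose_mat)
    finally show ?thesis .
  qed
  have "(\<lambda>u. ?\<Phi> *v u) ` shell ?G ?\<sigma> = shell ?G \<tau>"
  proof (intro equalityI subsetI)
    fix x assume "x \<in> (\<lambda>u. ?\<Phi> *v u) ` shell ?G ?\<sigma>"
    then show "x \<in> shell ?G \<tau>" using moment by (auto simp: shell_def)
  next
    fix x assume "x \<in> shell ?G \<tau>"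
    moreover obtain u where "x = ?\<Phi> *v u" using surj by blast
    ultimately show "x \<in> (\<lambda>u. ?\<Phi> *v u) ` shell ?G ?\<sigma>" using moment by (auto simp: shell_def)
  qed
  moreover have "symp (?\<Phi> *v u) (?\<Phi> *v v) = symp u v" for u v
    unfolding \<Phi> by (simp add: symp_block_diag symp_flip)
  ultimately show ?thesis
    unfolding double_iso_def using inv equivariant image moment by blast
qed

end

text \<open>\<open>W\<close> is the symplectic image of the standard subspace
  \<open>dpart u = 0\<close>, which is its own annihilator.\<close>

lemma lagrangian_if_double_iso:
  fixes \<rho> :: "complex^'n \<Rightarrow> complex^'m::finite^'m"
  assumes "double_iso G \<sigma> \<rho> W \<Phi>" "vec.subspace W"
  shows "lagrangian W"
proof -
  have symp: "symp (\<Phi> *v u) (\<Phi> *v v) = symp u v" for u v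
    using assms(1) unfolding double_iso_def by blast
  have image: "(\<lambda>u. \<Phi> *v u) ` {u. dpart u = 0} = W" and inv: "invertible \<Phi>"
    using assms(1) unfolding double_iso_def by blast+
  obtain \<Psi> where \<Psi>: "\<Phi> ** \<Psi> = mat 1" using inv unfolding invertible_def by blast
  have symp0: "symp u v = - (\<Sum>i\<in>UNIV. u $ Inr i * v $ Inl i)" if "dpart v = 0" for u v
    using that by (simp add: symp_def pairing_def) (simp add: vpart_def dpart_def)
  have "x \<in> W \<longleftrightarrow> (\<forall>v\<in>W. symp x v = 0)" for x
  proof -
    define u where "u = \<Psi> *v x"
    have x: "x = \<Phi> *v u" by (simp add: u_def matrix_vector_mul_assoc \<Psi>)
    have "dpart u = 0" if zero: "\<And>v. dpart v = 0 \<Longrightarrow> symp u v = 0"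
    proof -
      have "u $ Inr k = 0" for k
      proof -
        define v :: "complex^('m + 'm)" where "v = (\<chi> j. if j = Inl k then 1 else 0)"
        have "dpart v = 0" by (simp add: v_def dpart_def vec_eq_iff)
        moreover have "(\<Sum>i\<in>UNIV. u $ Inr i * v $ Inl i) = u $ Inr k"
          by (simp add: v_def if_distrib[of "\<lambda>x. _ * x"] cong: if_cong)
        ultimately show ?thesis using zero symp0[of v u] by simp
      qed
      then show ?thesis by (simp add: dpart_def vec_eq_iff)
    qed
    moreover have "symp u v = 0" if "dpart u = 0" "dpart v = 0" for v
      using that by (simp add: symp_def pairing_def)
    ultimately have "dpart u = 0 \<longleftrightarrow> (\<forall>v. dpart v = 0 \<longrightarrow> symp u v = 0)" by blast
    also have "\<dots> \<longleftrightarrow> (\<forall>v\<in>W. symp x v = 0)" unfolding image[symmetric] x by (simp add: symp)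
    finally have *: "dpart u = 0 \<longleftrightarrow> (\<forall>v\<in>W. symp x v = 0)" .
    have "x \<in> W \<longleftrightarrow> dpart u = 0"
    proof
      assume "x \<in> W"
      then show "dpart u = 0" unfolding * using assms by (auto simp: image[symmetric] symp) (simp add: symp_def pairing_def)
    next
      assume "dpart u = 0"
      then show "x \<in> W" using image x by blast
    qed
    then show ?thesis using * by simp
  qed
  then show ?thesis unfolding lagrangian_def using assms(2) by blast
qed

section \<open>Relations between the weights trivial on the isotropy group\<close>

context doubled_diagonal_rep
begin

lemma closed_orbit_support_relation:
  assumes u: "u \<in> shell (torus J) \<tau>" and closed: "closedin zariski (orbit (torus J) (double_rep \<tau>) u)"
    and i: "double.coord u (Inl i) \<noteq> 0 \<or> double.coord u (Inr i) \<noteq> 0"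
  shows "\<exists>c::'k \<Rightarrow> real. relation w c \<and>
    (\<forall>k. double.coord u (Inl k) = 0 \<and> double.coord u (Inr k) = 0 \<longrightarrow> c k = 0) \<and> c i \<noteq> 0"
proof (cases "double.coord u (Inl i) \<noteq> 0 \<and> double.coord u (Inr i) \<noteq> 0")
  case True
  define z where "z k = double.coord u (Inl k) * double.coord u (Inr k)" for k
  have z: "(\<Sum>k\<in>UNIV. of_int (w k b) * z k) = 0" for b
  proof (cases "b \<in> J")
    case True
    \<comment> \<open>This element of the Lie algebra extracts the component \<open>b\<close> of the
      shell equation.\<close>
    define a :: "complex^'n" where "a = axis b 1"
    have "a \<in> lie_algebra (torus J)"
      using True by (intro mem_lie_algebra_torus) (auto simp: a_def axis_def)
    moreover have "(\<Sum>l\<in>UNIV. of_int (w k l) * a $ l) = of_int (w k b)" for k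
      by (simp add: a_def axis_def if_distrib[of "\<lambda>x. _ * x"] cong: if_cong)
    moreover have "moment \<tau> u a = 0" using u calculation(1) unfolding shell_def by blast
    ultimately show ?thesis unfolding z_def double.coord_def by (simp add: moment_eq)
  next
    case False
    then show ?thesis by (simp add: supp)
  qed
  have "(\<Sum>k\<in>UNIV. Re (z k) * of_int (w k b)) = Re (\<Sum>k\<in>UNIV. of_int (w k b) * z k)"
    "(\<Sum>k\<in>UNIV. Im (z k) * of_int (w k b)) = Im (\<Sum>k\<in>UNIV. of_int (w k b) * z k)" for b
    by (simp_all add: mult.commute)
  then have rel: "relation w (\<lambda>k. Re (z k))" "relation w (\<lambda>k. Im (z k))"
    unfolding relation_def z by simp_all
  have "z i \<noteq> 0" using True by (simp add: z_def)
  then have "Re (z i) \<noteq> 0 \<or> Im (z i) \<noteq> 0" by (simp add: complex_eq_iff)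
  then show ?thesis
  proof
    assume "Re (z i) \<noteq> 0"
    then show ?thesis using rel by (intro exI[of _ "\<lambda>k. Re (z k)"]) (simp add: z_def)
  next
    assume "Im (z i) \<noteq> 0"
    then show ?thesis using rel by (intro exI[of _ "\<lambda>k. Im (z k)"]) (simp add: z_def)
  qed
next
  case False
  \<comment> \<open>Since \<open>w k\<close> and its negative both occur in the double,
    \<open>p\<close> becomes a relation between the \<open>w k\<close> by taking differences.
    Nothing cancels at \<open>i\<close>, where exactly one of the two coordinates is
    nonzero.\<close>
  from double.closed_orbit_relation[OF closed] obtain p :: "'k + 'k \<Rightarrow> int" where
    p: "relation (double_weights w) p" "\<forall>k. double.coord u k \<noteq> 0 \<longrightarrow> p k > 0"
      "\<forall>k. double.coord u k = 0 \<longrightarrow> p k = 0"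
    by (elim exE conjE)
  have "(\<Sum>k\<in>UNIV. (p (Inl k) - p (Inr k)) * w k b) = 0" for b
    using p(1) by (simp add: relation_def sum_UNIV_sum left_diff_distrib sum_subtractf sum_negf)
  then have "relation w (\<lambda>k. p (Inl k) - p (Inr k))" by (simp add: relation_def)
  then have "relation w (\<lambda>k. of_int (p (Inl k) - p (Inr k)) :: real)" by (rule relation_of_int)
  moreover have "p (Inl i) - p (Inr i) \<noteq> 0"
    using p(2,3) i False by (metis diff_0 diff_zero less_irrefl neg_equal_0_iff_equal)
  moreover have "p (Inl k) - p (Inr k) = 0"
    if "double.coord u (Inl k) = 0 \<and> double.coord u (Inr k) = 0" for k
    using p(3) that by simp
  ultimately show ?thesis
    by (intro exI[of _ "\<lambda>k. of_int (p (Inl k) - p (Inr k)) :: real"]) simp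
qed

text \<open>A weight that is trivial on the common kernel of the weights in \<open>S\<close> is a real linear
  combination of these: otherwise some one-parameter group in the kernel would detect it.\<close>

lemma relation_if_trivial_on_kernel:
  assumes "\<And>t. t \<in> torus J \<Longrightarrow> (\<And>k. k \<in> S \<Longrightarrow> tchar (w k) t = 1) \<Longrightarrow> tchar (w i) t = 1" and "i \<notin> S"
  shows "\<exists>c::'k \<Rightarrow> real. relation w c \<and> (\<forall>k. k \<notin> insert i S \<longrightarrow> c k = 0) \<and> c i \<noteq> 0"
proof -
  define f :: "'k \<Rightarrow> real^'n" where "f k = (\<chi> a. real_of_int (w k a))" for k
  have "f i \<in> span (f ` S)"
  proof (rule ccontr)
    assume "f i \<notin> span (f ` S)"
    then obtain \<mu> where \<mu>: "\<And>v. v \<in> f ` S \<Longrightarrow> \<mu> \<bullet> v = 0" "\<mu> \<bullet> f i \<noteq> 0"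
      by (rule not_in_span_separation) blast
    \<comment> \<open>Scaled so that \<open>w i\<close> takes the value exp 1 at this point of the
      kernel.\<close>
    define a :: "complex^'n" where
      "a = (\<chi> b. if b \<in> J then complex_of_real (\<mu> $ b / (\<mu> \<bullet> f i)) else 0)"
    have t: "vexp a \<in> torus J" by (intro vexp_in_torus) (simp add: a_def)
    have tchar_a: "tchar (w k) (vexp a) = exp (complex_of_real (\<mu> \<bullet> f k / (\<mu> \<bullet> f i)))" for k
    proof -
      have "(\<Sum>b\<in>UNIV. of_int (w k b) * a $ b) =
          (\<Sum>b\<in>UNIV. complex_of_real (\<mu> $ b * of_int (w k b) / (\<mu> \<bullet> f i)))"
        by (intro sum.cong) (auto simp: a_def supp)
      also have "\<dots> = complex_of_real (\<mu> \<bullet> f k / (\<mu> \<bullet> f i))"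
        by (simp add: inner_vec_def f_def sum_divide_distrib)
      finally show ?thesis by (simp only: tchar_vexp)
    qed
    have "tchar (w i) (vexp a) = 1" using \<mu>(1) by (intro assms(1) t) (simp add: tchar_a)
    moreover have "\<mu> \<bullet> f i / (\<mu> \<bullet> f i) = 1" using \<mu>(2) by simp
    ultimately have "exp (complex_of_real 1) = 1" by (simp only: tchar_a)
    then have "norm (exp (complex_of_real 1)) = 1" by (simp only: norm_one)
    then show False by simp
  qed
  then obtain c where c: "\<And>k. k \<notin> S \<Longrightarrow> c k = 0" "f i = (\<Sum>k\<in>UNIV. c k *\<^sub>R f k)"
    by (rule span_image_combination) blast
  define d where "d k = c k - (if k = i then 1 else 0)" for k
  have "(\<Sum>k\<in>UNIV. d k * of_int (w k a)) = (\<Sum>k\<in>UNIV. c k *\<^sub>R f k) $ a - f i $ a" for a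
    by (simp add: d_def f_def left_diff_distrib sum_subtractf if_distrib[of "\<lambda>x. x * _"] cong: if_cong)
  then have "relation w d" by (simp add: relation_def flip: c(2))
  then show ?thesis using c(1) assms(2) by (intro exI[of _ d]) (auto simp: d_def)
qed

text \<open>A negative coefficient at \<open>w k\<close> is a positive coefficient at the weight
  \<open>- w k\<close> of the dual coordinate.\<close>

lemma positively_dependent_double:
  fixes p :: "'k \<Rightarrow> int"
  assumes "relation w p" "\<And>k. k \<in> F \<Longrightarrow> k \<in> E \<Longrightarrow> p k > 0"
    "\<And>k. k \<in> F \<Longrightarrow> k \<notin> E \<Longrightarrow> p k < 0" "\<And>k. k \<notin> F \<Longrightarrow> p k = 0"
  shows "positively_dependent (double_weights w) (Inl ` (F \<inter> E) \<union> Inr ` (F - E))"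
  unfolding positively_dependent_def
proof (intro exI conjI)
  define n :: "'k + 'k \<Rightarrow> int" where
    "n = case_sum (\<lambda>k. if k \<in> E then p k else 0) (\<lambda>k. if k \<in> E then 0 else - p k)"
  have "n (Inl k) * w k a + n (Inr k) * - w k a = p k * w k a" for k a by (simp add: n_def)
  then have "(\<Sum>k\<in>UNIV. n k * double_weights w k a) = (\<Sum>k\<in>UNIV. p k * w k a)" for a
    by (simp only: sum_UNIV_sum double_weights_simps sum.distrib[symmetric])
  then show "relation (double_weights w) n" using assms(1) by (simp add: relation_def)
  show "\<forall>k\<in>Inl ` (F \<inter> E) \<union> Inr ` (F - E). n k > 0" using assms by (auto simp: n_def)
  show "\<forall>k. k \<notin> Inl ` (F \<inter> E) \<union> Inr ` (F - E) \<longrightarrow> n k = 0"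
    unfolding split_sum_all using assms(4) by (auto simp: n_def)
qed

end

section \<open>The choice of signs and the resulting submodule\<close>

theorem theorem1:
  fixes J :: "'n::finite set"
    and G H :: "(complex^'n) set"
    and \<rho> :: "complex^'n \<Rightarrow> complex^'m^'m"
    and u :: "complex^('m::finite + 'm)"
  assumes "G = torus J"
    and "rational_rep G \<rho>"
    and "inj_on \<rho> G"
    and "modular 1 G \<rho>"
    and "u \<in> shell G \<rho>" and "u \<noteq> 0"
    and "closedin (subtopology zariski (shell G \<rho>)) (orbit G (double_rep \<rho>) u)"
    and "H = isotropy G (double_rep \<rho>) u"
  shows "\<exists>V1. lagrangian V1 \<and> submodule G (double_rep \<rho>) V1 \<and>
           (\<exists>\<sigma> \<Phi>. rational_rep G \<sigma> \<and> double_iso G \<sigma> \<rho> V1 \<Phi>) \<and>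
           stable_variety G (double_rep \<rho>) V1 \<and>
           submodule G (double_rep \<rho>) (fixed_space H (double_rep \<rho>) V1) \<and>
           stable_variety G (double_rep \<rho>) (fixed_space H (double_rep \<rho>) V1) \<and>
           principal_isotropy G (double_rep \<rho>) (fixed_space H (double_rep \<rho>) V1) H"
proof -
  note G = assms(1)
  obtain P P' w where "diagonal_rep J \<rho> P P' w"
    by (rule diagonalization[OF assms(2)[unfolded G]])
  then interpret doubled_diagonal_rep J \<rho> P P' w
    by (simp add: doubled_diagonal_rep_def)
  have faithful: "t = 1" if t: "t \<in> torus J" "\<And>k. tchar (w k) t = 1" for t
  proof -
    have "\<rho> t *v x = \<rho> 1 *v x" for x
      by (simp add: eq_iff_coord coord_act t one_in_torus)
    then have "\<rho> t = \<rho> 1" by (simp add: matrix_eq)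
    then show ?thesis using assms(3) t(1) one_in_torus unfolding G inj_on_def by blast
  qed
  have closed: "closedin zariski (orbit (torus J) (double_rep \<rho>) u)"
    using closedin_trans_full[OF assms(7)[unfolded G] closedin_shell] .
  define S where "S = {k. double.coord u (Inl k) \<noteq> 0 \<or> double.coord u (Inr k) \<noteq> 0}"
  have mem_H: "t \<in> H \<longleftrightarrow> t \<in> torus J \<and> (\<forall>k\<in>S. tchar (w k) t = 1)" for t
    unfolding assms(8) G double.mem_isotropy_iff split_sum_all S_def by (auto simp: tchar_uminus)
  then have H_sub: "H \<subseteq> torus J" by blast
  \<comment> \<open>\<open>S\<close> indexes the weights on the support of \<open>u\<close>, and
    \<open>F\<close> the possibly larger set of weights that survive on the space fixed by
    \<open>H\<close>.\<close>
  define F where "F = {k. \<forall>h\<in>H. tchar (w k) h = 1}"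
  have "S \<subseteq> F" using mem_H by (auto simp: F_def)
  have relF: "\<exists>c::'m \<Rightarrow> real. relation w c \<and> (\<forall>k. k \<notin> F \<longrightarrow> c k = 0) \<and> c i \<noteq> 0" if "i \<in> F" for i
  proof (cases "i \<in> S")
    case True
    then have "\<exists>c::'m \<Rightarrow> real. relation w c \<and>
        (\<forall>k. double.coord u (Inl k) = 0 \<and> double.coord u (Inr k) = 0 \<longrightarrow> c k = 0) \<and> c i \<noteq> 0"
      by (intro closed_orbit_support_relation assms(5)[unfolded G] closed) (simp add: S_def)
    then show ?thesis using \<open>S \<subseteq> F\<close> unfolding S_def by blast
  next
    case False
    have "\<exists>c::'m \<Rightarrow> real. relation w c \<and> (\<forall>k. k \<notin> insert i S \<longrightarrow> c k = 0) \<and> c i \<noteq> 0"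
      using that mem_H by (intro relation_if_trivial_on_kernel False) (simp add: F_def)
    then obtain c :: "'m \<Rightarrow> real" where "relation w c" "\<forall>k. k \<notin> insert i S \<longrightarrow> c k = 0" "c i \<noteq> 0"
      by (elim exE conjE)
    then show ?thesis using \<open>S \<subseteq> F\<close> \<open>i \<in> F\<close> by (intro exI[of _ c]) auto
  qed
  have "\<exists>c::'m \<Rightarrow> real. relation w c \<and> (\<forall>k. c k \<noteq> 0 \<longleftrightarrow> k \<in> F)"
    by (rule full_support_relation) (rule relF)
  then obtain c :: "'m \<Rightarrow> real" where
    c: "relation w c" "\<forall>k. c k \<noteq> 0 \<longleftrightarrow> k \<in> F" by (elim exE conjE)
  have "\<exists>d::'m \<Rightarrow> real. relation w d \<and> (\<forall>k. d k \<noteq> 0 \<longleftrightarrow> k \<in> UNIV)"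
  proof (rule full_support_relation)
    fix i
    have "\<exists>c::'m \<Rightarrow> real. relation w c \<and> c i \<noteq> 0"
      by (rule relation_if_modular[OF _ assms(4)[unfolded G]]) (erule faithful; simp)
    then show "\<exists>c::'m \<Rightarrow> real. relation w c \<and> (\<forall>k. k \<notin> UNIV \<longrightarrow> c k = 0) \<and> c i \<noteq> 0" by simp
  qed
  then obtain d :: "'m \<Rightarrow> real" where
    d: "relation w d" "\<forall>k. d k \<noteq> 0 \<longleftrightarrow> k \<in> UNIV" by (elim exE conjE)
  from small_perturbation[of c d] obtain \<delta> where
    \<delta>: "\<forall>k. sgn (c k + \<delta> * d k) = (if c k = 0 then sgn (d k) else sgn (c k))" by (rule exE)
  define e where "e k = c k + \<delta> * d k" for k
  \<comment> \<open>No \<open>e k\<close> is zero, so \<open>E\<close> decides every sign; on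
    \<open>F\<close> its decisions agree with the signs of \<open>c\<close>.\<close>
  define E where "E = {k. e k > 0}"
  have rel_e: "relation w e" unfolding e_def by (intro relation_add relation_scale c(1) d(1))
  have e_c: "sgn (e k) = sgn (c k)" if "k \<in> F" for k using \<delta> c(2) that by (auto simp: e_def)
  have e_nonzero: "e k \<noteq> 0" for k
  proof -
    have "sgn (e k) \<noteq> 0" using \<delta>[rule_format, of k] d(2) by (auto simp: e_def sgn_zero_iff)
    then show ?thesis by (simp add: sgn_zero_iff)
  qed
  obtain p :: "'m \<Rightarrow> int" where p: "relation w p" "\<And>k. p k > 0 \<longleftrightarrow> e k > 0" "\<And>k. p k < 0 \<longleftrightarrow> e k < 0"
    using integral_relation[OF rel_e] by blast
  \<comment> \<open>Two integral relations are needed: \<open>p\<close> has full support and makes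
    \<open>V1\<close> stable, \<open>q\<close> is supported exactly on \<open>F\<close> and makes
    the fixed space stable.\<close>
  obtain q :: "'m \<Rightarrow> int" where q: "relation w q" "\<And>k. q k > 0 \<longleftrightarrow> c k > 0" "\<And>k. q k < 0 \<longleftrightarrow> c k < 0"
    using integral_relation[OF c(1)] by blast
  define T where "T = Inl ` (F \<inter> E) \<union> Inr ` (F - E)"
  have "positively_dependent (double_weights w) (Inl ` (UNIV \<inter> E) \<union> Inr ` (UNIV - E))"
    using p e_nonzero by (intro positively_dependent_double[of p]) (auto simp: E_def not_less less_le)
  then have pos: "positively_dependent (double_weights w) (half E)"
    by (simp add: half_def Compl_eq_Diff_UNIV)
  have posT: "positively_dependent (double_weights w) T"
    unfolding T_def
  proof (rule positively_dependent_double[OF q(1)])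
    fix k
    show "q k > 0" if "k \<in> F" "k \<in> E"
      using e_c[OF that(1)] that(2) by (simp add: q(2) E_def sgn_1_pos)
    show "q k < 0" if "k \<in> F" "k \<notin> E"
    proof -
      have "e k < 0" using that(2) e_nonzero[of k] by (simp add: E_def)
      then show ?thesis using e_c[OF that(1), symmetric] by (simp add: q(3) sgn_1_neg)
    qed
    show "q k = 0" if "k \<notin> F"
      using c(2)[rule_format, of k] q(2)[of k] q(3)[of k] that by simp
  qed
  let ?V1 = "double.coord_space (half E)"
  have iso: "double_iso G (half_rep E) \<rho> ?V1 (block_diag P (transpose P') ** flip E)"
    unfolding G by (rule double_iso_half)
  have "T = {k \<in> half E. \<forall>h\<in>H. tchar (double_weights w k) h = 1}"
  proof -
    have "k \<in> T \<longleftrightarrow> k \<in> half E \<and> (\<forall>h\<in>H. tchar (double_weights w k) h = 1)" for k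
      by (cases k) (auto simp: T_def half_def F_def tchar_uminus)
    then show ?thesis by blast
  qed
  then have fixed: "fixed_space H (double_rep \<rho>) ?V1 = double.coord_space T"
    using double.fixed_space_coord_space[OF H_sub] by simp
  \<comment> \<open>Every weight on the support of \<open>u\<close> occurs in \<open>T\<close> up to
    sign, so the kernel of the weights in \<open>T\<close> cannot be larger than
    \<open>H\<close>.\<close>
  have "H = {t \<in> torus J. \<forall>k\<in>T. tchar (double_weights w k) t = 1}"
  proof (intro equalityI subsetI)
    fix t assume "t \<in> H"
    then show "t \<in> {t \<in> torus J. \<forall>k\<in>T. tchar (double_weights w k) t = 1}"
      using H_sub by (auto simp: T_def F_def tchar_uminus)
  next
    fix t assume t: "t \<in> {t \<in> torus J. \<forall>k\<in>T. tchar (double_weights w k) t = 1}"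
    have "tchar (w k) t = 1" if "k \<in> S" for k
    proof (cases "k \<in> E")
      case True
      then have "Inl k \<in> T" using that \<open>S \<subseteq> F\<close> by (auto simp: T_def)
      then show ?thesis using t by force
    next
      case False
      then have "Inr k \<in> T" using that \<open>S \<subseteq> F\<close> by (auto simp: T_def)
      then have "tchar (double_weights w (Inr k)) t = 1" using t by blast
      then show ?thesis by (simp add: tchar_uminus)
    qed
    then show "t \<in> H" using t by (simp add: mem_H)
  qed
  then have principal: "principal_isotropy G (double_rep \<rho>) (double.coord_space T) H"
    using double.principal_isotropy_coord_space[OF posT] unfolding G by simp
  have "lagrangian ?V1"
    by (rule lagrangian_if_double_iso[OF iso double.subspace_coord_space])
  moreover have "rational_rep G (half_rep E)"
    unfolding half_rep_def[abs_def] G by (rule rational_rep_diagm)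
  ultimately show ?thesis
    using iso principal double.submodule_coord_space[of "half E"] double.submodule_coord_space[of T]
      double.stable_coord_space[OF pos]
      double.stable_coord_space[OF posT]
    unfolding fixed[symmetric] G by (intro exI[of _ ?V1] conjI exI)
qed

end
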